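(* Let $\boldsymbol{g}=(g_1,\ldots,g_m)$ and $F_i=(F_{i,1},\ldots,F_{i,n})$, for $1\le i\le k$, be sequences of polynomials in $\mathbb{Q}[x_1,\ldots,x_n]$. Let $E$ denote the vector space spanned by $\boldsymbol{g}$. Given $\boldsymbol{g}$ and $F_1,\ldots,F_k$ as input, the algorithm $\mathsf{SpecificForm}$ (described in the context) outputs a sequence of polynomials $\mathbf{P}$ in $\mathbb{Q}[\mathbf{x},\mathbf{a}]$, where $\mathbf{x}=(x_1,\ldots,x_n)$ and $\mathbf{a}=(a_1,\ldots,a_n)$, such that, for any $\mathbf{a}\in\mathbb{C}^n$ and any finite sequence $\mathbf{h}$ of polynomials in $\mathbb{Q}[\mathbf{x}]$ with all entries non-zero, the following hold. (i) The polynomials in $\mathbf{P}$ form a basis for the vector space of all polynomial invariants of $\mathcal{L}(\mathbf{a},\mathbf{h},F)$, with $F=(F_1,\ldots,F_k)$, of the form $f(\mathbf{x})-f(\mathbf{a})$, where $f\in E$. (ii) Furthermore, if $d_{\boldsymbol{g}}$ and $d_{F_1},\ldots,d_{F_k}$ are bounds on the degrees of $\boldsymbol{g}$ and $F_1,\ldots,F_k$ respectively, the algorithm performs at most $$O\left(\sum_{i=1}^k d_{\boldsymbol{g}}^{\,n}d_{F_i}^{\,n}\left(\frac{d_{\boldsymbol{g}}^{\,2n}d_{F_i}^{\,n}}{n^{2n}}+m^2\right)\right)=k\cdot m^2\,(d_{\boldsymbol{g}}d_F)^{O(n)}$$ operations in $\mathbb{Q}$, where $d_F=\max\{d_{F_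1},\ldots,d_{F_k}\}$.
   Context: Notation: $[k]=\{1,\ldots,k\}$. Each tuple $F_i$ is identified with the polynomial map $\mathbb{C}^n\to\mathbb{C}^n$ it defines. For $i_1,\ldots,i_r\in[k]$, $F_{i_1,\ldots,i_r}=F_{i_r}\circ\cdots\circ F_{i_1}$, with the empty composition equal to the identity. Branching loop: for $\mathbf{h}=(h_1,\ldots,h_s)$, $\mathcal{L}(\mathbf{a},\mathbf{h},(F_1,\ldots,F_k))$ is the loop which initializes $\mathbf{x}=\mathbf{a}$ and, while $h_1(\mathbf{x})\neq0,\ldots,h_s(\mathbf{x})\neq0$ (equivalently $h(\mathbf{x})\neq0$ with $h=h_1\cdots h_s$), nondeterministically chooses $i\in[k]$ and performs $\mathbf{x}\leftarrow F_i(\mathbf{x})$. A polynomial $p\in\mathbb{C}[\mathbf{x}]$ is a polynomial invariant of the loop if $p(\mathbf{a})=0$ and, for every $r\in\mathbb{N}$ and $i_1,\ldots,i_r\in[k]$, either $p(F_{i_1}(\mathbf{a}))=\cdots=p(F_{i_1,\ldots,i_r}(\mathbf{a}))=0$, or there is $0\le l<r$ such that $p(F_{i_1}(\mathbf{a}))=\cdots=p(F_{i_1,\ldots,i_l}(\mathbf{a}))=0$ and $h(F_{i_1,\ldots,i_l}(\mathbf{a}))=0$. Algorithm $\mathsf{SpecificForm}$, on input $\boldsymbol{g}$ and $F_1,\ldots,F_k$: (1) with new variables $\mathbf{y}=(y_1,\ldots,y_m)$ set $g(\mathbf{x},\mathbf{y})\leftarrow y_1g_1(\mathbf{x})+\cdots+y_mg_m(\mathbf{x})$;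 (2) set $D_i\leftarrow g(\mathbf{x},\mathbf{y})-g(F_i(\mathbf{x}),\mathbf{y})$ for $1\le i\le k$; (3) let $L_1(\mathbf{y}),\ldots,L_r(\mathbf{y})$ be the list of all coefficients of $D_1,\ldots,D_k$ viewed as polynomials in $\mathbf{x}$ with coefficients in $\mathbb{Q}[\mathbf{y}]$ (these are linear forms in $\mathbf{y}$); (4) compute a vector basis $(c_1,\ldots,c_s)$ of the common zero set of $L_1,\ldots,L_r$; (5) return $\big(P_1(\mathbf{x})-P_1(\mathbf{a}),\ldots,P_s(\mathbf{x})-P_s(\mathbf{a})\big)$, where $P_j=\sum_{i=1}^m c_{j,i}\,g_i$ and $c_{j,i}$ is the $i$-th coordinate of $c_j$.
   Formalization: Invariants of the form f(x)-f(a) are those valid for every initial value; P always spans them and is a basis iff 1,g_1,...,g_m are independent; n,m,k and degree bounds are positive; bounds uniform in n need d_g*d_{F_i}>=2 for all i (first) or d_g*d_F>=2 (second). *)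

theory Defs
  imports Complex_Main "HOL-Library.Poly_Mapping" "HOL-Library.State_Monad"
begin

section \<open>Polynomials\<close>

text \<open>
  A monomial is an exponent vector with finite support, a polynomial a finitely supported map from
  monomials to coefficients. The variables are indexed by naturals; in the ring of polynomials in
  \<open>x\<^sub>1, \<dots>, x\<^sub>n\<close> these are the indices below \<open>n\<close>, and in the ring of polynomials in
  \<open>x\<^sub>1, \<dots>, x\<^sub>n, a\<^sub>1, \<dots>, a\<^sub>n\<close> the index of \<open>a\<^sub>i\<close> is that of \<open>x\<^sub>i\<close> plus \<open>n\<close>.
\<close>

type_synonym monomial = "nat \<Rightarrow>\<^sub>0 nat"
type_synonym 'k mpoly = "monomial \<Rightarrow>\<^sub>0 'k"

definition Const :: "'k::zero \<Rightarrow> 'k mpoly" where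
  "Const c = Poly_Mapping.single 0 c"

definition Var :: "nat \<Rightarrow> 'k::zero_neq_one mpoly" where
  "Var i = Poly_Mapping.single (Poly_Mapping.single i 1) 1"

definition indets :: "'k::zero mpoly \<Rightarrow> nat set" where
  "indets p = (\<Union>t\<in>Poly_Mapping.keys p. Poly_Mapping.keys t)"

definition mon_degree :: "monomial \<Rightarrow> nat" where
  "mon_degree t = (\<Sum>i\<in>Poly_Mapping.keys t. Poly_Mapping.lookup t i)"

text \<open>The zero polynomial gets total degree 0.\<close>

definition total_degree :: "'k::zero mpoly \<Rightarrow> nat" where
  "total_degree p = Max (insert 0 (mon_degree ` Poly_Mapping.keys p))"

text \<open>The value of \<open>p\<close> when coefficients are mapped by \<open>e\<close> and the variable \<open>i\<close> is replaced by \<open>v i\<close>.\<close>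

definition meval :: "('k::zero \<Rightarrow> 'r::comm_semiring_1) \<Rightarrow> (nat \<Rightarrow> 'r) \<Rightarrow> 'k mpoly \<Rightarrow> 'r" where
  "meval e v p = (\<Sum>t\<in>Poly_Mapping.keys p. e (Poly_Mapping.lookup p t) *
     (\<Prod>i\<in>Poly_Mapping.keys t. v i ^ Poly_Mapping.lookup t i))"

text \<open>Points of complex \<open>n\<close>-space are complex lists of length \<open>n\<close>.\<close>

definition ceval :: "complex mpoly \<Rightarrow> complex list \<Rightarrow> complex" where
  "ceval p x = meval (\<lambda>c. c) (nth x) p"

definition qeval :: "rat mpoly \<Rightarrow> complex list \<Rightarrow> complex" where
  "qeval p x = meval of_rat (nth x) p"

definition to_complex :: "rat mpoly \<Rightarrow> complex mpoly" where
  "to_complex p = meval (\<lambda>c. Const (of_rat c)) Var p"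

text \<open>Specialize the initial values in a rational polynomial in \<open>2 * n\<close> variables to the point \<open>a\<close>.\<close>

definition at_initial :: "nat \<Rightarrow> complex list \<Rightarrow> rat mpoly \<Rightarrow> complex mpoly" where
  "at_initial n a p =
     meval (\<lambda>c. Const (of_rat c)) (\<lambda>i. if i < n then Var i else Const (a ! (i - n))) p"


section \<open>Loops and their polynomial invariants\<close>

definition apply_map :: "rat mpoly list \<Rightarrow> complex list \<Rightarrow> complex list" where
  "apply_map F x = map (\<lambda>f. qeval f x) F"

text \<open>
  The word \<open>[i\<^sub>1, \<dots>, i\<^sub>r]\<close> acts by \<open>F\<^bsub>i\<^sub>r\<^esub> \<circ> \<dots> \<circ> F\<^bsub>i\<^sub>1\<^esub>\<close>. The maps are numbered from 0.
\<close>

definition run_word :: "rat mpoly list list \<Rightarrow> nat list \<Rightarrow> complex list \<Rightarrow> complex list" where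
  "run_word Fs w x = fold (\<lambda>i. apply_map (Fs ! i)) w x"

definition polynomial_invariant ::
  "complex list \<Rightarrow> rat mpoly list \<Rightarrow> rat mpoly list list \<Rightarrow> complex mpoly \<Rightarrow> bool" where
  "polynomial_invariant a hs Fs p \<longleftrightarrow>
     ceval p a = 0 \<and>
     (\<forall>w. set w \<subseteq> {..<length Fs} \<longrightarrow>
        (\<forall>j\<in>{1..length w}. ceval p (run_word Fs (take j w) a) = 0) \<or>
        (\<exists>l<length w. (\<forall>j\<in>{1..l}. ceval p (run_word Fs (take j w) a) = 0) \<and>
           qeval (prod_list hs) (run_word Fs (take l w) a) = 0))"


section \<open>Spaces of polynomials\<close>

text \<open>
  The informal statement does not say whether vector spaces are over the rationals or over the
  complex numbers. Both readings are covered by the parameter \<open>e\<close>, the embedding of the scalar field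
  into the complex numbers.
\<close>

definition scale :: "('k \<Rightarrow> complex) \<Rightarrow> 'k \<Rightarrow> complex mpoly \<Rightarrow> complex mpoly" where
  "scale e c p = Const (e c) * p"

lemma Const_add: "Const (a + b) = Const a + Const b"
  by (simp add: Const_def single_add)

lemma Const_mult: "Const (a * b) = Const a * (Const b :: 'k::semiring_0 mpoly)"
  by (simp add: Const_def mult_single)

lemma Const_1: "Const 1 = (1 :: 'k::semiring_1 mpoly)"
  by (simp add: Const_def)

lemma vector_space_scale:
  fixes e :: "'k::field \<Rightarrow> complex"
  assumes "e 1 = 1" "\<And>x y. e (x + y) = e x + e y" "\<And>x y. e (x * y) = e x * e y"
  shows "vector_space (scale e)"
  by standard (simp_all add: scale_def assms Const_add Const_mult Const_1 algebra_simps)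

definition spanned :: "('k::field \<Rightarrow> complex) \<Rightarrow> complex mpoly set \<Rightarrow> complex mpoly set" where
  "spanned e S = module.span (scale e) S"

definition lin_independent :: "('k::field \<Rightarrow> complex) \<Rightarrow> complex mpoly list \<Rightarrow> bool" where
  "lin_independent e ps \<longleftrightarrow> distinct ps \<and> \<not> module.dependent (scale e) (set ps)"

definition is_basis ::
  "('k::field \<Rightarrow> complex) \<Rightarrow> complex mpoly list \<Rightarrow> complex mpoly set \<Rightarrow> bool" where
  "is_basis e ps V \<longleftrightarrow> lin_independent e ps \<and> spanned e (set ps) = V"

text \<open>
  The initial value is symbolic: the polynomials \<open>f(x) - f(a)\<close> collected here are those for which
  \<open>f(x) - f(b)\<close> is an invariant for every initial value \<open>b\<close>. If invariance were only required for
  the given \<open>a\<close>, the space would depend on \<open>a\<close> (it jumps, for instance, at a common fixed point of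
  the maps) and no output depending polynomially on \<open>a\<close> could be a basis for all \<open>a\<close>.
\<close>

definition invariants_of_form ::
  "('k::field \<Rightarrow> complex) \<Rightarrow> nat \<Rightarrow> complex list \<Rightarrow> rat mpoly list \<Rightarrow> rat mpoly list \<Rightarrow>
   rat mpoly list list \<Rightarrow> complex mpoly set" where
  "invariants_of_form e n a hs gs Fs =
     {f - Const (ceval f a) | f. f \<in> spanned e (to_complex ` set gs) \<and>
        (\<forall>b. length b = n \<longrightarrow> polynomial_invariant b hs Fs (f - Const (ceval f b)))}"


section \<open>The algorithm\<close>

text \<open>
  Programs live in the state monad; the state counts the rational operations performed so far.
  Rational arithmetic and zero tests are only done by the five operations below. Everything else
  (copying, traversing and indexing data, arithmetic on exponents) is free, as usual when counting
  arithmetic operations.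
\<close>

type_synonym 'a counted = "(nat, 'a) state"

definition counted_op :: "'a \<Rightarrow> 'a counted" where
  "counted_op x = State (\<lambda>c. (x, Suc c))"

definition add_q :: "rat \<Rightarrow> rat \<Rightarrow> rat counted" where
  "add_q x y = counted_op (x + y)"

definition sub_q :: "rat \<Rightarrow> rat \<Rightarrow> rat counted" where
  "sub_q x y = counted_op (x - y)"

definition mul_q :: "rat \<Rightarrow> rat \<Rightarrow> rat counted" where
  "mul_q x y = counted_op (x * y)"

definition div_q :: "rat \<Rightarrow> rat \<Rightarrow> rat counted" where
  "div_q x y = counted_op (x / y)"

definition is_zero_q :: "rat \<Rightarrow> bool counted" where
  "is_zero_q x = counted_op (x = 0)"

primrec fold_state :: "('a \<Rightarrow> 'b \<Rightarrow> 'b counted) \<Rightarrow> 'a list \<Rightarrow> 'b \<Rightarrow> 'b counted" where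
  "fold_state f [] s = State_Monad.return s"
| "fold_state f (x # xs) s = do { s' \<leftarrow> f x s; fold_state f xs s' }"


subsection \<open>Polynomial arithmetic\<close>

definition monomials :: "rat mpoly list \<Rightarrow> monomial list" where
  "monomials ps = sorted_list_of_set (\<Union>p\<in>set ps. Poly_Mapping.keys p)"

definition add_term :: "rat \<Rightarrow> monomial \<Rightarrow> rat mpoly \<Rightarrow> rat mpoly counted" where
  "add_term c t p = do {
     v \<leftarrow> add_q (Poly_Mapping.lookup p t) c;
     State_Monad.return (Poly_Mapping.update t v p) }"

definition sub_term :: "rat \<Rightarrow> monomial \<Rightarrow> rat mpoly \<Rightarrow> rat mpoly counted" where
  "sub_term c t p = do {
     v \<leftarrow> sub_q (Poly_Mapping.lookup p t) c;
     State_Monad.return (Poly_Mapping.update t v p) }"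

text \<open>\<open>add_multiple c s q p\<close> computes \<open>p + c * s * q\<close> for a scalar \<open>c\<close> and a monomial \<open>s\<close>.\<close>

definition add_multiple ::
  "rat \<Rightarrow> monomial \<Rightarrow> rat mpoly \<Rightarrow> rat mpoly \<Rightarrow> rat mpoly counted" where
  "add_multiple c s q p = fold_state (\<lambda>t acc. do {
     v \<leftarrow> mul_q c (Poly_Mapping.lookup q t);
     add_term v (s + t) acc }) (monomials [q]) p"

definition mult_poly :: "rat mpoly \<Rightarrow> rat mpoly \<Rightarrow> rat mpoly counted" where
  "mult_poly p q =
     fold_state (\<lambda>s. add_multiple (Poly_Mapping.lookup p s) s q) (monomials [p]) 0"

definition sub_poly :: "rat mpoly \<Rightarrow> rat mpoly \<Rightarrow> rat mpoly counted" where
  "sub_poly p q = fold_state (\<lambda>t. sub_term (Poly_Mapping.lookup q t) t) (monomials [q]) p"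

definition linear_combination :: "(rat \<times> rat mpoly) list \<Rightarrow> rat mpoly counted" where
  "linear_combination cps = fold_state (\<lambda>(c, p). add_multiple c 0 p) cps 0"

text \<open>The variables of a monomial, each listed as often as its exponent says.\<close>

definition factors :: "monomial \<Rightarrow> nat list" where
  "factors t =
     concat (map (\<lambda>i. replicate (Poly_Mapping.lookup t i) i) (sorted_list_of_set (Poly_Mapping.keys t)))"

definition subst_monomial :: "rat mpoly list \<Rightarrow> monomial \<Rightarrow> rat mpoly counted" where
  "subst_monomial F t = (case factors t of
     [] \<Rightarrow> State_Monad.return 1
   | i # js \<Rightarrow> fold_state (\<lambda>j acc. mult_poly acc (F ! j)) js (F ! i))"

text \<open>
  All \<open>g \<circ> F\<close> for \<open>g\<close> in \<open>gs\<close>; each monomial occurring in \<open>gs\<close> is substituted once only.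
\<close>

definition compose_all :: "rat mpoly list \<Rightarrow> rat mpoly list \<Rightarrow> rat mpoly list counted" where
  "compose_all gs F = do {
     ms \<leftarrow> State_Monad.traverse_list (subst_monomial F) (monomials gs);
     let table = map_of (zip (monomials gs) ms);
     State_Monad.traverse_list (\<lambda>g. linear_combination
       (map (\<lambda>t. (Poly_Mapping.lookup g t, the (table t))) (monomials [g]))) gs }"


subsection \<open>Linear algebra\<close>

definition dot_product :: "rat list \<Rightarrow> rat list \<Rightarrow> rat counted" where
  "dot_product u v = fold_state (\<lambda>(x, y) acc. do { z \<leftarrow> mul_q x y; add_q acc z }) (zip u v) 0"

definition sub_multiple :: "rat list \<Rightarrow> rat \<Rightarrow> rat list \<Rightarrow> rat list counted" where
  "sub_multiple v c w =
     State_Monad.traverse_list (\<lambda>(x, y). do { z \<leftarrow> mul_q c y; sub_q x z }) (zip v w)"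

text \<open>
  From a basis \<open>B\<close> of a space of vectors, compute a basis of its subspace on which the linear form
  with coefficient vector \<open>L\<close> vanishes, eliminating with a basis vector outside this subspace.
\<close>

definition restrict_basis :: "rat list \<Rightarrow> rat list list \<Rightarrow> rat list list counted" where
  "restrict_basis L B = do {
     vals \<leftarrow> State_Monad.traverse_list (dot_product L) B;
     tests \<leftarrow> State_Monad.traverse_list is_zero_q vals;
     let inside = map snd (filter fst (zip tests B));
     let outside = map snd (filter (\<lambda>(z, _). \<not> z) (zip tests (zip vals B)));
     (case outside of
        [] \<Rightarrow> State_Monad.return inside
      | (l\<^sub>0, v\<^sub>0) # rest \<Rightarrow> do {
          rest' \<leftarrow> State_Monad.traverse_list
            (\<lambda>(l, v). do { c \<leftarrow> div_q l l\<^sub>0; sub_multiple v c v\<^sub>0 }) rest;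
          State_Monad.return (inside @ rest') }) }"

definition kernel_basis :: "nat \<Rightarrow> rat list list \<Rightarrow> rat list list counted" where
  "kernel_basis m Ls = fold_state restrict_basis Ls
     (map (\<lambda>i. map (\<lambda>j. if i = j then 1 else 0) [0..<m]) [0..<m])"


subsection \<open>SpecificForm\<close>

text \<open>
  A polynomial \<open>y\<^sub>1 p\<^sub>1(x) + \<dots> + y\<^sub>m p\<^sub>m(x)\<close> that is linear and homogeneous in \<open>y\<close> is represented by
  \<open>[p\<^sub>1, \<dots>, p\<^sub>m]\<close>. So \<open>g(x, y)\<close> is \<open>gs\<close> itself and \<open>D\<^sub>i\<close> consists of the \<open>g\<^sub>j - g\<^sub>j \<circ> F\<^sub>i\<close>.
  Its coefficient at a monomial \<open>t\<close> in \<open>x\<close> is the linear form in \<open>y\<close> whose coefficient vector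
  consists of the coefficients of the \<open>p\<^sub>j\<close> at \<open>t\<close>.
\<close>

definition difference :: "rat mpoly list \<Rightarrow> rat mpoly list \<Rightarrow> rat mpoly list counted" where
  "difference gs F = do {
     gFs \<leftarrow> compose_all gs F;
     State_Monad.traverse_list (\<lambda>(g, gF). sub_poly g gF) (zip gs gFs) }"

definition coefficient_forms :: "rat mpoly list \<Rightarrow> rat list list" where
  "coefficient_forms D = map (\<lambda>t. map (\<lambda>p. Poly_Mapping.lookup p t) D) (monomials D)"

text \<open>The polynomial \<open>P(x) - P(a)\<close> in \<open>2 * n\<close> variables.\<close>

definition shift_monomial :: "nat \<Rightarrow> monomial \<Rightarrow> monomial" where
  "shift_monomial n t =
     (\<Sum>i\<in>Poly_Mapping.keys t. Poly_Mapping.single (n + i) (Poly_Mapping.lookup t i))"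

definition minus_initial :: "nat \<Rightarrow> rat mpoly \<Rightarrow> rat mpoly counted" where
  "minus_initial n P =
     fold_state (\<lambda>t. sub_term (Poly_Mapping.lookup P t) (shift_monomial n t)) (monomials [P]) P"

definition specific_form_counted ::
  "nat \<Rightarrow> rat mpoly list \<Rightarrow> rat mpoly list list \<Rightarrow> rat mpoly list counted" where
  "specific_form_counted n gs Fs = do {
     Ds \<leftarrow> State_Monad.traverse_list (difference gs) Fs;
     B \<leftarrow> kernel_basis (length gs) (concat (map coefficient_forms Ds));
     Ps \<leftarrow> State_Monad.traverse_list (\<lambda>c. linear_combination (zip c gs)) B;
     State_Monad.traverse_list (minus_initial n) Ps }"

definition specific_form :: "nat \<Rightarrow> rat mpoly list \<Rightarrow> rat mpoly list list \<Rightarrow> rat mpoly list" where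
  "specific_form n gs Fs = fst (run_state (specific_form_counted n gs Fs) 0)"

definition specific_form_ops :: "nat \<Rightarrow> rat mpoly list \<Rightarrow> rat mpoly list list \<Rightarrow> nat" where
  "specific_form_ops n gs Fs = snd (run_state (specific_form_counted n gs Fs) 0)"


section \<open>Inputs\<close>

definition valid_input :: "nat \<Rightarrow> rat mpoly list \<Rightarrow> rat mpoly list list \<Rightarrow> bool" where
  "valid_input n gs Fs \<longleftrightarrow>
     (\<forall>g\<in>set gs. indets g \<subseteq> {..<n}) \<and>
     (\<forall>F\<in>set Fs. length F = n \<and> (\<forall>f\<in>set F. indets f \<subseteq> {..<n}))"

text \<open>
  Inputs for the operation count. The degree bounds are positive, since with a bound of 0 the claimed
  number of operations would be 0. For the same reason none of the sequences is empty.
\<close>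

definition sized_input ::
  "nat \<Rightarrow> rat mpoly list \<Rightarrow> rat mpoly list list \<Rightarrow> nat \<Rightarrow> (nat \<Rightarrow> nat) \<Rightarrow> bool" where
  "sized_input n gs Fs dg dF \<longleftrightarrow>
     valid_input n gs Fs \<and> n \<ge> 1 \<and> gs \<noteq> [] \<and> Fs \<noteq> [] \<and>
     dg \<ge> 1 \<and> (\<forall>g\<in>set gs. total_degree g \<le> dg) \<and>
     (\<forall>i<length Fs. dF i \<ge> 1 \<and> (\<forall>f\<in>set (Fs ! i). total_degree f \<le> dF i))"

definition operation_bound :: "nat \<Rightarrow> nat \<Rightarrow> nat \<Rightarrow> nat \<Rightarrow> (nat \<Rightarrow> nat) \<Rightarrow> real" where
  "operation_bound n m k dg dF =
     (\<Sum>i<k. real dg ^ n * real (dF i) ^ n *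
        (real dg ^ (2 * n) * real (dF i) ^ n / real n ^ (2 * n) + real m ^ 2))"

end

theory Submission
  imports Defs "HOL-Computational_Algebra.Polynomial" "HOL-Library.Function_Algebras"
begin

text \<open>
  For a symbolic initial value, \<open>f(x) - f(a)\<close> is an invariant of the loop if and only if \<open>f\<close> is fixed by
  composition with every map: a single iteration shows that \<open>(f \<circ> F\<^sub>i - f) * h\<close> vanishes at every
  point, and \<open>h \<noteq> 0\<close>. For \<open>f\<close> in the span of \<open>g\<^sub>1, \<dots>, g\<^sub>m\<close> this is a linear system in the
  coefficients with rational entries, and its solution space is generated by the rational vectors
  found by elimination, over any field between the rationals and the complex numbers. The map
  \<open>f \<mapsto> f(x) - f(a)\<close> is injective on the solutions exactly if \<open>1, g\<^sub>1, \<dots>, g\<^sub>m\<close> are independent,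
  because a constant in the span of \<open>g\<^sub>1, \<dots>, g\<^sub>m\<close> is itself a solution.

  The operation count is a polynomial in the numbers \<open>N(d) = binom(n + d, n)\<close> of monomials of degree at
  most \<open>d\<close>. The delicate term is the cost of substituting into all monomials,
  \<open>N(d) * (\<Sum>e<d. N(e * f) * N(f))\<close>, where a constant independent of \<open>n\<close> requires estimates that are
  sharp up to \<open>e\<^sup>2 < 8\<close>; they follow from \<open>N(f) * y^n * (1 - y)^f \<le> 1\<close> with a suitable \<open>y\<close>.
\<close>


section \<open>Evaluation homomorphisms\<close>

text \<open>The shape of the operation count comes from one obstacle: against the target d^n f^n (1
  + \<open>ratio\<close>), every loss c^n must be paid for. The handy bound N(d) \<le> (3 (1 +
  d/n))^n loses 27 * 8 = 216 per variable in the substitution cost, and the target has a spare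
  factor d^n that pays for this once d \<ge> 216. That leaves finitely many d, each with its own
  constant. For fixed d the number N(d) is only polynomial in n, and the partial products have size
  at most (d - 1)^n N(f), so the slack is ((d - 1) / d)^n. It absorbs every polynomial in n, but it
  must also outweigh the exponential loss in N(f)^2; the tightest case is d = 2, and this is where
  e^2 < 8 comes from. For d f = 1 the target has base 1 while N(1) = n + 1, so a constant uniform in
  n is sought only for d f \<ge> 2.\<close>

definition mon_value :: "(nat \<Rightarrow> 'r::comm_semiring_1) \<Rightarrow> monomial \<Rightarrow> 'r" where
  "mon_value v t = (\<Prod>i\<in>Poly_Mapping.keys t. v i ^ Poly_Mapping.lookup t i)"

lemma mon_value_superset:
  assumes "finite A" "Poly_Mapping.keys t \<subseteq> A"
  shows "mon_value v t = (\<Prod>i\<in>A. v i ^ Poly_Mapping.lookup t i)"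
  unfolding mon_value_def using assms
  by (intro prod.mono_neutral_left) (auto simp: in_keys_iff)

lemma mon_value_0 [simp]: "mon_value v 0 = 1"
  by (simp add: mon_value_def)

lemma mon_value_single [simp]: "mon_value v (Poly_Mapping.single i k) = v i ^ k"
  by (simp add: mon_value_def)

lemma mon_value_add: "mon_value v (s + t) = mon_value v s * mon_value v t"
proof -
  let ?A = "Poly_Mapping.keys s \<union> Poly_Mapping.keys t"
  have "mon_value v (s + t) = (\<Prod>i\<in>?A. v i ^ Poly_Mapping.lookup (s + t) i)"
    by (rule mon_value_superset) (use keys_add[of s t] in auto)
  also have "\<dots> = (\<Prod>i\<in>?A. v i ^ Poly_Mapping.lookup s i) * (\<Prod>i\<in>?A. v i ^ Poly_Mapping.lookup t i)"
    by (simp add: lookup_add power_add prod.distrib)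
  also have "\<dots> = mon_value v s * mon_value v t"
    by (simp add: mon_value_superset[of ?A])
  finally show ?thesis .
qed

lemma mon_value_sum: "finite A \<Longrightarrow> mon_value v (\<Sum>i\<in>A. f i) = (\<Prod>i\<in>A. mon_value v (f i))"
  by (induction A rule: finite_induct) (auto simp: mon_value_add)

lemma mon_value_cong:
  "(\<And>i. i \<in> Poly_Mapping.keys t \<Longrightarrow> v i = w i) \<Longrightarrow> mon_value v t = mon_value w t"
  unfolding mon_value_def by (rule prod.cong) auto

lemma poly_mapping_sum_single:
  "(\<Sum>t\<in>Poly_Mapping.keys p. Poly_Mapping.single t (Poly_Mapping.lookup p t)) = p"
  by (rule poly_mapping_eqI)
    (auto simp: lookup_sum lookup_single when_def in_keys_iff sum.delta)

lemma meval_mon_value: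
  "meval e v p = (\<Sum>t\<in>Poly_Mapping.keys p. e (Poly_Mapping.lookup p t) * mon_value v t)"
  by (simp add: meval_def mon_value_def)

lemma meval_cong:
  assumes "\<And>i. i \<in> indets p \<Longrightarrow> v i = w i"
  shows "meval e v p = meval e w p"
  unfolding meval_mon_value
  by (intro sum.cong arg_cong2[of _ _ _ _ "(*)"] mon_value_cong refl assms) (auto simp: indets_def)

text \<open>The coefficient map is kept abstract because it occurs as the identity,
  \<open>of_rat\<close>, \<open>Const\<close> and compositions of these. Evaluation along a
  homomorphism is again a homomorphism, so the same facts serve \<open>qeval\<close>,
  \<open>ceval\<close>, \<open>to_complex\<close> and \<open>at_initial\<close>.\<close>

locale ring_homomorphism =
  fixes e :: "'k::comm_ring_1 \<Rightarrow> 'r::comm_ring_1"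
  assumes hom_one [simp]: "e 1 = 1"
    and hom_add: "e (x + y) = e x + e y"
    and hom_mult: "e (x * y) = e x * e y"
begin

lemma hom_zero [simp]: "e 0 = 0"
  using hom_add[of 0 0] by simp

lemma hom_uminus: "e (- x) = - e x"
  using hom_add[of x "- x"] by (simp add: eq_neg_iff_add_eq_0 add.commute)

lemma hom_diff: "e (x - y) = e x - e y"
  using hom_add[of x "- y"] by (simp add: hom_uminus)

lemma hom_sum: "e (sum f A) = (\<Sum>i\<in>A. e (f i))"
  by (induction A rule: infinite_finite_induct) (auto simp: hom_add)

lemma hom_power: "e (x ^ k) = e x ^ k"
  by (induction k) (auto simp: hom_mult)

lemma hom_prod: "e (prod f A) = (\<Prod>i\<in>A. e (f i))"
  by (induction A rule: infinite_finite_induct) (auto simp: hom_mult)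

lemma hom_mon_value: "e (mon_value v t) = mon_value (\<lambda>i. e (v i)) t"
  by (simp add: mon_value_def hom_prod hom_power)

text \<open>Sums, products and powers let the homomorphism pass to the coefficients and to the
  point. This is the substitution principle: evaluating a composed polynomial means evaluating the
  outer one at the image point.\<close>

lemma hom_meval: "e (meval c v p) = meval (\<lambda>x. e (c x)) (\<lambda>i. e (v i)) p"
  by (simp add: meval_mon_value hom_sum hom_mult hom_mon_value)

lemma meval_superset:
  assumes "finite A" "Poly_Mapping.keys p \<subseteq> A"
  shows "meval e v p = (\<Sum>t\<in>A. e (Poly_Mapping.lookup p t) * mon_value v t)"
  unfolding meval_mon_value using assms
  by (intro sum.mono_neutral_left) (auto simp: in_keys_iff)

lemma meval_single: "meval e v (Poly_Mapping.single t c) = e c * mon_value v t"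
  by (simp add: meval_superset[of "{t}"])

lemma meval_Const: "meval e v (Const c) = e c"
  by (simp add: Const_def meval_single)

lemma meval_add: "meval e v (p + q) = meval e v p + meval e v q"
proof -
  let ?A = "Poly_Mapping.keys p \<union> Poly_Mapping.keys q"
  have "meval e v (p + q) = (\<Sum>t\<in>?A. e (Poly_Mapping.lookup (p + q) t) * mon_value v t)"
    by (rule meval_superset) (use keys_add[of p q] in auto)
  also have "\<dots> = meval e v p + meval e v q"
    by (simp add: meval_superset[of ?A] lookup_add hom_add algebra_simps sum.distrib)
  finally show ?thesis .
qed

lemma meval_0: "meval e v 0 = 0"
  by (simp add: meval_def)

lemma meval_sum: "meval e v (sum f A) = (\<Sum>i\<in>A. meval e v (f i))"
  by (induction A rule: infinite_finite_induct) (auto simp: meval_0 meval_add)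

lemma meval_mult: "meval e v (p * q) = meval e v p * meval e v q"
proof -
  have "meval e v (p * q) = meval e v
    ((\<Sum>s\<in>Poly_Mapping.keys p. Poly_Mapping.single s (Poly_Mapping.lookup p s)) *
     (\<Sum>t\<in>Poly_Mapping.keys q. Poly_Mapping.single t (Poly_Mapping.lookup q t)))"
    by (simp only: poly_mapping_sum_single)
  also have "\<dots> = (\<Sum>s\<in>Poly_Mapping.keys p. \<Sum>t\<in>Poly_Mapping.keys q.
      (e (Poly_Mapping.lookup p s) * mon_value v s) * (e (Poly_Mapping.lookup q t) * mon_value v t))"
    by (simp add: sum_product meval_sum mult_single meval_single hom_mult mon_value_add ac_simps)
  also have "\<dots> = meval e v p * meval e v q"
    by (simp add: meval_mon_value sum_product)
  finally show ?thesis .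
qed

lemma ring_homomorphism_meval: "ring_homomorphism (meval e v)"
  by standard (auto simp: meval_add meval_mult meval_Const simp flip: Const_1)

end

lemma ring_homomorphism_Const:
  "ring_homomorphism e \<Longrightarrow> ring_homomorphism (\<lambda>x. Const (e x))"
  by (auto simp: ring_homomorphism_def Const_1 Const_add Const_mult)

interpretation rat_complex: ring_homomorphism "of_rat :: rat \<Rightarrow> complex"
  by standard (auto simp: of_rat_add of_rat_mult)

interpretation qeval: ring_homomorphism "\<lambda>p. qeval p x"
  unfolding qeval_def by (rule rat_complex.ring_homomorphism_meval)

lemma ring_homomorphism_ident: "ring_homomorphism (\<lambda>x. x)"
  by standard auto

interpretation ceval: ring_homomorphism "\<lambda>p. ceval p x"
  unfolding ceval_def by (rule ring_homomorphism.ring_homomorphism_meval[OF ring_homomorphism_ident])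

lemma ceval_Const [simp]: "ceval (Const c) x = c"
  unfolding ceval_def by (rule ring_homomorphism.meval_Const[OF ring_homomorphism_ident])

lemma ceval_Var [simp]: "ceval (Var i) x = x ! i"
  unfolding ceval_def Var_def
  by (subst ring_homomorphism.meval_single[OF ring_homomorphism_ident]) simp

interpretation const_rat: ring_homomorphism "\<lambda>c::rat. Const (of_rat c :: complex)"
  by (intro ring_homomorphism_Const rat_complex.ring_homomorphism_axioms)

interpretation to_complex: ring_homomorphism to_complex
  unfolding to_complex_def[abs_def] by (rule const_rat.ring_homomorphism_meval)

text \<open>Makes \<open>to_complex\<close>, an evaluation at the variables, a plain change of
  coefficients.\<close>

lemma mon_value_Var: "mon_value Var t = (Poly_Mapping.single t 1 :: 'k::comm_semiring_1 mpoly)"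
proof -
  have pow: "(Var i :: 'k mpoly) ^ k = Poly_Mapping.single (Poly_Mapping.single i k) 1" for i k
    by (induction k) (auto simp: Var_def mult_single simp flip: single_add)
  have "(\<Prod>i\<in>A. (Var i :: 'k mpoly) ^ f i) = Poly_Mapping.single (\<Sum>i\<in>A. Poly_Mapping.single i (f i)) 1"
    if "finite A" for A f
    using that by (induction A rule: finite_induct) (auto simp: pow mult_single)
  then show ?thesis
    by (simp add: mon_value_def poly_mapping_sum_single)
qed

lemma lookup_to_complex [simp]:
  "Poly_Mapping.lookup (to_complex p) t = of_rat (Poly_Mapping.lookup p t)"
  by (auto simp: to_complex_def meval_mon_value mon_value_Var Const_def mult_single lookup_sum
      lookup_single when_def in_keys_iff sum.delta)

lemma keys_to_complex [simp]: "Poly_Mapping.keys (to_complex p) = Poly_Mapping.keys p"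
  by (auto simp: in_keys_iff)

lemma indets_to_complex [simp]: "indets (to_complex p) = indets p"
  by (simp add: indets_def)

lemma to_complex_eq_0_iff [simp]: "to_complex p = 0 \<longleftrightarrow> p = 0"
  by (simp flip: keys_eq_empty)

lemma ceval_to_complex [simp]: "ceval (to_complex p) x = qeval p x"
  by (simp add: to_complex_def ceval.hom_meval qeval_def)

text \<open>Kronecker's substitution \<open>x\<^sub>i \<mapsto> z^(b^i)\<close> is injective on monomials with exponents below \<open>b\<close>.\<close>

lemma base_digits_inj:
  fixes f g :: "nat \<Rightarrow> nat"
  assumes "(\<Sum>i<n. f i * b ^ i) = (\<Sum>i<n. g i * b ^ i)"
    and "\<And>i. i < n \<Longrightarrow> f i < b" "\<And>i. i < n \<Longrightarrow> g i < b" "i < n"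
  shows "f i = g i"
  using assms
proof (induction n arbitrary: f g i)
  case (Suc n)
  have split: "(\<Sum>i<Suc n. h i * b ^ i) = h 0 + b * (\<Sum>i<n. h (Suc i) * b ^ i)" for h
    by (subst sum.lessThan_Suc_shift) (simp add: sum_distrib_left ac_simps)
  have eq: "f 0 + b * (\<Sum>i<n. f (Suc i) * b ^ i) = g 0 + b * (\<Sum>i<n. g (Suc i) * b ^ i)"
    using Suc.prems(1) by (simp only: split)
  have lt: "f 0 < b" "g 0 < b"
    using Suc.prems by auto
  have 0: "f 0 = g 0"
    using arg_cong[OF eq, of "\<lambda>x. x mod b"] lt by simp
  then have "(\<Sum>i<n. f (Suc i) * b ^ i) = (\<Sum>i<n. g (Suc i) * b ^ i)"
    using eq lt by auto
  then have "f (Suc j) = g (Suc j)" if "j < n" for j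
    using Suc.IH[of "\<lambda>i. f (Suc i)" "\<lambda>i. g (Suc i)" j] Suc.prems that by auto
  with 0 Suc.prems(4) show ?case
    by (cases i) auto
qed simp

text \<open>Restriction to the curve with coordinates z^(b^i) leaves a univariate polynomial. As
  \<open>code\<close> is injective on the support, no two terms merge, so the coefficients of
  \<open>p\<close> survive; a univariate polynomial that vanishes at every complex number is
  zero.\<close>

lemma vanishing_polynomial:
  fixes p :: "complex mpoly"
  assumes ind: "indets p \<subseteq> {..<n}" and van: "\<And>x. length x = n \<Longrightarrow> ceval p x = 0"
  shows "p = 0"
proof -
  let ?K = "Poly_Mapping.keys p"
  define E where "E = (\<Union>t\<in>?K. Poly_Mapping.lookup t ` {..<n})"
  \<comment> \<open>Larger than every exponent, so that the exponents of a monomial are the base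
    \<open>b\<close> digits of its code.\<close>
  define b where "b = Suc (Max E)"
  have "finite E"
    by (auto simp: E_def)
  then have b: "Poly_Mapping.lookup t i < b" if "t \<in> ?K" "i < n" for t i
    using that unfolding b_def E_def by (intro le_imp_less_Suc Max_ge) auto
  have keys: "Poly_Mapping.keys t \<subseteq> {..<n}" if "t \<in> ?K" for t
    using that ind by (auto simp: indets_def)
  define code where "code t = (\<Sum>i<n. Poly_Mapping.lookup t i * b ^ i)" for t
  have inj: "inj_on code ?K"
  proof (rule inj_onI)
    fix s t assume st: "s \<in> ?K" "t \<in> ?K" "code s = code t"
    show "s = t"
    proof (rule poly_mapping_eqI)
      fix i
      show "Poly_Mapping.lookup s i = Poly_Mapping.lookup t i"
      proof (cases "i < n")
        case True
        show ?thesis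
          by (rule base_digits_inj[where n = n and b = b])
            (use st b True in \<open>auto simp only: code_def\<close>)
      next
        case False
        with st keys show ?thesis
          by (metis in_keys_iff lessThan_iff subsetD)
      qed
    qed
  qed
  define u where "u = (\<Sum>t\<in>?K. monom (Poly_Mapping.lookup p t) (code t))"
  have "poly u z = 0" for z
  proof -
    define x where "x = map (\<lambda>i. z ^ (b ^ i)) [0..<n]"
    have "mon_value (nth x) t = z ^ code t" if "t \<in> ?K" for t
    proof -
      have "mon_value (nth x) t = (\<Prod>i<n. (x ! i) ^ Poly_Mapping.lookup t i)"
        by (rule mon_value_superset) (use keys that in auto)
      also have "\<dots> = (\<Prod>i<n. z ^ (Poly_Mapping.lookup t i * b ^ i))"
        by (rule prod.cong) (auto simp: x_def mult.commute simp flip: power_mult)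
      finally show ?thesis
        by (simp add: code_def power_sum)
    qed
    then have "poly u z = ceval p x"
      by (simp add: u_def poly_sum poly_monom ceval_def meval_mon_value)
    also have "\<dots> = 0"
      by (rule van) (simp add: x_def)
    finally show ?thesis .
  qed
  then have "u = 0"
    using poly_all_0_iff_0 by blast
  have "Poly_Mapping.lookup p t = 0" if "t \<in> ?K" for t
  proof -
    have "coeff u (code t) = (\<Sum>s\<in>?K. if s = t then Poly_Mapping.lookup p s else 0)"
      unfolding u_def coeff_sum
      by (rule sum.cong) (use inj that in \<open>auto simp: inj_on_def\<close>)
    with \<open>u = 0\<close> that show ?thesis
      by simp
  qed
  then show ?thesis
    by (metis in_keys_iff poly_mapping_eqI lookup_zero)
qed


section \<open>Numbers of monomials\<close>

definition num_mon :: "nat \<Rightarrow> nat \<Rightarrow> nat" where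
  "num_mon n d = (n + d) choose n"

lemma num_mon_0 [simp]: "num_mon 0 d = 1"
  by (simp add: num_mon_def)

lemma num_mon_pos: "num_mon n d \<ge> 1"
  by (simp add: num_mon_def Suc_leI)

lemma num_mon_Suc: "Suc n * num_mon (Suc n) d = (Suc n + d) * num_mon n d"
  unfolding num_mon_def using Suc_times_binomial[of n "n + d"] by simp

lemma num_mon_mono: "d \<le> d' \<Longrightarrow> num_mon n d \<le> num_mon n d'"
  unfolding num_mon_def by (rule binomial_right_mono) auto

text \<open>Choosing \<open>d\<close> instead of \<open>n\<close> elements: for fixed
  \<open>d\<close> the growth in the number of variables is only polynomial.\<close>

lemma num_mon_le_poly: "num_mon n d \<le> (n + d) ^ d"
proof -
  have "num_mon n d = (n + d) choose d"
    unfolding num_mon_def by (metis add_diff_cancel_left' binomial_symmetric le_add1)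
  then show ?thesis
    by (simp add: binomial_le_pow)
qed

text \<open>N(d) is the product of (j + d) / j for 1 \<le> j \<le> n, and (j + d) / (j d) decreases
  in d. So N(d) / d^n decreases in d, a comparison that loses no constant to the power n.\<close>

lemma num_mon_ratio:
  assumes "1 \<le> b" "b \<le> a"
  shows "num_mon n a * b ^ n \<le> a ^ n * num_mon n b"
proof (induction n)
  case (Suc n)
  obtain c where c: "a = b + c"
    using assms le_iff_add by blast
  have "(Suc n + a) * b \<le> a * (Suc n + b)"
    unfolding c by (simp add: algebra_simps)
  have "Suc n * (num_mon (Suc n) a * b ^ Suc n) = ((Suc n + a) * b) * (num_mon n a * b ^ n)"
    by (simp only: power_Suc num_mon_Suc mult.left_commute[of "Suc n" "num_mon (Suc n) a" for n]
        flip: mult.assoc) (simp only: ac_simps)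
  also have "\<dots> \<le> (a * (Suc n + b)) * (a ^ n * num_mon n b)"
    by (rule mult_mono[OF \<open>(Suc n + a) * b \<le> a * (Suc n + b)\<close> Suc.IH]) auto
  also have "\<dots> = Suc n * (a ^ Suc n * num_mon (Suc n) b)"
    by (simp only: power_Suc num_mon_Suc mult.left_commute[of "Suc n" "a * a ^ n"]) (simp only: ac_simps)
  finally show ?case
    by (simp only: mult_le_cancel1)
qed simp

lemma num_mon_mult_le:
  assumes "1 \<le> e" "1 \<le> f"
  shows "num_mon n (e * f) \<le> e ^ n * num_mon n f"
proof -
  have "num_mon n (e * f) * f ^ n \<le> (e ^ n * num_mon n f) * f ^ n"
    using num_mon_ratio[of f "e * f" n] assms by (simp add: power_mult_distrib ac_simps)
  then show ?thesis
    using assms by simp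
qed

text \<open>Comparison with degree 1. The loss 2^n is too much for a constant uniform in n; the
  bound serves where n is fixed, bounded, or allowed in the exponent.\<close>

lemma num_mon_le_power:
  assumes "1 \<le> d"
  shows "num_mon n d \<le> (2 * d) ^ n"
proof -
  have "num_mon n d \<le> d ^ n * num_mon n 1"
    using num_mon_mult_le[of d 1 n] assms by simp
  also have "num_mon n 1 = Suc n"
    by (simp add: num_mon_def)
  also have "Suc n \<le> 2 ^ n"
    by (simp add: Suc_leI)
  finally show ?thesis
    by (simp add: power_mult_distrib ac_simps)
qed

text \<open>One term of the binomial expansion is at most the whole sum. The weights are free and
  get tuned: \<open>s\<close> and 1 for a bound in d / n, and \<open>y\<close> and
  \<open>1 - y\<close> where the right-hand side should be 1.\<close>

lemma binomial_term_le:
  fixes x y :: real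
  assumes "0 \<le> x" "0 \<le> y"
  shows "real (num_mon n d) * x ^ n * y ^ d \<le> (x + y) ^ (n + d)"
proof -
  have "real ((n + d) choose n) * x ^ n * y ^ (n + d - n) \<le>
      (\<Sum>k\<le>n + d. real ((n + d) choose k) * x ^ k * y ^ (n + d - k))"
    by (rule member_le_sum) (use assms in auto)
  then show ?thesis
    by (simp add: num_mon_def binomial_ring)
qed

text \<open>The classical binom(n + d, n) \<le> (e (n + d) / n)^n, with e rounded up to 3: the
  weights \<open>s\<close> and 1 give (1 + s)^(n + d) \<le> exp(s (n + d)), and \<open>s\<close> is
  chosen to make this exponent n.\<close>

lemma num_mon_le_exp:
  assumes "1 \<le> n"
  shows "real (num_mon n d) \<le> (3 * (1 + real d / real n)) ^ n"
proof -
  define s where "s = real n / real (n + d)"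
  have s: "s > 0"
    using assms by (auto simp: s_def)
  have "real (num_mon n d) * s ^ n \<le> (s + 1) ^ (n + d)"
    using binomial_term_le[of s 1 n d] s by simp
  also have "\<dots> \<le> exp s ^ (n + d)"
    by (rule power_mono) (use s in \<open>auto simp: add.commute\<close>)
  also have "\<dots> = exp (real (n + d) * s)"
    by (metis exp_of_nat_mult)
  also have "real (n + d) * s = real n * 1"
    using assms by (simp add: s_def)
  also have "exp (real n * 1) = exp 1 ^ n"
    by (rule exp_of_nat_mult)
  also have "\<dots> \<le> 3 ^ n"
    by (rule power_mono) (use exp_le in auto)
  finally have "real (num_mon n d) \<le> 3 ^ n / s ^ n"
    using s by (simp add: field_simps)
  also have "\<dots> = (3 * (1 + real d / real n)) ^ n"
    using assms by (simp add: s_def field_simps flip: power_divide power_mult_distrib)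
  finally show ?thesis .
qed

text \<open>Turns factors polynomial in n into constants independent of n. With s^b = q the
  expression is the b-th power of (n + a) s^n, which converges and hence is bounded.\<close>

lemma poly_times_geometric_bounded:
  assumes "0 \<le> q" "q < (1::real)"
  shows "\<exists>C\<ge>0. \<forall>n. real (n + a) ^ b * q ^ n \<le> C"
proof (cases "b = 0")
  case True
  then show ?thesis
    using assms by (intro exI[of _ 1]) (auto simp: power_le_one)
next
  case False
  define s where "s = root b q"
  have s: "0 \<le> s" "s < 1" "s ^ b = q"
    using assms False by (auto simp: s_def)
  have "(\<lambda>n. real n * s ^ n + real a * s ^ n) \<longlonglongrightarrow> 0 + real a * 0"
    by (intro tendsto_add tendsto_mult tendsto_const powser_times_n_limit_0 LIMSEQ_realpow_zero)
      (use s in auto)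
  then have "Bseq (\<lambda>n. real n * s ^ n + real a * s ^ n)"
    by (intro convergent_imp_Bseq convergentI)
  then obtain K where K: "K > 0" "\<And>n. norm (real n * s ^ n + real a * s ^ n) \<le> K"
    by (auto simp: Bseq_def)
  have "real (n + a) ^ b * q ^ n \<le> K ^ b" for n
  proof -
    have "q ^ n = (s ^ n) ^ b"
      unfolding s(3)[symmetric] by (simp only: mult.commute flip: power_mult)
    then have "real (n + a) ^ b * q ^ n = (real n * s ^ n + real a * s ^ n) ^ b"
      by (metis distrib_right of_nat_add power_mult_distrib)
    also have "\<dots> \<le> K ^ b"
      by (rule power_mono) (use K(2)[of n] s in auto)
    finally show ?thesis .
  qed
  with K show ?thesis
    by (intro exI[of _ "K ^ b"]) auto
qed

text \<open>Since N(q) / q^n decreases in q, it suffices to bound N(2) / 2^n \<le> (n + 2)^2 / 2^n.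
  At q = 1 the quotient is n + 1, which is why q starts at 2.\<close>

lemma num_mon_le_const_power:
  "\<exists>C\<ge>0. \<forall>n q. q \<ge> 2 \<longrightarrow> real (num_mon n q) \<le> C * real q ^ n"
proof -
  obtain C where C: "C \<ge> 0" "\<And>n. real (n + 2) ^ 2 * (1 / 2) ^ n \<le> C"
    using poly_times_geometric_bounded[of "1 / 2" 2 2] by auto
  have "real (num_mon n q) \<le> C * real q ^ n" if "q \<ge> 2" for n q
  proof -
    have "real (num_mon n q) * 2 ^ n \<le> real q ^ n * real (num_mon n 2)"
      using of_nat_mono[where ?'a = real, OF num_mon_ratio[of 2 q n]] that by simp
    also have "\<dots> \<le> real q ^ n * real (n + 2) ^ 2"
      using of_nat_mono[where ?'a = real, OF num_mon_le_poly[of n 2]] by (intro mult_left_mono) simp_all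
    finally have "real (num_mon n q) \<le> real q ^ n * (real (n + 2) ^ 2 * (1 / 2) ^ n)"
      by (simp add: field_simps)
    also have "\<dots> \<le> real q ^ n * C"
      by (rule mult_left_mono[OF C(2)]) simp
    finally show ?thesis
      by (simp add: mult.commute)
  qed
  with C(1) show ?thesis
    by blast
qed

subsection \<open>The cost of substituting into all monomials\<close>

text \<open>At most N(d) monomials are built, each by at most d - 1 products; the product with index
  e multiplies a polynomial of degree at most e f by one entry of the map. The factor 2 for
  multiplying and adding is left to \<open>map_cost\<close>.\<close>

definition subst_cost :: "nat \<Rightarrow> nat \<Rightarrow> nat \<Rightarrow> nat" where
  "subst_cost n d f = num_mon n d * (\<Sum>e=1..<d. num_mon n (e * f) * num_mon n f)"

text \<open>The first summand inside the parentheses of \<open>operation_bound\<close>. Being an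
  n-th power, it can be compared with estimates per variable.\<close>

definition ratio :: "nat \<Rightarrow> nat \<Rightarrow> nat \<Rightarrow> real" where
  "ratio n d f = real d ^ (2 * n) * real f ^ n / real n ^ (2 * n)"

lemma ratio_eq: "ratio n d f = (real d ^ 2 * real f / real n ^ 2) ^ n"
  by (simp add: ratio_def power_divide power_mult_distrib power_mult)

lemma ratio_nonneg: "ratio n d f \<ge> 0"
  by (simp add: ratio_def)

text \<open>Allows taking the larger of two bounds per variable before raising to the power
  n.\<close>

lemma max_1_power_le: "0 \<le> (x::real) \<Longrightarrow> max 1 x ^ n \<le> 1 + x ^ n"
  by (simp add: max_def)

lemma subst_cost_le_crude:
  assumes "f \<ge> 1"
  shows "subst_cost n d f \<le> d * (num_mon n d * num_mon n (d * f) * num_mon n f)"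
proof -
  have "(\<Sum>e=1..<d. num_mon n (e * f) * num_mon n f) \<le> (\<Sum>e=1..<d. num_mon n (d * f) * num_mon n f)"
    by (intro sum_mono mult_right_mono num_mon_mono) auto
  also have "\<dots> \<le> d * (num_mon n (d * f) * num_mon n f)"
    by simp
  finally show ?thesis
    unfolding subst_cost_def by (metis (no_types, lifting) mult.assoc mult.left_commute mult_le_mono2)
qed

text \<open>With \<open>num_mon_le_exp\<close> for all three counts the cost is at most d (27 (1 +
  p) (1 + p f) (1 + q))^n. Each of the eight products in the expansion is at most f M, hence 216 =
  27 * 8. The target has d^n on top of f^n M^n, so what remains is (216 / d)^n, harmless for d \<ge>
  216.\<close>

lemma subst_cost_large_degree:
  assumes n: "n \<ge> 1" and f: "f \<ge> 1" and d: "d \<ge> 216"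
  shows "real (subst_cost n d f) \<le> 216 * (real d ^ n * real f ^ n * (1 + ratio n d f))"
proof -
  define p where "p = real d / real n"
  define q where "q = real f / real n"
  \<comment> \<open>Its n-th power is at most 1 + \<open>ratio n d f\<close>, so \<open>M\<close> is
    the size per variable of the last factor of the target.\<close>
  define M where "M = max 1 (p ^ 2 * real f)"
  have pq: "p > 0" "q > 0" "q \<le> real f" "real f \<ge> 1"
    using n f d by (auto simp: p_def q_def field_simps)
  have M: "1 \<le> M" "p ^ 2 * real f \<le> M" "0 \<le> M"
    by (auto simp: M_def)
  have p: "p \<le> M"
  proof (cases "p \<le> 1")
    case False
    then have "p * 1 \<le> p * (p * real f)"
      using pq by (intro mult_left_mono) (auto intro: order_trans[OF _ mult_right_mono[of 1 p "real f"]])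
    with M show ?thesis
      by (simp add: power2_eq_square ac_simps)
  qed (use M in simp)
  have fM: "1 \<le> real f * M"
    using mult_mono[of 1 "real f" 1 M] pq M by simp
  have 1: "p \<le> real f * M"
    using mult_mono[of 1 "real f" p M] pq M p by simp
  have 2: "p * real f \<le> real f * M"
    using mult_left_mono[OF p, of "real f"] pq by (simp add: ac_simps)
  have 3: "q \<le> real f * M"
    using mult_left_mono[of 1 M "real f"] pq M by linarith
  have 4: "p * (p * real f) \<le> real f * M"
    using M pq mult_mono[of 1 "real f" "p ^ 2 * real f" M] by (simp add: power2_eq_square ac_simps)
  have n1: "1 / real n \<le> 1"
    using n by simp
  have 5: "p * q \<le> real f * M"
  proof -
    have "p * q = (p * real f) * (1 / real n)"
      by (simp add: q_def)
    also have "\<dots> \<le> (p * real f) * 1"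
      by (intro mult_left_mono n1) (use pq in auto)
    finally show ?thesis
      using 2 by simp
  qed
  have 6: "(p * real f) * q \<le> real f * M"
  proof -
    have "(p * real f) * q = (p ^ 2 * real f) * (real f / real d)"
      using n d by (simp add: p_def q_def power2_eq_square)
    also have "\<dots> \<le> M * (real f / 1)"
      by (intro mult_mono M divide_left_mono) (use d pq in auto)
    finally show ?thesis
      by (simp add: ac_simps)
  qed
  have 7: "p * (p * real f) * q \<le> real f * M"
  proof -
    have "p * (p * real f) * q = (p ^ 2 * real f) * (real f * (1 / real n))"
      by (simp add: q_def power2_eq_square)
    also have "\<dots> \<le> M * (real f * 1)"
      by (intro mult_mono M n1 mult_left_mono) auto
    finally show ?thesis
      by (simp add: ac_simps)
  qed
  have prod: "(1 + p) * (1 + p * real f) * (1 + q) \<le> 8 * (real f * M)"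
    using 1 2 3 4 5 6 7 fM by (simp add: algebra_simps)
  have "real (subst_cost n d f) \<le>
      real (d * (num_mon n d * num_mon n (d * f) * num_mon n f))"
    using subst_cost_le_crude[OF f] of_nat_mono by blast
  also have "\<dots> = real d * (real (num_mon n d) * real (num_mon n (d * f)) * real (num_mon n f))"
    by simp
  also have "\<dots> \<le> real d * ((3 * (1 + p)) ^ n * (3 * (1 + p * real f)) ^ n * (3 * (1 + q)) ^ n)"
    using num_mon_le_exp[OF n, of d] num_mon_le_exp[OF n, of "d * f"] num_mon_le_exp[OF n, of f] pq
    by (intro mult_left_mono mult_mono) (auto simp: p_def q_def)
  also have "\<dots> = real d * (27 * ((1 + p) * (1 + p * real f) * (1 + q))) ^ n"
  proof -
    have "(27::real) ^ n = 3 ^ n * 3 ^ n * 3 ^ n"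
      by (simp flip: power_mult_distrib)
    then show ?thesis
      by (simp only: power_mult_distrib ac_simps)
  qed
  also have "\<dots> \<le> real d * (27 * (8 * (real f * M))) ^ n"
    by (intro mult_left_mono power_mono mult_left_mono prod) (use pq in auto)
  also have "\<dots> = (real d * (216 / real d) ^ n) * (real d ^ n * real f ^ n * M ^ n)"
  proof -
    have "27 * (8 * (real f * M)) = (216 / real d) * (real d * real f * M)"
      using d by simp
    then show ?thesis
      by (simp only: power_mult_distrib ac_simps)
  qed
  also have "\<dots> \<le> (real d * (216 / real d) ^ 1) * (real d ^ n * real f ^ n * (1 + ratio n d f))"
  proof (intro mult_mono mult_left_mono)
    \<comment> \<open>One power of 216 / d is kept, because it cancels the factor d that came from
      the number of products.\<close>
    show "(216 / real d) ^ n \<le> (216 / real d) ^ 1"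
      by (rule power_decreasing) (use n d in auto)
    show "M ^ n \<le> 1 + ratio n d f"
      unfolding M_def ratio_eq using max_1_power_le[of "p ^ 2 * real f" n]
      by (simp add: p_def power_divide)
  qed (use M in auto)
  finally show ?thesis
    using d by simp
qed

text \<open>In N(f) y^n (1 - y)^f \<le> 1 put y = \<alpha> / sqrt f. To first order (1 - y)^f costs
  exp(f y) = exp(\<alpha> sqrt f) \<le> e^n. The natural choice y = n / f would let the second-order
  error 2 f y^2 grow with n; capping \<alpha> at d keeps it below 2 d^2, a constant for fixed d. The
  two values of the minimum produce the two summands of 1 + \<open>ratio n d f\<close>.\<close>

lemma square_num_mon_le:
  assumes n: "n \<ge> 1" and d: "d \<ge> 1" and f: "f \<ge> 4 * d ^ 2"
  shows "real (num_mon n f) ^ 2 \<le>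
    exp (4 * real d ^ 2) * (exp 2 * real f / real d ^ 2) ^ n * (1 + ratio n d f)"
proof -
  define u where "u = sqrt (real f)"
  define \<alpha> where "\<alpha> = min (real d) (real n / u)"
  define y where "y = \<alpha> / u"
  have "sqrt (real (4 * d ^ 2)) \<le> u"
    unfolding u_def using f of_nat_mono real_sqrt_le_iff by blast
  then have u: "u \<ge> 2 * real d" "u ^ 2 = real f" "u > 0"
    using d f by (auto simp: real_sqrt_mult u_def intro!: gr0I)
  have \<alpha>: "0 < \<alpha>" "\<alpha> \<le> real d" "\<alpha> * u \<le> real n"
    using u d n by (auto simp: \<alpha>_def min_def field_simps)
  \<comment> \<open>This is where f \<ge> 4 d^2 enters: up to 1/2 the estimate ln(1 - y) \<ge> - y -
    2 y^2 holds.\<close>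
  have y: "0 < y" "y \<le> 1 / 2"
    using \<alpha> u by (auto simp: y_def field_simps)
  have "real (num_mon n f) * y ^ n * (1 - y) ^ f \<le> 1"
    using binomial_term_le[of y "1 - y" n f] y by simp
  moreover have "exp (- (real n + 2 * real d ^ 2)) \<le> (1 - y) ^ f"
  proof -
    have "real f * (y + 2 * y ^ 2) = \<alpha> * u + 2 * \<alpha> ^ 2"
      using u by (simp add: y_def flip: u(2)) (simp add: field_simps power2_eq_square)
    also have "\<dots> \<le> real n + 2 * real d ^ 2"
      using \<alpha> by (auto intro!: add_mono power_mono)
    finally have "- (real n + 2 * real d ^ 2) \<le> real f * (- y - 2 * y ^ 2)"
      by (simp add: algebra_simps)
    also have "\<dots> \<le> real f * ln (1 - y)"
      by (intro mult_left_mono ln_one_minus_pos_lower_bound) (use y in auto)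
    finally have "exp (- (real n + 2 * real d ^ 2)) \<le> exp (real f * ln (1 - y))"
      by simp
    also have "\<dots> = (1 - y) ^ f"
      using y by (simp add: exp_of_nat_mult)
    finally show ?thesis .
  qed
  ultimately have "real (num_mon n f) * y ^ n * exp (- (real n + 2 * real d ^ 2)) \<le> 1"
    using y by (smt (verit) mult_left_mono of_nat_0_le_iff zero_le_mult_iff zero_le_power)
  then have "real (num_mon n f) \<le> exp (real n + 2 * real d ^ 2) / y ^ n"
    unfolding exp_minus using y by (simp add: field_simps)
  then have "real (num_mon n f) ^ 2 \<le> (exp (real n + 2 * real d ^ 2) / y ^ n) ^ 2"
    by (rule power_mono) simp
  also have "\<dots> = exp (2 * (real n + 2 * real d ^ 2)) / (y ^ 2) ^ n"
    by (simp only: power_divide exp_double mult.commute[of n 2] flip: power_mult)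
  also have "exp (2 * (real n + 2 * real d ^ 2)) = exp (4 * real d ^ 2) * exp 2 ^ n"
    by (simp add: algebra_simps exp_add flip: exp_of_nat_mult)
  also have "\<dots> / (y ^ 2) ^ n = exp (4 * real d ^ 2) * (exp 2 / y ^ 2) ^ n"
    by (simp add: power_divide)
  also have "\<dots> \<le> exp (4 * real d ^ 2) * ((exp 2 * real f / real d ^ 2) ^ n * (1 + ratio n d f))"
  proof (intro mult_left_mono)
    show "(exp 2 / y ^ 2) ^ n \<le> (exp 2 * real f / real d ^ 2) ^ n * (1 + ratio n d f)"
    proof (cases "real d \<le> real n / u")
      case True
      then have "exp 2 / y ^ 2 = exp 2 * real f / real d ^ 2"
        using u d by (simp add: y_def \<alpha>_def power_divide)
      then show ?thesis
        using mult_left_mono[of 1 "1 + ratio n d f" "(exp 2 * real f / real d ^ 2) ^ n"]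
          ratio_nonneg[of n d f] by simp
    next
      case False
      \<comment> \<open>Uncapped case: 1 / y^2 = f^2 / n^2 splits into f / d^2 and d^2 f / n^2, and
        the second factor is the base of \<open>ratio\<close>.\<close>
      then have "y = real n / real f"
        using u by (simp add: y_def \<alpha>_def power2_eq_square flip: u(2))
      then have "exp 2 / y ^ 2 = (exp 2 * real f / real d ^ 2) * (real d ^ 2 * real f / real n ^ 2)"
        using d n by (simp add: power_divide power2_eq_square)
      then have "(exp 2 / y ^ 2) ^ n = (exp 2 * real f / real d ^ 2) ^ n * ratio n d f"
        by (simp only: power_mult_distrib ratio_eq)
      then show ?thesis
        by (simp add: mult_left_mono)
    qed
  qed simp
  finally show ?thesis
    by (simp only: mult.assoc)
qed

text \<open>
  The factors polynomial in \<open>n\<close> are absorbed by a geometric sequence whose ratio is at most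
  \<open>(d - 1) e\<^sup>2 / d\<^sup>3 \<le> e\<^sup>2 / 8 < 1\<close>, or \<open>(d - 1) / d\<close> for bounded \<open>f\<close>.
\<close>

lemma subst_cost_fixed_degree:
  assumes d: "d \<ge> 2"
  shows "\<exists>C\<ge>0. \<forall>n f. n \<ge> 1 \<longrightarrow> f \<ge> 1 \<longrightarrow>
    real (subst_cost n d f) \<le> C * (real d ^ n * real f ^ n * (1 + ratio n d f))"
proof -
  \<comment> \<open>The threshold of \<open>square_num_mon_le\<close>. Below it f is bounded in
    terms of d, so N(f) is polynomial in n.\<close>
  define a where "a = 4 * d ^ 2"
  define q where "q = (real d - 1) / real d"
  define r where "r = (real d - 1) * exp 2 / real d ^ 3"
  have "0 \<le> q" "q < 1"
    using d by (auto simp: q_def)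
  then obtain C1 where C1: "C1 \<ge> 0" "\<And>n. real (n + a) ^ (d + 2 * a) * q ^ n \<le> C1"
    using poly_times_geometric_bounded[of q a "d + 2 * a"] by auto
  \<comment> \<open>The difference of the two sides factors as below, with equality at d = 2. There
    \<open>r\<close> equals e^2 / 8, and rounding e up to 3 would give 9 / 8.\<close>
  have "8 * (real d - 1) \<le> real d ^ 3"
  proof -
    have "0 \<le> (real d - 2) * (real d ^ 2 + 2 * real d - 4)"
      using d power_mono[of 2 "real d" 2] by (intro mult_nonneg_nonneg) auto
    then show ?thesis
      by (simp add: power2_eq_square power3_eq_cube algebra_simps)
  qed
  moreover have "exp (2::real) < 8"
  proof -
    \<comment> \<open>The quadratic bound on exp is sharp only near 0, so it is applied at 1/16 and
      raised to the power 32; (273 / 256)^32 is about 7.83.\<close>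
    have "exp (2::real) = exp (1 / 16) ^ 32"
      by (simp flip: exp_of_nat_mult)
    also have "\<dots> \<le> (1 + 1 / 16 + (1 / 16) ^ 2) ^ 32"
      by (intro power_mono exp_bound) auto
    also have "\<dots> < (8::real)"
      by (simp add: power2_eq_square field_simps)
    finally show ?thesis .
  qed
  ultimately have "(real d - 1) * exp 2 < real d ^ 3"
    using d mult_strict_left_mono[of "exp 2" 8 "real d - 1"] by linarith
  then have "0 \<le> r" "r < 1"
    using d by (auto simp: r_def)
  then obtain C2 where C2: "C2 \<ge> 0" "\<And>n. real (n + d) ^ d * r ^ n \<le> C2"
    using poly_times_geometric_bounded[of r d d] by auto
  let ?C = "real d * C1 + real d * exp (4 * real d ^ 2) * C2"
  have "real (subst_cost n d f) \<le> ?C * (real d ^ n * real f ^ n * (1 + ratio n d f))"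
    if n: "n \<ge> 1" and f: "f \<ge> 1" for n f
  proof -
    \<comment> \<open>Using e \<le> d - 1 instead of e \<le> d is what leaves the factor ((d - 1) /
      d)^n against the target.\<close>
    have "(\<Sum>e=1..<d. num_mon n (e * f) * num_mon n f) \<le> (\<Sum>e=1..<d. (d - 1) ^ n * num_mon n f * num_mon n f)"
    proof (intro sum_mono mult_right_mono)
      fix e assume e: "e \<in> {1..<d}"
      then have "num_mon n (e * f) \<le> e ^ n * num_mon n f"
        using f by (intro num_mon_mult_le) auto
      also have "\<dots> \<le> (d - 1) ^ n * num_mon n f"
        by (intro mult_right_mono power_mono) (use e in auto)
      finally show "num_mon n (e * f) \<le> (d - 1) ^ n * num_mon n f" .
    qed auto
    also have "\<dots> \<le> d * ((d - 1) ^ n * num_mon n f ^ 2)"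
      by (simp add: power2_eq_square)
    finally have "subst_cost n d f \<le> (n + d) ^ d * (d * ((d - 1) ^ n * num_mon n f ^ 2))"
      unfolding subst_cost_def by (intro mult_mono num_mon_le_poly) auto
    then have "real (subst_cost n d f) \<le> real ((n + d) ^ d * (d * ((d - 1) ^ n * num_mon n f ^ 2)))"
      by (rule of_nat_mono)
    also have "\<dots> = real (n + d) ^ d * (real d * ((real d - 1) ^ n * real (num_mon n f) ^ 2))"
      using d by (simp add: of_nat_diff)
    finally have cost: "real (subst_cost n d f) \<le> \<dots>" .
    have d1: "real d - 1 \<ge> 0"
      using d by simp
    have ratio: "1 \<le> 1 + ratio n d f"
      using ratio_nonneg by simp
    show ?thesis
    proof (cases "f < a")
      case True
      have "num_mon n f \<le> num_mon n a"
        by (rule num_mon_mono) (use True in simp)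
      also have "\<dots> \<le> (n + a) ^ a"
        by (rule num_mon_le_poly)
      finally have "real (num_mon n f) \<le> real (n + a) ^ a"
        unfolding of_nat_power[symmetric] by (rule of_nat_mono)
      then have sq: "real (num_mon n f) ^ 2 \<le> real (n + a) ^ (2 * a)"
        using power_mono[of "real (num_mon n f)" "real (n + a) ^ a" 2]
        by (simp add: power_mult mult.commute flip: power_mult)
      have "d \<le> a"
        using d by (simp add: a_def power2_eq_square)
      note cost
      also have "real (n + d) ^ d * (real d * ((real d - 1) ^ n * real (num_mon n f) ^ 2)) \<le>
          real (n + a) ^ d * (real d * ((real d - 1) ^ n * real (n + a) ^ (2 * a)))"
        using sq d1 \<open>d \<le> a\<close> by (intro mult_mono mult_left_mono power_mono) auto
      also have "\<dots> = real d * (real (n + a) ^ (d + 2 * a) * q ^ n) * real d ^ n"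
        using d by (simp add: power_add q_def power_divide)
      also have "\<dots> \<le> real d * C1 * (real d ^ n * (1 * 1))"
        using mult_right_mono[OF mult_left_mono[OF C1(2)[of n], of "real d"], of "real d ^ n"] by simp
      also have "\<dots> \<le> real d * C1 * (real d ^ n * (real f ^ n * (1 + ratio n d f)))"
        using C1(1) f ratio by (intro mult_left_mono mult_mono) auto
      also have "\<dots> = real d * C1 * (real d ^ n * real f ^ n * (1 + ratio n d f))"
        by simp
      also have "\<dots> \<le> ?C * (real d ^ n * real f ^ n * (1 + ratio n d f))"
        using C2(1) ratio by (intro mult_right_mono) auto
      finally show ?thesis .
    next
      case False
      then have sq: "real (num_mon n f) ^ 2 \<le>
          exp (4 * real d ^ 2) * (exp 2 * real f / real d ^ 2) ^ n * (1 + ratio n d f)"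
        using n d by (intro square_num_mon_le) (auto simp: a_def)
      note cost
      also have "real (n + d) ^ d * (real d * ((real d - 1) ^ n * real (num_mon n f) ^ 2)) \<le>
          real (n + d) ^ d * (real d * ((real d - 1) ^ n *
            (exp (4 * real d ^ 2) * (exp 2 * real f / real d ^ 2) ^ n * (1 + ratio n d f))))"
        using sq d1 by (intro mult_left_mono) auto
      also have "\<dots> = real d * exp (4 * real d ^ 2) *
          (real (n + d) ^ d * ((real d - 1) * (exp 2 * real f / real d ^ 2)) ^ n) * (1 + ratio n d f)"
        by (simp only: power_mult_distrib ac_simps)
      also have "(real d - 1) * (exp 2 * real f / real d ^ 2) = r * (real d * real f)"
        using d by (simp add: r_def power2_eq_square power3_eq_cube)
      also have "real d * exp (4 * real d ^ 2) *
          (real (n + d) ^ d * (r * (real d * real f)) ^ n) * (1 + ratio n d f) =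
          real d * exp (4 * real d ^ 2) * (real (n + d) ^ d * r ^ n) *
            (real d ^ n * real f ^ n * (1 + ratio n d f))"
        by (simp only: power_mult_distrib ac_simps)
      also have "\<dots> \<le> real d * exp (4 * real d ^ 2) * C2 * (real d ^ n * real f ^ n * (1 + ratio n d f))"
        using ratio by (intro mult_right_mono mult_left_mono C2(2)) auto
      also have "\<dots> \<le> ?C * (real d ^ n * real f ^ n * (1 + ratio n d f))"
        using C1(1) ratio by (intro mult_right_mono) auto
      finally show ?thesis .
    qed
  qed
  moreover have "?C \<ge> 0"
    using C1 C2 by simp
  ultimately show ?thesis
    by blast
qed

text \<open>Below 216 the constant may depend on d; the sum of these finitely many constants serves
  all of them. For d = 1 there is nothing to multiply.\<close>

lemma subst_cost_bound:
  "\<exists>C\<ge>0. \<forall>n d f. n \<ge> 1 \<longrightarrow> d \<ge> 1 \<longrightarrow> f \<ge> 1 \<longrightarrow>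
    real (subst_cost n d f) \<le> C * (real d ^ n * real f ^ n * (1 + ratio n d f))"
proof -
  have "\<exists>C\<ge>0. \<forall>n f. n \<ge> 1 \<longrightarrow> f \<ge> 1 \<longrightarrow>
      real (subst_cost n d f) \<le> C * (real d ^ n * real f ^ n * (1 + ratio n d f))"
    if "d \<ge> 1" for d
  proof (cases "d = 1")
    case True
    then show ?thesis
      by (intro exI[of _ 0]) (auto simp: subst_cost_def)
  qed (use that in \<open>intro subst_cost_fixed_degree, auto\<close>)
  then obtain K where K: "\<And>d. d \<ge> 1 \<Longrightarrow> K d \<ge> 0"
    "\<And>n d f. n \<ge> 1 \<Longrightarrow> d \<ge> 1 \<Longrightarrow> f \<ge> 1 \<Longrightarrow>
      real (subst_cost n d f) \<le> K d * (real d ^ n * real f ^ n * (1 + ratio n d f))"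
    by metis
  let ?C = "216 + (\<Sum>d=1..<216. K d)"
  have "real (subst_cost n d f) \<le> ?C * (real d ^ n * real f ^ n * (1 + ratio n d f))"
    if "n \<ge> 1" "d \<ge> 1" "f \<ge> 1" for n d f
  proof (cases "d < 216")
    case True
    have "K d \<le> (\<Sum>d=1..<216. K d)"
      by (rule member_le_sum) (use True that K(1) in auto)
    then show ?thesis
      by (intro order_trans[OF K(2)[OF that]] mult_right_mono)
        (use ratio_nonneg[of n d f] in auto)
  next
    case False
    moreover have "0 \<le> (\<Sum>d=1..<216. K d)"
      by (intro sum_nonneg K) auto
    ultimately show ?thesis
      by (intro order_trans[OF subst_cost_large_degree] mult_right_mono)
        (use that ratio_nonneg[of n d f] in auto)
  qed
  moreover have "?C \<ge> 0"
    by (intro add_nonneg_nonneg sum_nonneg K) auto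
  ultimately show ?thesis
    by blast
qed

subsection \<open>The cost of one map\<close>

text \<open>The threshold is 36 = 9 * 4: a factor 3 from each use of \<open>num_mon_le_exp\<close>,
  and four products in (1 + p) (1 + p f). Once n and d reach it, no constant to the power n is lost.
  For n < 36 the loss (4 n)^n is at most 144^36. For d < 36 the count N(d) is polynomial in n and is
  absorbed by N(d f) / (d f)^n \<le> N(2) / 2^n, as d f \<ge> 2.\<close>

lemma num_mon_product_bound:
  "\<exists>C\<ge>0. \<forall>n d f. n \<ge> 1 \<longrightarrow> d * f \<ge> 2 \<longrightarrow>
    real (num_mon n d) * real (num_mon n (d * f)) \<le>
      C * (real d ^ n * real f ^ n * (1 + (real d / real n) ^ n))"
proof -
  \<comment> \<open>The exponent 38 is 36 for N(d) with d < 36 plus 2 for N(2).\<close>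
  obtain C2 where C2: "C2 \<ge> 0" "\<And>n. real (n + 36) ^ 38 * (1 / 2) ^ n \<le> C2"
    using poly_times_geometric_bounded[of "1 / 2" 36 38] by auto
  let ?C = "144 ^ 36 + C2 + 1"
  have "real (num_mon n d) * real (num_mon n (d * f)) \<le>
      ?C * (real d ^ n * real f ^ n * (1 + (real d / real n) ^ n))"
    if n: "n \<ge> 1" and df: "d * f \<ge> 2" for n d f
  proof -
    have d: "d \<ge> 1"
      using df by (cases "d = 0") auto
    have f: "f \<ge> 1"
      using df by (cases "f = 0") auto
    consider "n < 36" | "d < 36" | "n \<ge> 36" "d \<ge> 36"
      by linarith
    then have "\<exists>c. c \<le> ?C \<and> real (num_mon n d) * real (num_mon n (d * f)) \<le>
        c * (real d ^ n * real f ^ n * (1 + (real d / real n) ^ n))"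
    proof cases
      case 1
      have "num_mon n d * num_mon n (d * f) \<le> (2 * d) ^ n * (2 * (d * f)) ^ n"
        by (intro mult_mono num_mon_le_power) (use d f in auto)
      then have "real (num_mon n d) * real (num_mon n (d * f)) \<le> real ((2 * d) ^ n * (2 * (d * f)) ^ n)"
        by (metis of_nat_le_iff of_nat_mult)
      also have "\<dots> = (4 * real n) ^ n * (real d ^ n * real f ^ n * (real d / real n) ^ n)"
      proof -
        have "real ((2 * d) ^ n * (2 * (d * f)) ^ n) = (2 * real d * (2 * (real d * real f))) ^ n"
          by (simp only: of_nat_mult of_nat_power of_nat_numeral power_mult_distrib)
        also have "2 * real d * (2 * (real d * real f)) = 4 * real n * (real d * real f * (real d / real n))"
          using n by simp
        finally show ?thesis
          by (simp only: power_mult_distrib)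
      qed
      also have "\<dots> \<le> 144 ^ 36 * (real d ^ n * real f ^ n * (1 + (real d / real n) ^ n))"
      proof (intro mult_mono)
        have "(4 * real n) ^ n \<le> 144 ^ n"
          by (rule power_mono) (use 1 in auto)
        also have "\<dots> \<le> (144::real) ^ 36"
          by (rule power_increasing) (use 1 in auto)
        finally show "(4 * real n) ^ n \<le> 144 ^ 36" .
      qed auto
      finally show ?thesis
        using C2 by (intro exI[of _ "144 ^ 36"]) simp
    next
      case 2
      have "num_mon n d \<le> (n + d) ^ d"
        by (rule num_mon_le_poly)
      also have "\<dots> \<le> (n + 36) ^ d"
        by (rule power_mono) (use 2 in auto)
      also have "\<dots> \<le> (n + 36) ^ 36"
        by (rule power_increasing) (use 2 in auto)
      finally have 1: "real (num_mon n d) \<le> real (n + 36) ^ 36"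
        unfolding of_nat_power[symmetric] by (rule of_nat_mono)
      have "real (num_mon n (d * f)) * 2 ^ n \<le> real (d * f) ^ n * real (num_mon n 2)"
        using of_nat_mono[where ?'a = real, OF num_mon_ratio[of 2 "d * f" n]] df by simp
      also have "\<dots> \<le> real (d * f) ^ n * real (n + 36) ^ 2"
      proof (intro mult_left_mono)
        have "num_mon n 2 \<le> (n + 2) ^ 2"
          by (rule num_mon_le_poly)
        also have "\<dots> \<le> (n + 36) ^ 2"
          by (rule power_mono) auto
        finally show "real (num_mon n 2) \<le> real (n + 36) ^ 2"
          unfolding of_nat_power[symmetric] by (rule of_nat_mono)
      qed simp
      finally have "real (num_mon n (d * f)) \<le> real (d * f) ^ n * real (n + 36) ^ 2 * (1 / 2) ^ n"
        by (simp add: field_simps)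
      with 1 have "real (num_mon n d) * real (num_mon n (d * f)) \<le>
          real (n + 36) ^ 36 * (real (d * f) ^ n * real (n + 36) ^ 2 * (1 / 2) ^ n)"
        by (intro mult_mono) auto
      also have "\<dots> = (real (n + 36) ^ (36 + 2) * (1 / 2) ^ n) * (real d ^ n * real f ^ n * 1)"
        by (simp only: power_add power_mult_distrib of_nat_mult ac_simps mult_1_right)
      also have "\<dots> \<le> C2 * (real d ^ n * real f ^ n * (1 + (real d / real n) ^ n))"
        using C2 by (intro mult_mono) auto
      finally show ?thesis
        using C2 by (intro exI[of _ C2]) simp
    next
      case 3
      define p where "p = real d / real n"
      define M where "M = max 1 p"
      have p: "0 \<le> p" "p \<le> M" "1 \<le> M"
        by (auto simp: p_def M_def)
      have df36: "36 \<le> real d * real f"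
        using 3 f mult_mono[of 36 "real d" 1 "real f"] by simp
      have 1: "36 \<le> real d * real f * M"
        using mult_mono[OF df36, of 1 M] p by simp
      have 2: "36 * p \<le> real d * real f * M"
        using mult_mono[OF df36, of p M] p by simp
      have 4: "36 * (p * real f) \<le> real d * real f * M"
      proof -
        have "36 * (p * real f) = real d * real f * (36 / real n)"
          by (simp add: p_def)
        also have "\<dots> \<le> real d * real f * M"
          using 3 p by (intro mult_left_mono order_trans[OF _ p(3)]) auto
        finally show ?thesis .
      qed
      have 5: "36 * (p * (p * real f)) \<le> real d * real f * M"
      proof -
        have "36 * (p * (p * real f)) = real d * real f * (p * (36 / real n))"
          by (simp add: p_def)
        also have "\<dots> \<le> real d * real f * (M * 1)"
          using 3 p by (intro mult_left_mono mult_mono) (auto simp: field_simps)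
        finally show ?thesis
          by simp
      qed
      have prod: "9 * ((1 + p) * (1 + p * real f)) \<le> real d * real f * M"
        using 1 2 4 5 by (simp add: algebra_simps)
      have "real (num_mon n d) * real (num_mon n (d * f)) \<le> (3 * (1 + p)) ^ n * (3 * (1 + p * real f)) ^ n"
        using num_mon_le_exp[OF n, of d] num_mon_le_exp[OF n, of "d * f"]
        by (intro mult_mono) (auto simp: p_def)
      also have "\<dots> = (9 * ((1 + p) * (1 + p * real f))) ^ n"
      proof -
        have "(9::real) ^ n = 3 ^ n * 3 ^ n"
          by (simp flip: power_mult_distrib)
        then show ?thesis
          by (simp only: power_mult_distrib ac_simps)
      qed
      also have "\<dots> \<le> (real d * real f * M) ^ n"
        by (rule power_mono[OF prod]) (use p in auto)
      also have "\<dots> = real d ^ n * real f ^ n * M ^ n"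
        by (simp only: power_mult_distrib)
      also have "\<dots> \<le> 1 * (real d ^ n * real f ^ n * (1 + (real d / real n) ^ n))"
        using max_1_power_le[of p n] p by (simp add: M_def mult_left_mono p_def)
      finally show ?thesis
        using C2 by (intro exI[of _ 1]) simp
    qed
    then obtain c where c: "c \<le> ?C" "real (num_mon n d) * real (num_mon n (d * f)) \<le>
        c * (real d ^ n * real f ^ n * (1 + (real d / real n) ^ n))"
      by blast
    show ?thesis
      by (rule order_trans[OF c(2)]) (intro mult_right_mono c(1), auto)
  qed
  moreover have "?C \<ge> 0"
    using C2 by simp
  ultimately show ?thesis
    by blast
qed

text \<open>
  The constant 10 consists of 6 for the elimination, 1 for the subtraction \<open>g - g \<circ> F\<close>, and 3 for the
  computation of the output from the kernel, which is done once only but is charged to every map.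
\<close>

definition map_cost :: "nat \<Rightarrow> nat \<Rightarrow> nat \<Rightarrow> nat \<Rightarrow> nat" where
  "map_cost n m d f = 2 * subst_cost n d f + 2 * m * (num_mon n d * num_mon n (d * f)) +
     10 * m ^ 2 * num_mon n (d * f)"

text \<open>One summand of \<open>operation_bound\<close>, so that the maps can be treated
  separately.\<close>

definition map_bound :: "nat \<Rightarrow> nat \<Rightarrow> nat \<Rightarrow> nat \<Rightarrow> real" where
  "map_bound n m d f = real d ^ n * real f ^ n * (ratio n d f + real m ^ 2)"

text \<open>Only the cost m N(d) N(d f) mixes the two summands of the target. With z = (d / n)^n it
  carries the factor m (1 + z), and 2 m z \<le> m^2 + z^2 separates them because z^2 \<le>
  \<open>ratio n d f\<close>.\<close>

lemma map_cost_bound: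
  "\<exists>C. \<forall>n m d f. n \<ge> 1 \<longrightarrow> m \<ge> 1 \<longrightarrow> d * f \<ge> 2 \<longrightarrow> real (map_cost n m d f) \<le> C * map_bound n m d f"
proof -
  obtain C1 where C1: "C1 \<ge> 0" "\<And>n d f. n \<ge> 1 \<Longrightarrow> d \<ge> 1 \<Longrightarrow> f \<ge> 1 \<Longrightarrow>
      real (subst_cost n d f) \<le> C1 * (real d ^ n * real f ^ n * (1 + ratio n d f))"
    using subst_cost_bound by blast
  obtain C2 where C2: "C2 \<ge> 0" "\<And>n d f. n \<ge> 1 \<Longrightarrow> d * f \<ge> 2 \<Longrightarrow>
      real (num_mon n d) * real (num_mon n (d * f)) \<le>
        C2 * (real d ^ n * real f ^ n * (1 + (real d / real n) ^ n))"
    using num_mon_product_bound by blast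
  obtain C3 where C3: "C3 \<ge> 0" "\<And>n q. q \<ge> 2 \<Longrightarrow> real (num_mon n q) \<le> C3 * real q ^ n"
    using num_mon_le_const_power by blast
  have "real (map_cost n m d f) \<le> (2 * C1 + 4 * C2 + 10 * C3) * map_bound n m d f"
    if n: "n \<ge> 1" and m: "m \<ge> 1" and df: "d * f \<ge> 2" for n m d f
  proof -
    have d: "d \<ge> 1"
      using df by (cases "d = 0") auto
    have f: "f \<ge> 1"
      using df by (cases "f = 0") auto
    let ?B = "real d ^ n * real f ^ n"
    have m2: "1 \<le> real m ^ 2"
      using m by simp
    have 1: "real (subst_cost n d f) \<le> C1 * map_bound n m d f"
      unfolding map_bound_def
      by (rule order_trans[OF C1(2)[OF n d f]]) (use C1(1) m2 in \<open>intro mult_left_mono, auto\<close>)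
    have "real m * (1 + (real d / real n) ^ n) \<le> 2 * (ratio n d f + real m ^ 2)"
    proof -
      let ?z = "(real d / real n) ^ n"
      have "0 \<le> (real m - ?z) ^ 2"
        by simp
      then have "2 * (real m * ?z) \<le> real m ^ 2 + ?z ^ 2"
        by (simp add: power2_eq_square algebra_simps)
      moreover have "?z ^ 2 \<le> ratio n d f"
      proof -
        have "?z ^ 2 = real d ^ (2 * n) / real n ^ (2 * n) * 1"
          by (simp add: power_divide mult.commute flip: power_mult)
        also have "\<dots> \<le> real d ^ (2 * n) / real n ^ (2 * n) * real f ^ n"
          by (intro mult_left_mono) (use f in auto)
        finally show ?thesis
          by (simp add: ratio_def)
      qed
      moreover have "real m \<le> real m ^ 2"
        using m by (simp add: power2_eq_square mult_le_cancel_left1)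
      moreover have "0 \<le> real m * ?z"
        by simp
      moreover note ratio_nonneg[of n d f]
      ultimately show ?thesis
        unfolding distrib_left mult_1_right by linarith
    qed
    then have "C2 * ?B * (real m * (1 + (real d / real n) ^ n)) \<le>
        C2 * ?B * (2 * (ratio n d f + real m ^ 2))"
      using C2(1) by (intro mult_left_mono) auto
    moreover have "real m * (real (num_mon n d) * real (num_mon n (d * f))) \<le>
        real m * (C2 * (?B * (1 + (real d / real n) ^ n)))"
      by (intro mult_left_mono C2(2) n df) auto
    ultimately have 2: "real m * (real (num_mon n d) * real (num_mon n (d * f))) \<le>
        2 * C2 * map_bound n m d f"
      by (simp add: map_bound_def ac_simps)
    have "real (num_mon n (d * f)) * real m ^ 2 \<le> C3 * ?B * (ratio n d f + real m ^ 2)"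
      using C3(2)[OF df, of n] C3(1) ratio_nonneg[of n d f]
      by (intro mult_mono) (auto simp: power_mult_distrib)
    then have 3: "real m ^ 2 * real (num_mon n (d * f)) \<le> C3 * map_bound n m d f"
      by (simp add: map_bound_def ac_simps)
    show ?thesis
      using 1 2 3 by (simp add: map_cost_def algebra_simps)
  qed
  then show ?thesis
    by blast
qed

text \<open>With n fixed every loss 2^n is a constant, so \<open>num_mon_le_power\<close> suffices
  throughout, and d f = 1 is covered too.\<close>

lemma map_cost_bound_fixed:
  "\<exists>C. \<forall>m d f. m \<ge> 1 \<longrightarrow> d \<ge> 1 \<longrightarrow> f \<ge> 1 \<longrightarrow> n \<ge> 1 \<longrightarrow>
     real (map_cost n m d f) \<le> C * map_bound n m d f"
proof (cases "n \<ge> 1")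
  case True
  note n = True
  \<comment> \<open>The factor 8^n collects the 2^n of three monomial counts; n^(2 n) clears the
    denominator of \<open>ratio\<close>.\<close>
  define c where "c = (8::real) ^ n * real n ^ (2 * n)"
  have "real (map_cost n m d f) \<le> (2 * c + 2 * c + 10 * c) * map_bound n m d f"
    if m: "m \<ge> 1" and d: "d \<ge> 1" and f: "f \<ge> 1" for m d f
  proof -
    let ?B = "real d ^ n * real f ^ n"
    let ?w = "real d ^ (2 * n) * real f ^ n"
    have "(8::real) ^ n * 1 \<le> c"
      unfolding c_def using n by (intro mult_left_mono) auto
    then have c: "(2::real) ^ n \<le> c" "4 ^ n \<le> c"
      using power_mono[of "2::real" 8 n] power_mono[of "4::real" 8 n] by auto
    have c0: "c \<ge> 0"
      by (simp add: c_def)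
    have B: "?B \<ge> 1"
      using d f by (simp add: mult_ge1_I)
    have w: "ratio n d f * c = 8 ^ n * ?w"
      using n by (simp add: ratio_def c_def)
    have m1: "1 \<le> real m" "real m \<le> real m ^ 2"
      using m by (auto simp: power2_eq_square)
    have "subst_cost n d f \<le> d * (num_mon n d * num_mon n (d * f) * num_mon n f)"
      by (rule subst_cost_le_crude[OF f])
    also have "\<dots> \<le> d ^ n * ((2 * d) ^ n * (2 * (d * f)) ^ n * (2 * f) ^ n)"
      using d f n by (intro mult_mono num_mon_le_power) (auto simp: self_le_power)
    finally have "real (subst_cost n d f) \<le> real (d ^ n * ((2 * d) ^ n * (2 * (d * f)) ^ n * (2 * f) ^ n))"
      by (rule of_nat_mono)
    also have "\<dots> = ?B * (8 ^ n * ?w)"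
    proof -
      have "(8::real) ^ n = 2 ^ n * 2 ^ n * 2 ^ n"
        by (simp flip: power_mult_distrib)
      moreover have "real d ^ (2 * n) = real d ^ n * real d ^ n"
        by (simp add: mult_2 power_add)
      ultimately show ?thesis
        by (simp only: of_nat_mult of_nat_power of_nat_numeral power_mult_distrib ac_simps)
    qed
    also have "\<dots> = c * (?B * ratio n d f)"
      unfolding w[symmetric] by (simp only: ac_simps)
    also have "\<dots> \<le> c * map_bound n m d f"
      unfolding map_bound_def using c0 by (intro mult_left_mono) auto
    finally have 1: "real (subst_cost n d f) \<le> c * map_bound n m d f" .
    have "num_mon n d * num_mon n (d * f) \<le> (2 * d) ^ n * (2 * (d * f)) ^ n"
      using d f by (intro mult_mono num_mon_le_power) auto
    then have "real (num_mon n d * num_mon n (d * f)) \<le> real ((2 * d) ^ n * (2 * (d * f)) ^ n)"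
      by (rule of_nat_mono)
    also have "\<dots> = 4 ^ n * ?B * real d ^ n"
    proof -
      have "(4::real) ^ n = 2 ^ n * 2 ^ n"
        by (simp flip: power_mult_distrib)
      then show ?thesis
        by (simp only: of_nat_mult of_nat_power of_nat_numeral power_mult_distrib ac_simps)
    qed
    finally have "real m * real (num_mon n d * num_mon n (d * f)) \<le> real m * (4 ^ n * ?B * real d ^ n)"
      by (intro mult_left_mono) auto
    also have "\<dots> = 4 ^ n * ?B * (real m * real d ^ n)"
      by simp
    also have "\<dots> \<le> 4 ^ n * ?B * (real m ^ 2 + ?w)"
    proof (rule mult_left_mono)
      have "0 \<le> (real m - real d ^ n) ^ 2"
        by simp
      then have "2 * (real m * real d ^ n) \<le> real m ^ 2 + (real d ^ n) ^ 2"
        by (simp add: power2_diff)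
      then have "2 * (real m * real d ^ n) \<le> real m ^ 2 + real d ^ (2 * n)"
        by (simp only: mult.commute[of 2 n] power_mult)
      moreover have "real d ^ (2 * n) * 1 \<le> ?w"
        using f by (intro mult_left_mono) auto
      moreover have "0 \<le> real m * real d ^ n"
        by simp
      ultimately show "real m * real d ^ n \<le> real m ^ 2 + ?w"
        by linarith
    qed simp
    also have "\<dots> = ?B * (4 ^ n * real m ^ 2 + 4 ^ n * ?w)"
      by (simp add: algebra_simps)
    also have "\<dots> \<le> ?B * (c * real m ^ 2 + 8 ^ n * ?w)"
      using c by (intro mult_left_mono add_mono mult_right_mono power_mono) auto
    also have "\<dots> = c * map_bound n m d f"
      unfolding map_bound_def w[symmetric] by (simp only: algebra_simps)
    finally have 2: "real m * (real (num_mon n d) * real (num_mon n (d * f))) \<le> c * map_bound n m d f"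
      by simp
    have "num_mon n (d * f) \<le> (2 * (d * f)) ^ n"
      using d f by (intro num_mon_le_power) auto
    then have "real (num_mon n (d * f)) \<le> real ((2 * (d * f)) ^ n)"
      by (rule of_nat_mono)
    also have "\<dots> = 2 ^ n * ?B"
      by (simp add: power_mult_distrib)
    also have "\<dots> \<le> c * ?B"
      using c B by (intro mult_right_mono) auto
    finally have "real (num_mon n (d * f)) * real m ^ 2 \<le> (c * ?B) * (ratio n d f + real m ^ 2)"
      using ratio_nonneg[of n d f] c0 by (intro mult_mono) auto
    then have 3: "real m ^ 2 * real (num_mon n (d * f)) \<le> c * map_bound n m d f"
      by (simp add: map_bound_def ac_simps)
    show ?thesis
      using 1 2 3 by (simp add: map_cost_def algebra_simps)
  qed
  then show ?thesis
    by blast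
qed auto

text \<open>As M \<ge> 2, constants can move into the exponent: each count is at most (2 k)^n \<le>
  M^(2 n), the substitution cost needs the exponent 6 n + 1 \<le> 8 n, and the total weight 14 = 2 +
  2 + 10 is below 2^4 \<le> M^(4 n). Hence 12 = 8 + 4.\<close>

lemma map_cost_le_power:
  assumes n: "n \<ge> 1" and m: "m \<ge> 1" and d: "d \<ge> 1" and f: "f \<ge> 1"
    and M: "d * f \<le> M" "M \<ge> 2"
  shows "map_cost n m d f \<le> m ^ 2 * M ^ (12 * n)"
proof -
  have N: "num_mon n k \<le> M ^ (2 * n)" if "1 \<le> k" "k \<le> d * f" for k
  proof -
    have "num_mon n k \<le> (2 * k) ^ n"
      using that by (intro num_mon_le_power) auto
    also have "\<dots> \<le> (M * M) ^ n"
      using that M by (intro power_mono mult_mono) auto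
    finally show ?thesis
      by (simp add: power_mult power2_eq_square)
  qed
  have "d \<le> d * f" "f \<le> d * f" "1 \<le> d * f"
    using d f by auto
  note N1 = N[OF d \<open>d \<le> d * f\<close>] and N2 = N[OF f \<open>f \<le> d * f\<close>] and N3 = N[OF \<open>1 \<le> d * f\<close> order_refl]
  have M8: "M ^ k \<le> M ^ (8 * n)" if "k \<le> 8 * n" for k
    using that M by (intro power_increasing) auto
  have m2: "m \<le> m ^ 2" "1 \<le> m ^ 2"
    using m by (auto simp: power2_eq_square)
  have "subst_cost n d f \<le> d * (num_mon n d * num_mon n (d * f) * num_mon n f)"
    by (rule subst_cost_le_crude[OF f])
  also have "\<dots> \<le> M ^ 1 * (M ^ (2 * n) * M ^ (2 * n) * M ^ (2 * n))"
    using order_trans[OF \<open>d \<le> d * f\<close> M(1)] by (intro mult_mono N1 N2 N3) auto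
  also have "\<dots> = M ^ (1 + (2 * n + 2 * n + 2 * n))"
    by (simp only: power_add)
  also have "\<dots> \<le> M ^ (8 * n)"
    by (rule M8) (use n in auto)
  also have "\<dots> \<le> m ^ 2 * M ^ (8 * n)"
    using m2 by simp
  finally have 1: "subst_cost n d f \<le> m ^ 2 * M ^ (8 * n)" .
  have "m * (num_mon n d * num_mon n (d * f)) \<le> m ^ 2 * (M ^ (2 * n) * M ^ (2 * n))"
    by (intro mult_mono N1 N3 m2) auto
  also have "\<dots> = m ^ 2 * M ^ (2 * n + 2 * n)"
    by (simp only: power_add)
  also have "\<dots> \<le> m ^ 2 * M ^ (8 * n)"
    by (intro mult_left_mono M8) auto
  finally have 2: "m * (num_mon n d * num_mon n (d * f)) \<le> m ^ 2 * M ^ (8 * n)" .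
  have "m ^ 2 * num_mon n (d * f) \<le> m ^ 2 * M ^ (8 * n)"
    by (intro mult_left_mono order_trans[OF N3] M8) auto
  with 1 2 have "map_cost n m d f \<le> 14 * (m ^ 2 * M ^ (8 * n))"
    unfolding map_cost_def by linarith
  also have "14 \<le> M ^ (4 * n)"
  proof -
    have "14 \<le> (2::nat) ^ 4"
      by simp
    also have "\<dots> \<le> M ^ 4"
      using M by (intro power_mono) auto
    also have "\<dots> \<le> M ^ (4 * n)"
      using M n by (intro power_increasing) auto
    finally show ?thesis .
  qed
  then have "14 * (m ^ 2 * M ^ (8 * n)) \<le> M ^ (4 * n) * (m ^ 2 * M ^ (8 * n))"
    by (intro mult_right_mono) auto
  also have "\<dots> = m ^ 2 * M ^ (4 * n + 8 * n)"
    by (simp only: power_add ac_simps)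
  finally show ?thesis
    by simp
qed


section \<open>Monomials of bounded degree\<close>

definition bounded_mons :: "nat \<Rightarrow> nat \<Rightarrow> monomial set" where
  "bounded_mons n d = {t. Poly_Mapping.keys t \<subseteq> {..<n} \<and> mon_degree t \<le> d}"

lemma mon_degree_superset:
  assumes "finite A" "Poly_Mapping.keys t \<subseteq> A"
  shows "mon_degree t = (\<Sum>i\<in>A. Poly_Mapping.lookup t i)"
  unfolding mon_degree_def using assms
  by (intro sum.mono_neutral_left) (auto simp: in_keys_iff)

lemma mon_degree_add: "mon_degree (s + t) = mon_degree s + mon_degree t"
proof -
  let ?A = "Poly_Mapping.keys s \<union> Poly_Mapping.keys t"
  have "mon_degree (s + t) = (\<Sum>i\<in>?A. Poly_Mapping.lookup (s + t) i)"
    by (rule mon_degree_superset) (use keys_add[of s t] in auto)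
  then show ?thesis
    by (simp add: mon_degree_superset[of ?A] lookup_add sum.distrib)
qed

text \<open>Stars and bars: the slack d - deg t is appended as one more entry, so a degree of at
  most d becomes a list of n + 1 naturals with sum exactly d. An injection suffices for the upper
  bound.\<close>

lemma bounded_mons_count: "finite (bounded_mons n d)" "card (bounded_mons n d) \<le> num_mon n d"
proof -
  let ?L = "{l :: nat list. length l = n + 1 \<and> sum_list l = d}"
  let ?h = "\<lambda>t. map (Poly_Mapping.lookup t) [0..<n] @ [d - mon_degree t]"
  have card: "card ?L = num_mon n d"
    using card_length_sum_list[of "n + 1" d] binomial_symmetric[of d "d + n"]
    by (simp add: num_mon_def add.commute)
  then have "finite ?L"
    using num_mon_pos[of n d] by (intro card_ge_0_finite) simp
  have into: "?h ` bounded_mons n d \<subseteq> ?L"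
  proof (rule image_subsetI)
    fix t assume t: "t \<in> bounded_mons n d"
    then have "mon_degree t = (\<Sum>i<n. Poly_Mapping.lookup t i)"
      by (intro mon_degree_superset) (auto simp: bounded_mons_def)
    then have "sum_list (map (Poly_Mapping.lookup t) [0..<n]) = mon_degree t"
      by (simp add: interv_sum_list_conv_sum_set_nat atLeast0LessThan)
    with t show "?h t \<in> ?L"
      by (simp add: bounded_mons_def)
  qed
  have inj: "inj_on ?h (bounded_mons n d)"
  proof (rule inj_onI)
    fix s t assume st: "s \<in> bounded_mons n d" "t \<in> bounded_mons n d" "?h s = ?h t"
    then have eq: "Poly_Mapping.lookup s i = Poly_Mapping.lookup t i" if "i < n" for i
      using that by simp
    show "s = t"
    proof (rule poly_mapping_eqI)
      fix i
      show "Poly_Mapping.lookup s i = Poly_Mapping.lookup t i"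
      proof (cases "i < n")
        case False
        then have "i \<notin> Poly_Mapping.keys s" "i \<notin> Poly_Mapping.keys t"
          using st by (auto simp: bounded_mons_def)
        then show ?thesis
          by (simp add: in_keys_iff)
      qed (rule eq)
    qed
  qed
  show "finite (bounded_mons n d)"
    using finite_subset[OF into \<open>finite ?L\<close>] inj by (rule finite_imageD)
  show "card (bounded_mons n d) \<le> num_mon n d"
    using card_inj_on_le[OF inj into \<open>finite ?L\<close>] card by simp
qed

text \<open>A containment of supports: ring operations reduce to unions and sums of exponent
  vectors, and the number of terms is bounded at once.\<close>

definition bounded_poly :: "nat \<Rightarrow> nat \<Rightarrow> 'k::zero mpoly \<Rightarrow> bool" where
  "bounded_poly n d p \<longleftrightarrow> Poly_Mapping.keys p \<subseteq> bounded_mons n d"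

lemma bounded_poly_iff: "bounded_poly n d p \<longleftrightarrow> indets p \<subseteq> {..<n} \<and> total_degree p \<le> d"
  by (auto simp: bounded_poly_def bounded_mons_def indets_def total_degree_def)

lemma card_keys_bounded: "bounded_poly n d p \<Longrightarrow> card (Poly_Mapping.keys p) \<le> num_mon n d"
  unfolding bounded_poly_def
  by (meson bounded_mons_count card_mono order_trans)

lemma bounded_mons_mono: "d \<le> d' \<Longrightarrow> bounded_mons n d \<subseteq> bounded_mons n d'"
  by (auto simp: bounded_mons_def)

lemma bounded_poly_mono: "bounded_poly n d p \<Longrightarrow> d \<le> d' \<Longrightarrow> bounded_poly n d' p"
  using bounded_mons_mono unfolding bounded_poly_def by blast

lemma bounded_poly_0 [simp]: "bounded_poly n d 0"
  by (simp add: bounded_poly_def)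

lemma bounded_poly_add: "bounded_poly n d p \<Longrightarrow> bounded_poly n d q \<Longrightarrow> bounded_poly n d (p + q)"
  unfolding bounded_poly_def using keys_add[of p q] by blast

lemma bounded_poly_sum:
  "(\<And>i. i \<in> A \<Longrightarrow> bounded_poly n d (f i)) \<Longrightarrow> bounded_poly n d (sum f A)"
  by (induction A rule: infinite_finite_induct) (auto simp: bounded_poly_add)

lemma bounded_poly_sum_list:
  "(\<And>x. x \<in> set xs \<Longrightarrow> bounded_poly n d x) \<Longrightarrow> bounded_poly n d (sum_list xs)"
  by (induction xs) (auto simp: bounded_poly_add)

lemma bounded_poly_diff:
  fixes p q :: "'k::ab_group_add mpoly"
  shows "bounded_poly n d p \<Longrightarrow> bounded_poly n d q \<Longrightarrow> bounded_poly n d (p - q)"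
proof -
  have "Poly_Mapping.keys (p - q) \<subseteq> Poly_Mapping.keys p \<union> Poly_Mapping.keys q"
    by (auto simp: in_keys_iff lookup_minus)
  then show "bounded_poly n d p \<Longrightarrow> bounded_poly n d q \<Longrightarrow> bounded_poly n d (p - q)"
    unfolding bounded_poly_def by blast
qed

lemma bounded_poly_mult:
  assumes "bounded_poly n d p" "bounded_poly n d' q"
  shows "bounded_poly n (d + d') (p * q)"
proof -
  have "s + t \<in> bounded_mons n (d + d')" if "s \<in> bounded_mons n d" "t \<in> bounded_mons n d'" for s t
    using that keys_add[of s t] by (auto simp: bounded_mons_def mon_degree_add)
  then show ?thesis
    using assms keys_mult[of p q] unfolding bounded_poly_def by blast
qed

lemma bounded_poly_Const: "bounded_poly n d (Const c)"
  by (auto simp: bounded_poly_def bounded_mons_def Const_def mon_degree_def)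

lemma bounded_poly_Const_mult: "bounded_poly n d p \<Longrightarrow> bounded_poly n d (Const c * p)"
  using bounded_poly_mult[OF bounded_poly_Const[of n 0]] by simp

lemma bounded_poly_prod_list:
  fixes ps :: "'k::comm_ring_1 mpoly list"
  assumes "\<And>p. p \<in> set ps \<Longrightarrow> bounded_poly n d p"
  shows "bounded_poly n (length ps * d) (prod_list ps)"
  using assms
proof (induction ps)
  case Nil
  then show ?case
    using bounded_poly_Const[of n 0 "1::'k"] by (simp add: Const_1)
qed (auto intro: bounded_poly_mult)


section \<open>Operation counts\<close>

text \<open>The result is exact, the cost only an upper bound, and both must hold for every start
  value of the counter; so the costs of consecutive programs add up.\<close>

definition computes :: "'a counted \<Rightarrow> 'a \<Rightarrow> nat \<Rightarrow> bool" where
  "computes m x k \<longleftrightarrow> (\<forall>c. fst (run_state m c) = x \<and> snd (run_state m c) \<le> c + k)"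

lemma computes_mono: "computes m x k \<Longrightarrow> k \<le> l \<Longrightarrow> computes m x l"
  unfolding computes_def by (meson add_left_mono order_trans)

lemma computes_run:
  assumes "computes m x k"
  shows "fst (run_state m 0) = x" "snd (run_state m 0) \<le> k"
  using assms[unfolded computes_def, rule_format, of 0] by simp_all

lemma computes_return: "computes (State_Monad.return x) x 0"
  by (simp add: computes_def)

lemma computes_counted_op: "computes (counted_op x) x 1"
  by (simp add: computes_def counted_op_def)

lemma computes_bind:
  assumes "computes m x k" "computes (f x) y l"
  shows "computes (State_Monad.bind m f) y (k + l)"
  unfolding computes_def
proof (intro allI conjI)
  fix c
  obtain c' where c': "run_state m c = (x, c')" "c' \<le> c + k"
    using assms(1) by (metis computes_def prod.collapse)
  with assms(2) show "fst (run_state (State_Monad.bind m f) c) = y"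
    by (simp add: computes_def)
  have "snd (run_state (f x) c') \<le> c' + l"
    using assms(2) by (simp add: computes_def)
  with c' show "snd (run_state (State_Monad.bind m f) c) \<le> c + (k + l)"
    by simp
qed

lemma computes_counted_op_bind:
  "computes (f x) y k \<Longrightarrow> computes (State_Monad.bind (counted_op x) f) y (1 + k)"
  by (rule computes_bind[OF computes_counted_op])

lemma computes_two_ops:
  "computes (State_Monad.bind (counted_op x) (\<lambda>y. counted_op (f y))) (f x) 2"
  unfolding one_add_one[symmetric] by (intro computes_counted_op_bind computes_counted_op)

lemma computes_bind_return:
  "computes m x k \<Longrightarrow> y = f x \<Longrightarrow> computes (State_Monad.bind m (\<lambda>x. State_Monad.return (f x))) y k"
  using computes_bind[of m x k "\<lambda>x. State_Monad.return (f x)" y 0] by (simp add: computes_return)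

lemma computes_traverse:
  assumes "\<And>x. x \<in> set xs \<Longrightarrow> computes (f x) (g x) (k x)"
  shows "computes (State_Monad.traverse_list f xs) (map g xs) (\<Sum>x\<leftarrow>xs. k x)"
  using assms
proof (induction xs)
  case (Cons x xs)
  have "computes (State_Monad.traverse_list f (x # xs)) (g x # map g xs) (k x + ((\<Sum>x\<leftarrow>xs. k x) + 0))"
    unfolding State_Monad.traverse_list.simps
    by (rule computes_bind[OF Cons.prems computes_bind[OF Cons.IH computes_return]])
      (use Cons.prems in auto)
  then show ?case
    by simp
qed (simp add: computes_return)

lemma computes_traverse_const:
  assumes "\<And>x. x \<in> set xs \<Longrightarrow> computes (f x) (g x) k"
  shows "computes (State_Monad.traverse_list f xs) (map g xs) (length xs * k)"
  using computes_traverse[of xs f g "\<lambda>_. k"] assms by (simp add: sum_list_triv)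

text \<open>The invariant \<open>P\<close> is for elimination, whose cost per linear form is bounded
  only while the number and length of the vectors stay under control.\<close>

lemma computes_fold:
  assumes "\<And>x s. x \<in> set xs \<Longrightarrow> P s \<Longrightarrow> computes (f x s) (g x s) (k x) \<and> P (g x s)" "P s"
  shows "computes (fold_state f xs s) (fold g xs s) (\<Sum>x\<leftarrow>xs. k x)"
  using assms
proof (induction xs arbitrary: s)
  case (Cons x xs)
  have "computes (fold_state f (x # xs) s) (fold g xs (g x s)) (k x + (\<Sum>x\<leftarrow>xs. k x))"
    unfolding fold_state.simps
    by (rule computes_bind, use Cons.prems in force)
      (rule Cons.IH, use Cons.prems in auto)
  then show ?case
    by simp
qed (simp add: computes_return)

lemma fold_add: "fold (\<lambda>x s. s + h x) xs s = s + sum_list (map h xs)" for s :: "'a::comm_monoid_add"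
  by (induction xs arbitrary: s) (auto simp: ac_simps)

lemma fold_diff: "fold (\<lambda>x s. s - h x) xs s = s - sum_list (map h xs)" for s :: "'a::ab_group_add"
  by (induction xs arbitrary: s) auto

lemma computes_sum:
  fixes s :: "'a::comm_monoid_add"
  assumes "\<And>x s. x \<in> set xs \<Longrightarrow> computes (f x s) (s + h x) (k x)"
  shows "computes (fold_state f xs s) (s + (\<Sum>x\<leftarrow>xs. h x)) (\<Sum>x\<leftarrow>xs. k x)"
  using computes_fold[of xs "\<lambda>_. True" f "\<lambda>x s. s + h x" k s] assms by (simp add: fold_add)

lemma computes_diff:
  fixes s :: "'a::ab_group_add"
  assumes "\<And>x s. x \<in> set xs \<Longrightarrow> computes (f x s) (s - h x) (k x)"
  shows "computes (fold_state f xs s) (s - (\<Sum>x\<leftarrow>xs. h x)) (\<Sum>x\<leftarrow>xs. k x)"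
  using computes_fold[of xs "\<lambda>_. True" f "\<lambda>x s. s - h x" k s] assms by (simp add: fold_diff)

lemma set_monomials [simp]: "set (monomials ps) = (\<Union>p\<in>set ps. Poly_Mapping.keys p)"
  by (simp add: monomials_def)

lemma sum_list_monomials: "(\<Sum>t\<leftarrow>monomials [p]. h t) = (\<Sum>t\<in>Poly_Mapping.keys p. h t)"
  by (simp add: monomials_def sum_list_distinct_conv_sum_set)

lemma length_monomials: "length (monomials ps) = card (\<Union>p\<in>set ps. Poly_Mapping.keys p)"
  by (simp add: monomials_def)

lemma length_monomials_le:
  assumes "\<And>p. p \<in> set ps \<Longrightarrow> bounded_poly n d p"
  shows "length (monomials ps) \<le> num_mon n d"
proof -
  have "(\<Union>p\<in>set ps. Poly_Mapping.keys p) \<subseteq> bounded_mons n d"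
    using assms by (auto simp: bounded_poly_def)
  then show ?thesis
    unfolding length_monomials by (meson bounded_mons_count card_mono order_trans)
qed

lemma update_eq_add:
  "Poly_Mapping.update t (Poly_Mapping.lookup p t + c) p = p + Poly_Mapping.single t c"
  by (rule poly_mapping_eqI) (simp add: lookup_update lookup_add lookup_single when_def)

lemma computes_add_term: "computes (add_term c t p) (p + Poly_Mapping.single t c) 1"
  unfolding add_term_def add_q_def
  by (rule computes_bind_return[OF computes_counted_op]) (simp add: update_eq_add)

lemma computes_sub_term: "computes (sub_term c t p) (p - Poly_Mapping.single t c) 1"
  unfolding sub_term_def sub_q_def
  by (rule computes_bind_return[OF computes_counted_op])
    (use update_eq_add[of t p "- c"] in \<open>simp add: single_uminus\<close>)

lemma computes_add_multiple:
  "computes (add_multiple c s q p) (p + Poly_Mapping.single s c * q) (2 * card (Poly_Mapping.keys q))"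
proof -
  let ?h = "\<lambda>t. Poly_Mapping.single (s + t) (c * Poly_Mapping.lookup q t)"
  have "computes (add_multiple c s q p) (p + (\<Sum>t\<leftarrow>monomials [q]. ?h t)) (\<Sum>t\<leftarrow>monomials [q]. 1 + 1)"
    unfolding add_multiple_def mul_q_def
    by (intro computes_sum computes_counted_op_bind computes_add_term)
  moreover have "Poly_Mapping.single s c * q = (\<Sum>t\<in>Poly_Mapping.keys q. ?h t)"
    by (subst (1) poly_mapping_sum_single[of q, symmetric]) (simp add: sum_distrib_left mult_single)
  ultimately show ?thesis
    by (simp add: sum_list_monomials mult_2)
qed

lemma computes_mult_poly:
  "computes (mult_poly p q) (p * q) (card (Poly_Mapping.keys p) * (2 * card (Poly_Mapping.keys q)))"
proof -
  let ?h = "\<lambda>s. Poly_Mapping.single s (Poly_Mapping.lookup p s) * q"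
  have "computes (mult_poly p q) (0 + (\<Sum>t\<leftarrow>monomials [p]. ?h t))
      (\<Sum>t\<leftarrow>monomials [p]. 2 * card (Poly_Mapping.keys q))"
    unfolding mult_poly_def by (intro computes_sum computes_add_multiple)
  then show ?thesis
    by (simp add: sum_list_monomials poly_mapping_sum_single flip: sum_distrib_right)
qed

lemma computes_sub_poly: "computes (sub_poly p q) (p - q) (card (Poly_Mapping.keys q))"
proof -
  have "computes (sub_poly p q)
      (p - (\<Sum>t\<leftarrow>monomials [q]. Poly_Mapping.single t (Poly_Mapping.lookup q t))) (\<Sum>t\<leftarrow>monomials [q]. 1)"
    unfolding sub_poly_def by (intro computes_diff computes_sub_term)
  then show ?thesis
    by (simp add: sum_list_monomials poly_mapping_sum_single)
qed

lemma computes_linear_combination: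
  "computes (linear_combination cps) (\<Sum>(c, p)\<leftarrow>cps. Const c * p)
     (\<Sum>(c, p)\<leftarrow>cps. 2 * card (Poly_Mapping.keys p))"
proof -
  have "computes (linear_combination cps) (0 + (\<Sum>x\<leftarrow>cps. case x of (c, p) \<Rightarrow> Const c * p))
     (\<Sum>x\<leftarrow>cps. case x of (c, p) \<Rightarrow> 2 * card (Poly_Mapping.keys p))"
    unfolding linear_combination_def
    by (rule computes_sum) (use computes_add_multiple[where s = 0] in \<open>auto simp: Const_def\<close>)
  then show ?thesis
    by simp
qed

section \<open>Substitution of polynomials into monomials\<close>

lemma prod_list_factors: "prod_list (map v (factors t)) = mon_value v t"
proof -
  have "prod_list (map v (concat (map (\<lambda>i. replicate (l i) i) is))) = prod_list (map (\<lambda>i. v i ^ l i) is)"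
    for l and "is" :: "nat list"
    by (induction "is") (auto simp: prod_list_replicate)
  then show ?thesis
    unfolding factors_def mon_value_def
    by (simp add: prod.distinct_set_conv_list[symmetric])
qed

lemma length_factors: "length (factors t) = mon_degree t"
  by (simp add: factors_def mon_degree_def length_concat comp_def sum_list_distinct_conv_sum_set)

lemma set_factors: "set (factors t) = Poly_Mapping.keys t"
  by (auto simp: factors_def in_keys_iff)

text \<open>The index \<open>a\<close> counts the factors already in the accumulator, whose degree
  is then at most a f. It is arbitrary for the sake of the induction; the actual run starts at 1
  because the first factor is copied for free.\<close>

lemma computes_fold_mult:
  assumes "\<And>j. j \<in> set js \<Longrightarrow> bounded_poly n f (F ! j)" "bounded_poly n (a * f) acc"
  shows "computes (fold_state (\<lambda>j acc. mult_poly acc (F ! j)) js acc) (acc * prod_list (map ((!) F) js))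
    (\<Sum>e=a..<a + length js. 2 * (num_mon n (e * f) * num_mon n f))"
  using assms
proof (induction js arbitrary: a acc)
  case Nil
  then show ?case
    by (simp add: computes_return)
next
  case (Cons j js)
  have F: "bounded_poly n f (F ! j)"
    using Cons.prems by simp
  have "computes (mult_poly acc (F ! j)) (acc * F ! j) (2 * (num_mon n (a * f) * num_mon n f))"
  proof (rule computes_mono[OF computes_mult_poly])
    show "card (Poly_Mapping.keys acc) * (2 * card (Poly_Mapping.keys (F ! j))) \<le>
        2 * (num_mon n (a * f) * num_mon n f)"
      using mult_le_mono[OF card_keys_bounded[OF Cons.prems(2)] card_keys_bounded[OF F]] by simp
  qed
  moreover have "bounded_poly n (Suc a * f) (acc * F ! j)"
    using bounded_poly_mult[OF Cons.prems(2) F] by (simp add: add.commute)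
  then have "computes (fold_state (\<lambda>j acc. mult_poly acc (F ! j)) js (acc * F ! j))
      (acc * F ! j * prod_list (map ((!) F) js))
      (\<Sum>e=Suc a..<Suc a + length js. 2 * (num_mon n (e * f) * num_mon n f))"
    by (intro Cons.IH) (use Cons.prems in auto)
  ultimately have "computes (fold_state (\<lambda>j acc. mult_poly acc (F ! j)) (j # js) acc)
      (acc * F ! j * prod_list (map ((!) F) js))
      (2 * (num_mon n (a * f) * num_mon n f) +
       (\<Sum>e=Suc a..<Suc a + length js. 2 * (num_mon n (e * f) * num_mon n f)))"
    unfolding fold_state.simps by (rule computes_bind)
  moreover have "(\<Sum>e=a..<a + length (j # js). 2 * (num_mon n (e * f) * num_mon n f)) =
      2 * (num_mon n (a * f) * num_mon n f) +
      (\<Sum>e=Suc a..<Suc a + length js. 2 * (num_mon n (e * f) * num_mon n f))"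
    by (subst sum.atLeast_Suc_lessThan) simp_all
  ultimately show ?case
    by (simp add: mult.assoc)
qed

definition subst_poly :: "rat mpoly list \<Rightarrow> rat mpoly \<Rightarrow> rat mpoly" where
  "subst_poly F g = meval Const ((!) F) g"

context
  fixes n f :: nat and F :: "rat mpoly list"
  assumes len: "length F = n" and bounded_F: "\<And>p. p \<in> set F \<Longrightarrow> bounded_poly n f p"
begin

lemma bounded_mon_value:
  assumes "t \<in> bounded_mons n d"
  shows "bounded_poly n (d * f) (mon_value ((!) F) t)"
proof -
  have "bounded_poly n (length (map ((!) F) (factors t)) * f) (prod_list (map ((!) F) (factors t)))"
    by (rule bounded_poly_prod_list)
      (use assms len bounded_F in \<open>auto simp: set_factors bounded_mons_def\<close>)
  then have "bounded_poly n (mon_degree t * f) (mon_value ((!) F) t)"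
    by (simp add: length_factors prod_list_factors)
  then show ?thesis
    by (rule bounded_poly_mono) (use assms in \<open>auto simp: bounded_mons_def\<close>)
qed

lemma bounded_subst_poly:
  assumes "bounded_poly n d g"
  shows "bounded_poly n (d * f) (subst_poly F g)"
  unfolding subst_poly_def meval_mon_value
  by (intro bounded_poly_sum bounded_poly_Const_mult bounded_mon_value)
    (use assms in \<open>auto simp: bounded_poly_def\<close>)

lemma computes_subst_monomial:
  assumes "t \<in> bounded_mons n d"
  shows "computes (subst_monomial F t) (mon_value ((!) F) t)
    (2 * (\<Sum>e=1..<d. num_mon n (e * f) * num_mon n f))"
proof (cases "factors t")
  case Nil
  then show ?thesis
    using computes_mono[OF computes_return, of "2 * (\<Sum>e=1..<d. num_mon n (e * f) * num_mon n f)"]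
    by (simp add: subst_monomial_def flip: prod_list_factors)
next
  case (Cons i js)
  have F: "bounded_poly n f (F ! j)" if "j \<in> set (factors t)" for j
    using that assms len by (intro bounded_F nth_mem) (auto simp: set_factors bounded_mons_def)
  have "computes (fold_state (\<lambda>j acc. mult_poly acc (F ! j)) js (F ! i))
      (F ! i * prod_list (map ((!) F) js))
      (\<Sum>e=1..<1 + length js. 2 * (num_mon n (e * f) * num_mon n f))"
    by (rule computes_fold_mult) (use F Cons in auto)
  moreover have "(\<Sum>e=1..<1 + length js. 2 * (num_mon n (e * f) * num_mon n f)) \<le>
      (\<Sum>e=1..<d. 2 * (num_mon n (e * f) * num_mon n f))"
    using assms length_factors[of t] Cons by (intro sum_mono2) (auto simp: bounded_mons_def)
  ultimately show ?thesis
    using Cons by (auto simp: subst_monomial_def sum_distrib_left simp flip: prod_list_factors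
        intro: computes_mono)
qed

text \<open>All of \<open>gs\<close> share one table of substituted monomials, so
  \<open>subst_cost\<close> is not multiplied by their number. Each polynomial only pays for
  combining at most N(d) table entries of at most N(d f) terms.\<close>

lemma computes_compose_all:
  assumes "\<And>g. g \<in> set gs \<Longrightarrow> bounded_poly n d g"
  shows "computes (compose_all gs F) (map (subst_poly F) gs)
    (2 * subst_cost n d f + length gs * (2 * (num_mon n d * num_mon n (d * f))))"
proof -
  let ?ms = "monomials gs" and ?v = "mon_value ((!) F)"
  have bm: "t \<in> bounded_mons n d" if "g \<in> set gs" "t \<in> Poly_Mapping.keys g" for t g
    using assms that by (auto simp: bounded_poly_def)
  let ?table = "map_of (zip ?ms (map ?v ?ms))"
  have table: "?table t = Some (?v t)" if "g \<in> set gs" "t \<in> Poly_Mapping.keys g" for t g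
    using that by (auto simp: map_of_zip_map)
  let ?k = "\<Sum>e=1..<d. num_mon n (e * f) * num_mon n f"
  have "computes (State_Monad.traverse_list (subst_monomial F) ?ms) (map ?v ?ms) (length ?ms * (2 * ?k))"
    by (intro computes_traverse_const computes_subst_monomial) (use bm in auto)
  moreover have "length ?ms * (2 * ?k) \<le> 2 * subst_cost n d f"
    using mult_le_mono1[OF length_monomials_le[OF assms], of gs "2 * ?k"] by (simp add: subst_cost_def)
  ultimately have "computes (State_Monad.traverse_list (subst_monomial F) ?ms) (map ?v ?ms) (2 * subst_cost n d f)"
    by (rule computes_mono)
  moreover have "computes (State_Monad.traverse_list (\<lambda>g. linear_combination
       (map (\<lambda>t. (Poly_Mapping.lookup g t, the (?table t))) (monomials [g]))) gs)
       (map (subst_poly F) gs) (length gs * (2 * (num_mon n d * num_mon n (d * f))))"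
  proof (rule computes_traverse_const)
    fix g assume g: "g \<in> set gs"
    let ?l = "map (\<lambda>t. (Poly_Mapping.lookup g t, the (?table t))) (monomials [g])"
    have l: "?l = map (\<lambda>t. (Poly_Mapping.lookup g t, ?v t)) (monomials [g])"
      using table[OF g] by simp
    have "(\<Sum>(c, p)\<leftarrow>?l. Const c * p) = subst_poly F g"
      unfolding l by (simp add: comp_def sum_list_monomials subst_poly_def meval_mon_value)
    moreover have "(\<Sum>(c, p)\<leftarrow>?l. 2 * card (Poly_Mapping.keys p)) \<le> 2 * (num_mon n d * num_mon n (d * f))"
    proof -
      have "(\<Sum>(c, p)\<leftarrow>?l. 2 * card (Poly_Mapping.keys p)) =
          (\<Sum>t\<in>Poly_Mapping.keys g. 2 * card (Poly_Mapping.keys (?v t)))"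
        unfolding l by (simp add: comp_def sum_list_monomials)
      also have "\<dots> \<le> (\<Sum>t\<in>Poly_Mapping.keys g. 2 * num_mon n (d * f))"
        by (intro sum_mono mult_left_mono card_keys_bounded bounded_mon_value bm[OF g]) auto
      also have "\<dots> \<le> num_mon n d * (2 * num_mon n (d * f))"
        using card_keys_bounded[OF assms[OF g]] by simp
      finally show ?thesis
        by simp
    qed
    ultimately show "computes (linear_combination ?l) (subst_poly F g) (2 * (num_mon n d * num_mon n (d * f)))"
      using computes_mono[OF computes_linear_combination[of ?l]] by simp
  qed
  ultimately show ?thesis
    unfolding compose_all_def Let_def by (rule computes_bind)
qed

lemma computes_difference:
  assumes "\<And>g. g \<in> set gs \<Longrightarrow> bounded_poly n d g"
  shows "computes (difference gs F) (map (\<lambda>g. g - subst_poly F g) gs)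
    (2 * subst_cost n d f + length gs * (2 * (num_mon n d * num_mon n (d * f))) +
     length gs * num_mon n (d * f))"
proof -
  have "computes (State_Monad.traverse_list (\<lambda>(g, gF). sub_poly g gF) (zip gs (map (subst_poly F) gs)))
      (map (\<lambda>(g, gF). g - gF) (zip gs (map (subst_poly F) gs)))
      (length (zip gs (map (subst_poly F) gs)) * num_mon n (d * f))"
  proof (rule computes_traverse_const)
    fix x assume "x \<in> set (zip gs (map (subst_poly F) gs))"
    then obtain g where x: "x = (g, subst_poly F g)" "g \<in> set gs"
      by (auto simp: zip_map2 set_zip)
    show "computes (case x of (g, gF) \<Rightarrow> sub_poly g gF) (case x of (g, gF) \<Rightarrow> g - gF) (num_mon n (d * f))"
      unfolding x prod.case
      by (rule computes_mono[OF computes_sub_poly card_keys_bounded])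
        (intro bounded_subst_poly assms x)
  qed
  moreover have "map (\<lambda>(g, gF). g - gF) (zip gs (map (subst_poly F) gs)) = map (\<lambda>g. g - subst_poly F g) gs"
    by (induction gs) auto
  ultimately show ?thesis
    unfolding difference_def by (intro computes_bind[OF computes_compose_all[OF assms]]) simp_all
qed

end

section \<open>Elimination as pure functions, and its cost\<close>

lemma traverse_pairs_map: "map snd (filter fst (zip (map P xs) xs)) = filter P xs"
  by (induction xs) auto

lemma traverse_triples_map:
  "map snd (filter (\<lambda>(z, _). \<not> z) (zip (map (P \<circ> h) xs) (zip (map h xs) xs))) =
    map (\<lambda>x. (h x, x)) (filter (\<lambda>x. \<not> P (h x)) xs)"
  by (induction xs) auto

definition dot :: "rat list \<Rightarrow> rat list \<Rightarrow> rat" where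
  "dot u v = (\<Sum>(x, y)\<leftarrow>zip u v. x * y)"

definition eliminate :: "rat list \<Rightarrow> rat list \<Rightarrow> rat list \<Rightarrow> rat list" where
  "eliminate L v\<^sub>0 v = map (\<lambda>(x, y). x - dot L v / dot L v\<^sub>0 * y) (zip v v\<^sub>0)"

definition restricted :: "rat list \<Rightarrow> rat list list \<Rightarrow> rat list list" where
  "restricted L B = filter (\<lambda>v. dot L v = 0) B @
     (case filter (\<lambda>v. dot L v \<noteq> 0) B of [] \<Rightarrow> [] | v\<^sub>0 # rest \<Rightarrow> map (eliminate L v\<^sub>0) rest)"

lemma computes_dot_product: "computes (dot_product u v) (dot u v) (2 * length u)"
proof -
  have "computes (dot_product u v) (0 + (\<Sum>z\<leftarrow>zip u v. case z of (x, y) \<Rightarrow> x * y)) (\<Sum>z\<leftarrow>zip u v. 1 + 1)"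
    unfolding dot_product_def
    by (rule computes_sum)
      (auto simp: mul_q_def add_q_def[abs_def] simp del: One_nat_def intro!: computes_two_ops)
  then have "computes (dot_product u v) (dot u v) (length (zip u v) * 2)"
    by (simp add: dot_def sum_list_triv mult_2_right)
  then show ?thesis
    by (rule computes_mono) simp
qed

lemma computes_eliminate:
  "computes (do { c \<leftarrow> div_q (dot L v) (dot L v\<^sub>0); sub_multiple v c v\<^sub>0 }) (eliminate L v\<^sub>0 v)
    (1 + length v * 2)"
proof (rule computes_bind)
  show "computes (div_q (dot L v) (dot L v\<^sub>0)) (dot L v / dot L v\<^sub>0) 1"
    unfolding div_q_def by (rule computes_counted_op)
  have "computes (sub_multiple v c v\<^sub>0) (map (\<lambda>(x, y). x - c * y) (zip v v\<^sub>0)) (length (zip v v\<^sub>0) * (1 + 1))" for c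
    unfolding sub_multiple_def mul_q_def sub_q_def
    by (rule computes_traverse_const)
      (auto simp del: One_nat_def intro!: computes_two_ops)
  then show "computes (sub_multiple v (dot L v / dot L v\<^sub>0) v\<^sub>0) (eliminate L v\<^sub>0 v) (length v * 2)"
    unfolding eliminate_def by (rule computes_mono) simp
qed

definition basis_shape :: "nat \<Rightarrow> rat list list \<Rightarrow> bool" where
  "basis_shape m B \<longleftrightarrow> length B \<le> m \<and> (\<forall>v\<in>set B. length v = m)"

text \<open>Each basis vector costs at most 2 m for the value of the form, one test, one division
  and 2 m for the correction. For m \<ge> 1 this is 4 m + 2 \<le> 6 m, and there are at most m
  vectors.\<close>

lemma computes_restrict_basis:
  assumes L: "length L = m" and shape: "basis_shape m B"
  shows "computes (restrict_basis L B) (restricted L B) (6 * m ^ 2)"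
proof -
  have B: "length B \<le> m" "\<And>v. v \<in> set B \<Longrightarrow> length v = m"
    using shape by (auto simp: basis_shape_def)
  have 1: "computes (State_Monad.traverse_list (dot_product L) B) (map (dot L) B) (length B * (2 * m))"
    by (rule computes_traverse_const) (use computes_dot_product[of L] L in simp)
  have 2: "computes (State_Monad.traverse_list is_zero_q (map (dot L) B)) (map (\<lambda>v. dot L v = 0) B)
      (length B * 1)"
    using computes_traverse_const[of "map (dot L) B" is_zero_q "\<lambda>x. x = 0" 1]
    by (simp add: is_zero_q_def computes_counted_op[unfolded One_nat_def] comp_def)
  let ?out = "filter (\<lambda>v. dot L v \<noteq> 0) B"
  let ?in = "filter (\<lambda>v. dot L v = 0) B"
  have 3: "computes (case map (\<lambda>v. (dot L v, v)) ?out of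
        [] \<Rightarrow> State_Monad.return ?in
      | (l\<^sub>0, v\<^sub>0) # rest \<Rightarrow> do {
          rest' \<leftarrow> State_Monad.traverse_list
            (\<lambda>(l, v). do { c \<leftarrow> div_q l l\<^sub>0; sub_multiple v c v\<^sub>0 }) rest;
          State_Monad.return (?in @ rest') }) (restricted L B) (length B * (1 + m * 2))"
  proof (cases ?out)
    case Nil
    then show ?thesis
      using computes_mono[OF computes_return] by (simp add: restricted_def)
  next
    case (Cons v\<^sub>0 rest)
    have sub: "set rest \<subseteq> set B" "length rest \<le> length B"
      using Cons length_filter_le[of "\<lambda>v. dot L v \<noteq> 0" B] by (force dest: arg_cong[of _ _ set], simp)
    have "computes (State_Monad.traverse_list (\<lambda>(l, v). do { c \<leftarrow> div_q l (dot L v\<^sub>0); sub_multiple v c v\<^sub>0 })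
        (map (\<lambda>v. (dot L v, v)) rest)) (map (\<lambda>(l, v). eliminate L v\<^sub>0 v) (map (\<lambda>v. (dot L v, v)) rest))
        (length (map (\<lambda>v. (dot L v, v)) rest) * (1 + m * 2))"
      by (rule computes_traverse_const) (use computes_eliminate sub B in fastforce)
    then have "computes (State_Monad.traverse_list (\<lambda>(l, v). do { c \<leftarrow> div_q l (dot L v\<^sub>0); sub_multiple v c v\<^sub>0 })
        (map (\<lambda>v. (dot L v, v)) rest)) (map (eliminate L v\<^sub>0) rest) (length B * (1 + m * 2))"
      using mult_le_mono1[OF sub(2), of "1 + m * 2"] by (auto simp: comp_def elim!: computes_mono)
    then show ?thesis
      unfolding Cons by (auto simp: restricted_def Cons intro!: computes_bind_return)
  qed
  have 4: "map snd (filter (\<lambda>(z, _). \<not> z) (zip (map (\<lambda>v. dot L v = 0) B) (zip (map (dot L) B) B))) =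
      map (\<lambda>v. (dot L v, v)) ?out"
    using traverse_triples_map[of "\<lambda>x. x = 0" "dot L" B] by (simp add: comp_def)
  have "computes (restrict_basis L B) (restricted L B)
      (length B * (2 * m) + (length B * 1 + length B * (1 + m * 2)))"
    unfolding restrict_basis_def Let_def
    by (rule computes_bind[OF 1], rule computes_bind[OF 2], unfold 4 traverse_pairs_map, rule 3)
  then show ?thesis
  proof (rule computes_mono)
    have "length B * (2 * m) + (length B * 1 + length B * (1 + m * 2)) = length B * (4 * m + 2)"
      by (simp add: algebra_simps)
    also have "\<dots> \<le> m * (4 * m + 2 * m)"
      by (cases m) (use B(1) in \<open>simp, intro mult_le_mono, auto\<close>)
    finally show "length B * (2 * m) + (length B * 1 + length B * (1 + m * 2)) \<le> 6 * m ^ 2"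
      by (simp add: power2_eq_square)
  qed
qed

lemma basis_shape_restricted:
  assumes "basis_shape m B"
  shows "basis_shape m (restricted L B)"
  unfolding basis_shape_def
proof (intro conjI ballI)
  have assms: "length B \<le> m" "\<And>v. v \<in> set B \<Longrightarrow> length v = m"
    using assms by (auto simp: basis_shape_def)
  have len: "length (filter (\<lambda>v. dot L v = 0) B) + length (filter (\<lambda>v. dot L v \<noteq> 0) B) = length B"
    using sum_length_filter_compl[of "\<lambda>v. dot L v = 0" B] by simp
  then show "length (restricted L B) \<le> m"
    using assms(1) by (auto simp: restricted_def split: list.split)
  fix v assume v: "v \<in> set (restricted L B)"
  show "length v = m"
  proof (cases "filter (\<lambda>v. dot L v \<noteq> 0) B")
    case Nil
    with v assms(2) show ?thesis
      by (auto simp: restricted_def)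
  next
    case (Cons v\<^sub>0 rest)
    then have "set (v\<^sub>0 # rest) \<subseteq> set B"
      by (metis filter_is_subset)
    with v Cons assms(2) show ?thesis
      by (auto simp: restricted_def eliminate_def)
  qed
qed

definition unit_vectors :: "nat \<Rightarrow> rat list list" where
  "unit_vectors m = map (\<lambda>i. map (\<lambda>j. if i = j then 1 else 0) [0..<m]) [0..<m]"

definition kernel_vectors :: "nat \<Rightarrow> rat list list \<Rightarrow> rat list list" where
  "kernel_vectors m Ls = fold restricted Ls (unit_vectors m)"

lemma basis_shape_unit_vectors: "basis_shape m (unit_vectors m)"
  by (auto simp: basis_shape_def unit_vectors_def)

lemma basis_shape_kernel: "basis_shape m (kernel_vectors m Ls)"
proof -
  have "basis_shape m (fold restricted Ls B)" if "basis_shape m B" for B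
    using that by (induction Ls arbitrary: B) (auto simp: basis_shape_restricted)
  then show ?thesis
    unfolding kernel_vectors_def by (simp add: basis_shape_unit_vectors)
qed

lemma computes_kernel_basis:
  assumes "\<And>L. L \<in> set Ls \<Longrightarrow> length L = m"
  shows "computes (kernel_basis m Ls) (kernel_vectors m Ls) (length Ls * (6 * m ^ 2))"
proof -
  have "computes (fold_state restrict_basis Ls (unit_vectors m)) (fold restricted Ls (unit_vectors m))
      (\<Sum>L\<leftarrow>Ls. 6 * m ^ 2)"
    by (rule computes_fold[where P = "basis_shape m"])
      (simp_all add: assms computes_restrict_basis basis_shape_restricted basis_shape_unit_vectors)
  then show ?thesis
    by (simp add: kernel_basis_def kernel_vectors_def unit_vectors_def sum_list_triv)
qed

section \<open>The cost of the whole algorithm\<close>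

definition at_start :: "nat \<Rightarrow> rat mpoly \<Rightarrow> rat mpoly" where
  "at_start n P =
    (\<Sum>t\<in>Poly_Mapping.keys P. Poly_Mapping.single (shift_monomial n t) (Poly_Mapping.lookup P t))"

lemma computes_minus_initial:
  "computes (minus_initial n P) (P - at_start n P) (card (Poly_Mapping.keys P))"
proof -
  have "computes (minus_initial n P)
      (P - (\<Sum>t\<leftarrow>monomials [P]. Poly_Mapping.single (shift_monomial n t) (Poly_Mapping.lookup P t)))
      (\<Sum>t\<leftarrow>monomials [P]. 1)"
    unfolding minus_initial_def by (intro computes_diff computes_sub_term)
  then show ?thesis
    by (simp add: sum_list_monomials at_start_def)
qed

definition differences :: "rat mpoly list \<Rightarrow> rat mpoly list \<Rightarrow> rat mpoly list" where
  "differences gs F = map (\<lambda>g. g - subst_poly F g) gs"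

definition combination :: "rat list \<Rightarrow> rat mpoly list \<Rightarrow> rat mpoly" where
  "combination c gs = (\<Sum>(c, g)\<leftarrow>zip c gs. Const c * g)"

definition invariant_kernel :: "rat mpoly list \<Rightarrow> rat mpoly list list \<Rightarrow> rat list list" where
  "invariant_kernel gs Fs =
    kernel_vectors (length gs) (concat (map coefficient_forms (map (differences gs) Fs)))"

definition specific_form_value :: "nat \<Rightarrow> rat mpoly list \<Rightarrow> rat mpoly list list \<Rightarrow> rat mpoly list" where
  "specific_form_value n gs Fs =
    map (\<lambda>P. P - at_start n P) (map (\<lambda>c. combination c gs) (invariant_kernel gs Fs))"

text \<open>Map number i contributes at most N(d f_i) linear forms, each eliminated at cost 6 m^2.
  The kernel basis has at most m vectors, so the output takes 2 m^2 N(d) for the combinations and m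
  N(d), rounded up to m^2 N(d), for the subtractions.\<close>

lemma computes_specific_form:
  assumes gs: "\<And>g. g \<in> set gs \<Longrightarrow> bounded_poly n d g"
    and Fs: "\<And>i. i < length Fs \<Longrightarrow> length (Fs ! i) = n"
      "\<And>i p. i < length Fs \<Longrightarrow> p \<in> set (Fs ! i) \<Longrightarrow> bounded_poly n (f i) p"
    and f: "\<And>i. i < length Fs \<Longrightarrow> f i \<ge> 1"
    and m: "m = length gs"
  shows "computes (specific_form_counted n gs Fs) (specific_form_value n gs Fs)
    ((\<Sum>i<length Fs. 2 * subst_cost n d (f i) + 2 * m * (num_mon n d * num_mon n (d * f i)) +
       m * num_mon n (d * f i) + 6 * m ^ 2 * num_mon n (d * f i)) + 3 * m ^ 2 * num_mon n d)"
proof -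
  let ?k = "length Fs"
  let ?c = "\<lambda>i. 2 * subst_cost n d (f i) + m * (2 * (num_mon n d * num_mon n (d * f i))) +
       m * num_mon n (d * f i)"
  have "computes (State_Monad.traverse_list (\<lambda>i. difference gs (Fs ! i)) [0..<?k])
      (map (\<lambda>i. differences gs (Fs ! i)) [0..<?k]) (\<Sum>i\<leftarrow>[0..<?k]. ?c i)"
    unfolding differences_def m
    by (intro computes_traverse computes_difference) (use gs Fs in auto)
  moreover have "State_Monad.traverse_list (\<lambda>i. difference gs (Fs ! i)) [0..<?k] =
      State_Monad.traverse_list (difference gs) Fs"
  proof -
    have "State_Monad.traverse_list (\<lambda>i. difference gs (v i)) is =
        State_Monad.traverse_list (difference gs) (map v is)" for v and "is" :: "nat list"
      by (induction "is") auto
    from this[of "(!) Fs" "[0..<?k]"] show ?thesis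
      by (simp add: map_nth)
  qed
  moreover have "map (\<lambda>i. differences gs (Fs ! i)) [0..<?k] = map (differences gs) Fs"
    by (rule nth_equalityI) auto
  ultimately have 1: "computes (State_Monad.traverse_list (difference gs) Fs) (map (differences gs) Fs)
      (\<Sum>i<?k. ?c i)"
    by (simp add: interv_sum_list_conv_sum_set_nat atLeast0LessThan)
  let ?Ls = "concat (map coefficient_forms (map (differences gs) Fs))"
  have len: "length ?Ls \<le> (\<Sum>i<?k. num_mon n (d * f i))"
  proof -
    have "length ?Ls = (\<Sum>i<?k. length (coefficient_forms (differences gs (Fs ! i))))"
      by (simp add: length_concat comp_def sum_list_sum_nth atLeast0LessThan)
    also have "\<dots> \<le> (\<Sum>i<?k. num_mon n (d * f i))"
    proof (rule sum_mono)
      fix i assume i: "i \<in> {..<?k}"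
      have "length (monomials (differences gs (Fs ! i))) \<le> num_mon n (d * f i)"
      proof (rule length_monomials_le)
        fix p assume "p \<in> set (differences gs (Fs ! i))"
        then obtain g where g: "g \<in> set gs" "p = g - subst_poly (Fs ! i) g"
          by (auto simp: differences_def)
        \<comment> \<open>The uncomposed polynomial has degree up to d, which stays within d f_i
          because f_i \<ge> 1.\<close>
        have "bounded_poly n (d * f i) g"
          by (rule bounded_poly_mono[OF gs[OF g(1)]]) (use f[of i] i in simp)
        moreover have "bounded_poly n (d * f i) (subst_poly (Fs ! i) g)"
          by (rule bounded_subst_poly[OF Fs(1) Fs(2) gs[OF g(1)]]) (use i in auto)
        ultimately show "bounded_poly n (d * f i) p"
          unfolding g(2) by (rule bounded_poly_diff)
      qed
      then show "length (coefficient_forms (differences gs (Fs ! i))) \<le> num_mon n (d * f i)"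
        by (simp add: coefficient_forms_def)
    qed
    finally show ?thesis .
  qed
  have 2: "computes (kernel_basis m ?Ls) (invariant_kernel gs Fs) ((\<Sum>i<?k. num_mon n (d * f i)) * (6 * m ^ 2))"
    unfolding invariant_kernel_def m
    by (rule computes_mono[OF computes_kernel_basis mult_le_mono1[OF len[unfolded m]]])
      (auto simp: coefficient_forms_def differences_def)
  let ?B = "invariant_kernel gs Fs"
  have B: "length ?B \<le> m"
    using basis_shape_kernel by (simp add: invariant_kernel_def m basis_shape_def)
  have bounded: "bounded_poly n d (combination c gs)" for c :: "rat list"
    unfolding combination_def
    by (rule bounded_poly_sum_list) (auto intro!: bounded_poly_Const_mult[OF gs] dest: set_zip_rightD)
  have "computes (State_Monad.traverse_list (\<lambda>c. linear_combination (zip c gs)) ?B) (map (\<lambda>c. combination c gs) ?B)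
      (length ?B * (m * (2 * num_mon n d)))"
  proof (rule computes_traverse_const)
    fix c :: "rat list"
    have "(\<Sum>x\<leftarrow>zip c gs. case x of (c, p) \<Rightarrow> 2 * card (Poly_Mapping.keys p)) \<le> (\<Sum>x\<leftarrow>zip c gs. 2 * num_mon n d)"
      by (rule sum_list_mono) (auto intro!: card_keys_bounded gs dest: set_zip_rightD)
    also have "\<dots> \<le> m * (2 * num_mon n d)"
      by (simp add: sum_list_triv m)
    finally show "computes (linear_combination (zip c gs)) (combination c gs) (m * (2 * num_mon n d))"
      unfolding combination_def by (rule computes_mono[OF computes_linear_combination])
  qed
  then have 3: "computes (State_Monad.traverse_list (\<lambda>c. linear_combination (zip c gs)) ?B)
      (map (\<lambda>c. combination c gs) ?B) (m * (m * (2 * num_mon n d)))"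
    by (rule computes_mono) (use B in simp)
  let ?Ps = "map (\<lambda>c. combination c gs) ?B"
  have "computes (State_Monad.traverse_list (minus_initial n) ?Ps) (map (\<lambda>P. P - at_start n P) ?Ps)
      (length ?Ps * num_mon n d)"
    by (rule computes_traverse_const)
      (auto intro!: computes_mono[OF computes_minus_initial] card_keys_bounded bounded)
  then have 4: "computes (State_Monad.traverse_list (minus_initial n) ?Ps) (specific_form_value n gs Fs)
      (m ^ 2 * num_mon n d)"
    unfolding specific_form_value_def
    by (rule computes_mono) (use B in \<open>auto simp: power2_eq_square intro!: order_trans[OF B]\<close>)
  have "computes (specific_form_counted n gs Fs) (specific_form_value n gs Fs)
      ((\<Sum>i<?k. ?c i) + ((\<Sum>i<?k. num_mon n (d * f i)) * (6 * m ^ 2) +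
       (m * (m * (2 * num_mon n d)) + m ^ 2 * num_mon n d)))"
    unfolding specific_form_counted_def m[symmetric]
    by (rule computes_bind[OF 1], rule computes_bind[OF 2],
        rule computes_bind[OF 3], rule 4)
  then show ?thesis
    by (rule computes_mono)
      (simp add: sum.distrib sum_distrib_left sum_distrib_right algebra_simps power2_eq_square)
qed


section \<open>The kernel algorithm\<close>

text \<open>Independence of lists treats a repeated vector as a dependence. This matters for the
  output, where two kernel vectors may yield the same polynomial P(x) - P(a).\<close>

locale vector_list_space = vector_space
begin

definition independent_list :: "'b list \<Rightarrow> bool" where
  "independent_list vs \<longleftrightarrow> distinct vs \<and> independent (set vs)"

lemma independent_list_Nil: "independent_list []"
  by (simp add: independent_list_def independent_empty)

lemma independent_list_Cons: "independent_list (v # vs) \<longleftrightarrow> v \<notin> span (set vs) \<and> independent_list vs"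
  by (auto simp: independent_list_def independent_insert span_base)

lemma independent_list_mset: "mset vs = mset ws \<Longrightarrow> independent_list vs \<longleftrightarrow> independent_list ws"
  by (metis independent_list_def mset_eq_imp_distinct_iff mset_eq_setD)

text \<open>Adding the multiple of \<open>v\<^sub>0\<close> back undoes the shear, so each
  generating set lies in the span of the other.\<close>

lemma span_insert_shear: "span (insert v\<^sub>0 ((\<lambda>v. v - scale (c v) v\<^sub>0) ` S)) = span (insert v\<^sub>0 S)"
proof -
  have "v - scale (c v) v\<^sub>0 \<in> span (insert v\<^sub>0 S)" if "v \<in> S" for v
    using that by (intro span_diff span_scale span_base) auto
  moreover have "v \<in> span (insert v\<^sub>0 ((\<lambda>v. v - scale (c v) v\<^sub>0) ` S))" (is "v \<in> ?T") if "v \<in> S" for v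
  proof -
    have "(v - scale (c v) v\<^sub>0) + scale (c v) v\<^sub>0 \<in> ?T"
      using that by (intro span_add span_scale span_base) auto
    then show ?thesis
      by simp
  qed
  ultimately show ?thesis
    unfolding span_eq by (auto intro: span_base)
qed

text \<open>The fixed vector stands last so that the induction can peel off the sheared vectors one
  at a time.\<close>

lemma independent_list_shear:
  assumes "independent_list (vs @ [v\<^sub>0])"
  shows "independent_list (map (\<lambda>v. v - scale (c v) v\<^sub>0) vs @ [v\<^sub>0])"
  using assms
proof (induction vs)
  case (Cons v vs)
  let ?h = "\<lambda>v. v - scale (c v) v\<^sub>0"
  have "v \<notin> span (insert v\<^sub>0 (set vs))"
    using Cons.prems by (simp add: independent_list_Cons)
  moreover have "v \<in> span (insert v\<^sub>0 (set vs))" if "?h v \<in> span (insert v\<^sub>0 (set vs))"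
  proof -
    have "?h v + scale (c v) v\<^sub>0 \<in> span (insert v\<^sub>0 (set vs))"
      using that by (intro span_add span_scale span_base[of v\<^sub>0]) auto
    then show ?thesis
      by simp
  qed
  ultimately have "?h v \<notin> span (insert v\<^sub>0 (?h ` set vs))"
    unfolding span_insert_shear by blast
  with Cons show ?case
    by (simp add: independent_list_Cons)
qed simp

text \<open>The sheared vectors lie in the kernel of \<open>\<phi>\<close> and, together with
  \<open>v\<^sub>0\<close>, still span everything. So an element of the kernel is a combination of
  them plus a multiple of \<open>v\<^sub>0\<close>, and applying \<open>\<phi>\<close> shows that
  this multiple is zero.\<close>

lemma elimination_step:
  assumes add: "\<And>x y. \<phi> (x + y) = \<phi> x + \<phi> y" and scale: "\<And>c x. \<phi> (scale c x) = c * \<phi> x"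
    and v\<^sub>0: "\<phi> v\<^sub>0 \<noteq> 0" and indep: "independent_list (vs @ [v\<^sub>0])"
  defines "ws \<equiv> map (\<lambda>v. v - scale (\<phi> v / \<phi> v\<^sub>0) v\<^sub>0) vs"
  shows "independent_list ws" "span (set ws) = {x \<in> span (set (vs @ [v\<^sub>0])). \<phi> x = 0}"
proof -
  have "independent_list (ws @ [v\<^sub>0])"
    unfolding ws_def by (rule independent_list_shear[OF indep])
  then show "independent_list ws"
    using independent_mono[of "insert v\<^sub>0 (set ws)" "set ws"] by (auto simp: independent_list_def)
  have diff: "\<phi> (x - y) = \<phi> x - \<phi> y" for x y
    using add[of "x - y" y] by simp
  have zero: "\<phi> 0 = 0"
    using diff[of 0 0] by simp
  have span: "span (insert v\<^sub>0 (set ws)) = span (set (vs @ [v\<^sub>0]))"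
    by (simp add: ws_def span_insert_shear)
  have ker: "\<phi> x = 0" if "x \<in> span (set ws)" for x
    using that
  proof (induction x rule: span_induct_alt)
    case (step c x y)
    then show ?case
      using v\<^sub>0 by (auto simp: ws_def add scale diff)
  qed (rule zero)
  show "span (set ws) = {x \<in> span (set (vs @ [v\<^sub>0])). \<phi> x = 0}"
  proof (intro equalityI subsetI CollectI conjI)
    fix x assume "x \<in> span (set ws)"
    then show "x \<in> span (set (vs @ [v\<^sub>0]))" "\<phi> x = 0"
      using span_mono[of "set ws" "insert v\<^sub>0 (set ws)"] ker unfolding span by auto
  next
    fix x assume x: "x \<in> {x \<in> span (set (vs @ [v\<^sub>0])). \<phi> x = 0}"
    then obtain k where k: "x - scale k v\<^sub>0 \<in> span (set ws)"
      unfolding span[symmetric] span_insert by auto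
    then have "k * \<phi> v\<^sub>0 = 0"
      using ker[OF k] x by (simp add: diff scale)
    with k v\<^sub>0 show "x \<in> span (set ws)"
      by simp
  qed
qed

end

text \<open>Turns the question whether the output is a basis into injectivity on the span of the
  kernel vectors; coinciding images violate both sides.\<close>

lemma independent_list_map_iff:
  assumes "Vector_Spaces.linear s1 s2 f" "vector_list_space.independent_list s1 vs"
  shows "vector_list_space.independent_list s2 (map f vs) \<longleftrightarrow> inj_on f (module.span s1 (set vs))"
proof -
  interpret Vector_Spaces.linear s1 s2 f
    by fact
  interpret l1: vector_list_space s1 ..
  interpret l2: vector_list_space s2 ..
  show ?thesis
  proof
    assume "l2.independent_list (map f vs)"
    then show "inj_on f (vs1.span (set vs))"
      by (intro inj_on_span_independent_image) (auto simp: l2.independent_list_def distinct_map)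
  next
    assume inj: "inj_on f (vs1.span (set vs))"
    then have "inj_on f (set vs)"
      by (rule inj_on_subset) (rule vs1.span_superset)
    with inj assms show "l2.independent_list (map f vs)"
      using independent_injective_image[of "set vs"]
      by (simp add: l1.independent_list_def l2.independent_list_def distinct_map)
  qed
qed

section \<open>Coordinate vectors over a field of characteristic 0\<close>

definition fun_scale :: "'k::field \<Rightarrow> (nat \<Rightarrow> 'k) \<Rightarrow> nat \<Rightarrow> 'k" where
  "fun_scale c f = (\<lambda>i. c * f i)"

interpretation fun_space: vector_list_space "fun_scale :: 'k::field \<Rightarrow> (nat \<Rightarrow> 'k) \<Rightarrow> nat \<Rightarrow> 'k"
  by standard (auto simp: fun_scale_def fun_eq_iff algebra_simps)

text \<open>One rational list yields a vector over either scalar field. Padding with 0 puts all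
  lengths into a single vector space.\<close>

definition vec :: "rat list \<Rightarrow> nat \<Rightarrow> 'k::field_char_0" where
  "vec v = (\<lambda>i. if i < length v then of_rat (v ! i) else 0)"

definition form :: "rat list \<Rightarrow> (nat \<Rightarrow> 'k::field_char_0) \<Rightarrow> 'k" where
  "form L f = (\<Sum>i<length L. of_rat (L ! i) * f i)"

lemma form_add: "form L (f + g) = form L f + form L g"
  by (simp add: form_def algebra_simps sum.distrib)

lemma form_scale: "form L (fun_scale c f) = c * form L f"
  by (simp add: form_def fun_scale_def algebra_simps sum_distrib_left)

lemma form_vec: "length v = length L \<Longrightarrow> form L (vec v) = of_rat (dot L v)"
  by (simp add: form_def vec_def dot_def sum_list_sum_nth atLeast0LessThan of_rat_sum of_rat_mult)

lemma vec_eliminate: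
  "length v = length v\<^sub>0 \<Longrightarrow>
    vec (eliminate L v\<^sub>0 v) = vec v - fun_scale (of_rat (dot L v / dot L v\<^sub>0)) (vec v\<^sub>0)"
  by (auto simp: vec_def eliminate_def fun_scale_def fun_eq_iff of_rat_diff simp flip: of_rat_mult)

definition supported :: "nat \<Rightarrow> (nat \<Rightarrow> 'k::zero) set" where
  "supported m = {f. \<forall>i\<ge>m. f i = 0}"

text \<open>The values of a rational form on rational vectors embed into \<open>'k\<close>, so the
  zero tests and quotients made over the rationals are also the right ones over
  \<open>'k\<close>.\<close>

lemma restricted_correct:
  fixes B :: "rat list list"
  assumes shape: "basis_shape m B" and L: "length L = m"
    and indep: "fun_space.independent_list (map vec B :: (nat \<Rightarrow> 'k::field_char_0) list)"
  shows "fun_space.independent_list (map vec (restricted L B) :: (nat \<Rightarrow> 'k) list)"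
    and "fun_space.span (vec ` set (restricted L B)) =
      {f :: nat \<Rightarrow> 'k. f \<in> fun_space.span (vec ` set B) \<and> form L f = 0}"
proof -
  let ?in = "filter (\<lambda>v. dot L v = 0) B" and ?out = "filter (\<lambda>v. dot L v \<noteq> 0) B"
  let ?vec = "vec :: rat list \<Rightarrow> nat \<Rightarrow> 'k"
  have len: "length v = m" if "v \<in> set B" for v
    using shape that by (simp add: basis_shape_def)
  have "fun_space.independent_list (map ?vec (restricted L B)) \<and>
    fun_space.span (?vec ` set (restricted L B)) = {f \<in> fun_space.span (?vec ` set B). form L f = 0}"
  proof (cases ?out)
    case Nil
    then have dot: "dot L v = 0" if "v \<in> set B" for v
      using that by (auto simp: filter_empty_conv)
    have "form L f = 0" if "f \<in> fun_space.span (?vec ` set B)" for f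
      using that
    proof (induction f rule: fun_space.span_induct_alt)
      case base
      show ?case
        by (simp add: form_def)
    next
      case (step c x y)
      then have "form L x = 0"
        using dot len L by (auto simp: form_vec)
      with step show ?case
        by (simp only: form_add form_scale) simp
    qed
    moreover have "restricted L B = B"
      using Nil dot by (simp add: restricted_def)
    ultimately show ?thesis
      using indep by auto
  next
    case (Cons v\<^sub>0 rest)
    \<comment> \<open>Independence does not depend on the order, so the pivot may be moved to the
      end, where \<open>elimination_step\<close> expects it.\<close>
    have mset: "mset (?in @ rest @ [v\<^sub>0]) = mset B"
      using multiset_partition[of "mset B" "\<lambda>v. dot L v = 0"] Cons
      by (metis (no_types, lifting) mset.simps(2) mset_append mset_filter mset_rev rev.simps(2) union_mset_add_mset_right add_mset_add_single append.right_neutral mset.simps(1))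
    then have set: "set (?in @ rest @ [v\<^sub>0]) = set B"
      by (rule mset_eq_setD)
    have v\<^sub>0: "dot L v\<^sub>0 \<noteq> 0" "length v\<^sub>0 = m"
      using Cons len set by (auto dest: filter_eq_ConsD)
    \<comment> \<open>One shear for all vectors: on those already in the kernel of the form its
      coefficient is 0.\<close>
    let ?E = "\<lambda>f. f - fun_scale (form L f / form L (?vec v\<^sub>0)) (?vec v\<^sub>0)"
    have E: "?vec (eliminate L v\<^sub>0 v) = ?E (?vec v)" if "v \<in> set B" for v
      using len[OF that] v\<^sub>0 L by (simp add: vec_eliminate form_vec of_rat_divide)
    have E0: "?E (?vec v) = ?vec v" if "v \<in> set ?in" for v
      using that len L by (auto simp: form_vec fun_scale_def fun_eq_iff)
    have res: "map ?vec (restricted L B) = map ?E (map ?vec (?in @ rest))"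
      using E E0 set by (auto simp: restricted_def Cons)
    have im: "?vec ` set (restricted L B) = set (map ?E (map ?vec (?in @ rest)))"
      unfolding res[symmetric] by simp
    have indep': "fun_space.independent_list (map ?vec (?in @ rest) @ [?vec v\<^sub>0])"
    proof -
      have "mset (map ?vec (?in @ rest) @ [?vec v\<^sub>0]) = mset (map ?vec B)"
        using mset by (metis append_assoc list.simps(8) list.simps(9) map_append mset_map)
      then show ?thesis
        using indep fun_space.independent_list_mset by blast
    qed
    have nz: "form L (?vec v\<^sub>0) \<noteq> 0"
      using v\<^sub>0 L by (simp add: form_vec)
    have setB: "set (map ?vec (?in @ rest) @ [?vec v\<^sub>0]) = ?vec ` set B"
      unfolding set[symmetric] by auto
    note step = fun_space.elimination_step[of "form L", OF form_add form_scale nz indep']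
    show ?thesis
      unfolding im res using step(1) step(2)[unfolded setB] by blast
  qed
  then show "fun_space.independent_list (map ?vec (restricted L B))"
    "fun_space.span (?vec ` set (restricted L B)) =
      {f \<in> fun_space.span (?vec ` set B). form L f = 0}"
    by auto
qed

lemma unit_vectors_correct:
  shows "fun_space.independent_list (map vec (unit_vectors m) :: (nat \<Rightarrow> 'k::field_char_0) list)"
    and "fun_space.span (vec ` set (unit_vectors m)) = (supported m :: (nat \<Rightarrow> 'k) set)"
proof -
  define u :: "nat \<Rightarrow> nat \<Rightarrow> 'k" where "u i = (\<lambda>j. if j = i then 1 else 0)" for i
  have vec: "map vec (unit_vectors m) = map u [0..<m]"
    by (auto simp: unit_vectors_def vec_def u_def fun_eq_iff)
  \<comment> \<open>The unit vectors are added from the last to the first; whatever is spanned so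
    far vanishes at the new position.\<close>
  have "fun_space.independent_list (map u [m - k..<m])" if "k \<le> m" for k
    using that
  proof (induction k)
    case (Suc k)
    have "f (m - Suc k) = 0" if "f \<in> fun_space.span (u ` {m - k..<m})" for f
      using that by (induction f rule: fun_space.span_induct_alt)
        (use Suc.prems in \<open>auto simp: u_def fun_scale_def split: if_splits\<close>)
    from this[of "u (m - Suc k)"] have "u (m - Suc k) \<notin> fun_space.span (u ` {m - k..<m})"
      by (auto simp: u_def)
    moreover have "[m - Suc k..<m] = (m - Suc k) # [m - k..<m]"
      using Suc.prems by (simp add: upt_conv_Cons Suc_diff_Suc)
    ultimately show ?case
      using Suc by (simp add: fun_space.independent_list_Cons)
  qed (simp add: fun_space.independent_list_Nil)
  from this[of m] show "fun_space.independent_list (map vec (unit_vectors m) :: (nat \<Rightarrow> 'k) list)"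
    by (simp add: vec)
  have set: "vec ` set (unit_vectors m) = u ` {..<m}"
    using arg_cong[OF vec, of set] by (simp add: atLeast0LessThan)
  show "fun_space.span (vec ` set (unit_vectors m)) = (supported m :: (nat \<Rightarrow> 'k) set)"
  proof (intro equalityI subsetI)
    fix f :: "nat \<Rightarrow> 'k" assume "f \<in> fun_space.span (vec ` set (unit_vectors m))"
    then show "f \<in> supported m"
      unfolding set by (induction f rule: fun_space.span_induct_alt)
        (auto simp: supported_def u_def fun_scale_def)
  next
    fix f :: "nat \<Rightarrow> 'k" assume f: "f \<in> supported m"
    have sum_apply: "(\<Sum>i\<in>A. h i) j = (\<Sum>i\<in>A. h i j)" for A :: "nat set" and h :: "nat \<Rightarrow> nat \<Rightarrow> 'k" and j
      by (induction A rule: infinite_finite_induct) auto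
    have "f = (\<Sum>i<m. fun_scale (f i) (u i))"
      using f by (auto simp: fun_eq_iff sum_apply fun_scale_def u_def supported_def sum.delta if_distrib not_less cong: if_cong)
    moreover have "(\<Sum>i<m. fun_scale (f i) (u i)) \<in> fun_space.span (vec ` set (unit_vectors m))"
      unfolding set by (intro fun_space.span_sum fun_space.span_scale fun_space.span_base) auto
    ultimately show "f \<in> fun_space.span (vec ` set (unit_vectors m))"
      by simp
  qed
qed

text \<open>Each form cuts the current span down to its kernel, starting from the full coordinate
  space. So the same rational vectors are a basis of the solution space over every field of
  characteristic 0.\<close>

lemma kernel_vectors_correct:
  assumes Ls: "\<And>L. L \<in> set Ls \<Longrightarrow> length L = m"
  shows "fun_space.independent_list (map vec (kernel_vectors m Ls) :: (nat \<Rightarrow> 'k::field_char_0) list)"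
    and "fun_space.span (vec ` set (kernel_vectors m Ls)) =
      {f :: nat \<Rightarrow> 'k. f \<in> supported m \<and> (\<forall>L\<in>set Ls. form L f = 0)}"
proof -
  have "fun_space.independent_list (map vec (fold restricted Ls B) :: (nat \<Rightarrow> 'k) list) \<and>
     fun_space.span (vec ` set (fold restricted Ls B)) =
       {f :: nat \<Rightarrow> 'k. f \<in> fun_space.span (vec ` set B) \<and> (\<forall>L\<in>set Ls. form L f = 0)}"
    if "basis_shape m B" "fun_space.independent_list (map vec B :: (nat \<Rightarrow> 'k) list)" for B
    using that Ls
  proof (induction Ls arbitrary: B)
    case (Cons L Ls)
    have L: "length L = m"
      using Cons.prems by simp
    note step = restricted_correct[OF Cons.prems(1) L Cons.prems(2)]
    show ?case
      using Cons.IH[OF basis_shape_restricted[OF Cons.prems(1)] step(1)] Cons.prems(3)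
      by (auto simp: step(2))
  qed simp
  from this[OF basis_shape_unit_vectors unit_vectors_correct(1)]
  show "fun_space.independent_list (map vec (kernel_vectors m Ls) :: (nat \<Rightarrow> 'k) list)"
    "fun_space.span (vec ` set (kernel_vectors m Ls)) =
      {f :: nat \<Rightarrow> 'k. f \<in> supported m \<and> (\<forall>L\<in>set Ls. form L f = 0)}"
    by (auto simp: kernel_vectors_def unit_vectors_correct(2))
qed


section \<open>Invariants\<close>

lemma indets_add: "indets (p + q) \<subseteq> indets p \<union> indets q"
  using keys_add[of p q] by (auto simp: indets_def)

lemma indets_uminus [simp]: "indets (- p) = indets (p :: 'k::ab_group_add mpoly)"
  by (simp add: indets_def)

lemma indets_diff: "indets (p - q) \<subseteq> indets p \<union> indets (q :: 'k::ab_group_add mpoly)"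
  using indets_add[of p "- q"] by simp

lemma indets_mult: "indets (p * q) \<subseteq> indets p \<union> indets q"
proof
  fix i assume "i \<in> indets (p * q)"
  then obtain s t where "s \<in> Poly_Mapping.keys p" "t \<in> Poly_Mapping.keys q" "i \<in> Poly_Mapping.keys (s + t)"
    using keys_mult[of p q] by (auto simp: indets_def)
  then show "i \<in> indets p \<union> indets q"
    using keys_add[of s t] by (auto simp: indets_def)
qed

lemma indets_single: "indets (Poly_Mapping.single t c) \<subseteq> Poly_Mapping.keys t"
  by (auto simp: indets_def split: if_splits)

lemma indets_0 [simp]: "indets 0 = {}"
  by (simp add: indets_def)

lemma indets_Const [simp]: "indets (Const c) = {}"
  by (auto simp: indets_def Const_def)

lemma indets_sum: "(\<And>i. i \<in> A \<Longrightarrow> indets (f i) \<subseteq> V) \<Longrightarrow> indets (sum f A) \<subseteq> V"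
proof (induction A rule: infinite_finite_induct)
  case (insert x A)
  then show ?case
    using indets_add[of "f x" "sum f A"] by (auto simp: subset_iff)
qed auto

lemma indets_prod: "(\<And>i. i \<in> A \<Longrightarrow> indets (f i) \<subseteq> V) \<Longrightarrow> indets (prod f A :: 'k::comm_ring_1 mpoly) \<subseteq> V"
proof (induction A rule: infinite_finite_induct)
  case (insert x A)
  then show ?case
    using indets_mult[of "f x" "prod f A"] by (auto simp: subset_iff)
qed (simp_all flip: Const_1)

lemma indets_power: "indets (p ^ k :: 'k::comm_ring_1 mpoly) \<subseteq> indets p"
  using indets_prod[of "{..<k}" "\<lambda>_. p"] by simp

lemma indets_prod_list:
  "(\<And>p. p \<in> set ps \<Longrightarrow> indets p \<subseteq> V) \<Longrightarrow> indets (prod_list ps :: 'k::comm_ring_1 mpoly) \<subseteq> V"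
proof (induction ps)
  case (Cons p ps)
  then show ?case
    using indets_mult[of p "prod_list ps"] by (auto simp: subset_iff)
qed (simp flip: Const_1)

lemma indets_combination:
  assumes "\<And>g. g \<in> set gs \<Longrightarrow> indets g \<subseteq> V"
  shows "indets (combination c gs) \<subseteq> V"
  unfolding combination_def sum_list_sum_nth
proof (rule indets_sum)
  fix i assume "i \<in> {0..<length (map (\<lambda>(c, g). Const c * g) (zip c gs))}"
  then have "gs ! i \<in> set gs" "map (\<lambda>(c, g). Const c * g) (zip c gs) ! i = Const (c ! i) * gs ! i"
    by auto
  then show "indets (map (\<lambda>(c, g). Const c * g) (zip c gs) ! i) \<subseteq> V"
    using assms[of "gs ! i"] indets_mult[of "Const (c ! i)" "gs ! i"] by auto
qed

lemma indets_subst_poly: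
  assumes "indets g \<subseteq> {..<length F}" "\<And>f. f \<in> set F \<Longrightarrow> indets f \<subseteq> V"
  shows "indets (subst_poly F g) \<subseteq> V"
  unfolding subst_poly_def meval_def
proof (rule indets_sum)
  fix t assume t: "t \<in> Poly_Mapping.keys g"
  have "indets (\<Prod>i\<in>Poly_Mapping.keys t. F ! i ^ Poly_Mapping.lookup t i) \<subseteq> V"
  proof (rule indets_prod)
    fix i assume "i \<in> Poly_Mapping.keys t"
    then have "i < length F"
      using t assms(1) by (auto simp: indets_def)
    then show "indets (F ! i ^ Poly_Mapping.lookup t i) \<subseteq> V"
      using indets_power[of "F ! i" "Poly_Mapping.lookup t i"] assms(2)[of "F ! i"] by auto
  qed
  then show "indets (Const (Poly_Mapping.lookup g t) *
      (\<Prod>i\<in>Poly_Mapping.keys t. F ! i ^ Poly_Mapping.lookup t i)) \<subseteq> V"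
    using indets_mult by fastforce
qed

lemma qeval_subst_poly:
  assumes "indets g \<subseteq> {..<length F}"
  shows "qeval (subst_poly F g) x = qeval g (apply_map F x)"
proof -
  have "qeval (subst_poly F g) x = meval of_rat (\<lambda>i. qeval (F ! i) x) g"
    unfolding subst_poly_def qeval.hom_meval
    by (simp add: qeval_def rat_complex.meval_Const)
  also have "\<dots> = meval of_rat ((!) (apply_map F x)) g"
    by (rule meval_cong) (use assms in \<open>auto simp: apply_map_def\<close>)
  finally show ?thesis
    by (simp add: qeval_def)
qed

lemma lookup_Const_mult: "Poly_Mapping.lookup (Const c * p) t = c * Poly_Mapping.lookup p t"
  by (simp add: Const_def Poly_Mapping.map.rep_eq when_def flip: mult_map_scale_conv_mult)

lemma keys_shift_monomial: "Poly_Mapping.keys (shift_monomial n t) \<subseteq> (+) n ` Poly_Mapping.keys t"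
  unfolding shift_monomial_def using keys_sum[of "\<lambda>i. Poly_Mapping.single (n + i) (Poly_Mapping.lookup t i)" "Poly_Mapping.keys t"]
  by (auto split: if_splits)

lemma indets_minus_at_start:
  assumes "indets P \<subseteq> {..<n}"
  shows "indets (P - at_start n P) \<subseteq> {..<2 * n}"
proof -
  have "indets (at_start n P) \<subseteq> {..<2 * n}"
    unfolding at_start_def
  proof (rule indets_sum)
    fix t assume "t \<in> Poly_Mapping.keys P"
    then have "Poly_Mapping.keys t \<subseteq> {..<n}"
      using assms by (auto simp: indets_def)
    then show "indets (Poly_Mapping.single (shift_monomial n t) (Poly_Mapping.lookup P t)) \<subseteq> {..<2 * n}"
      using indets_single[of "shift_monomial n t" "Poly_Mapping.lookup P t"] keys_shift_monomial[of n t]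
      by fastforce
  qed
  then show ?thesis
    using indets_diff[of P "at_start n P"] assms by (fastforce simp: subset_iff)
qed

interpretation at_initial: ring_homomorphism "at_initial n a"
  unfolding at_initial_def[abs_def] by (rule const_rat.ring_homomorphism_meval)

lemma at_initial_minus_at_start:
  assumes "indets P \<subseteq> {..<n}" "length a = n"
  shows "at_initial n a (P - at_start n P) = to_complex P - Const (qeval P a)"
proof -
  have "at_initial n a P = to_complex P"
    unfolding at_initial_def to_complex_def by (rule meval_cong) (use assms in auto)
  moreover have "at_initial n a (at_start n P) = Const (qeval P a)"
  proof -
    interpret Const: ring_homomorphism "Const :: complex \<Rightarrow> complex mpoly"
      by (rule ring_homomorphism_Const[OF ring_homomorphism_ident])
    let ?v = "\<lambda>i. if i < n then Var i else Const (a ! (i - n)) :: complex mpoly"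
    have "mon_value ?v (shift_monomial n t) = Const (mon_value ((!) a) t)" for t
      by (simp add: shift_monomial_def mon_value_sum Const.hom_mon_value)
        (simp add: mon_value_def)
    then have "at_initial n a (at_start n P) =
        (\<Sum>t\<in>Poly_Mapping.keys P. Const (of_rat (Poly_Mapping.lookup P t) * mon_value ((!) a) t))"
      by (simp add: at_start_def at_initial.hom_sum Const_mult)
        (simp add: at_initial_def const_rat.meval_single)
    then show ?thesis
      by (simp add: Const.hom_sum qeval_def meval_mon_value)
  qed
  ultimately show ?thesis
    by (simp add: at_initial.hom_diff)
qed

text \<open>Treats both scalar fields at once, with the identity or \<open>of_rat\<close> as
  embedding. Agreement on the rationals gives the input coefficients and the computed vectors the
  same meaning in \<open>'k\<close> and in the complex numbers.\<close>

locale scalar_embedding = ring_homomorphism e for e :: "'k::field_char_0 \<Rightarrow> complex" +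
  assumes e_of_rat [simp]: "e (of_rat q) = of_rat q"
begin

lemma e_eq_0_iff [simp]: "e x = 0 \<longleftrightarrow> x = 0"
proof
  assume "e x = 0"
  then have "e (x * inverse x) = 0"
    by (simp add: hom_mult)
  then show "x = 0"
    by (cases "x = 0") auto
qed simp

sublocale poly_space: vector_list_space "scale e"
  by (intro vector_list_space.intro vector_space_scale hom_one hom_add hom_mult)

lemma lin_independent_eq: "lin_independent e ps \<longleftrightarrow> poly_space.independent_list ps"
  by (simp add: lin_independent_def poly_space.independent_list_def)

definition lincomb :: "rat mpoly list \<Rightarrow> (nat \<Rightarrow> 'k) \<Rightarrow> complex mpoly" where
  "lincomb gs f = (\<Sum>i<length gs. Const (e (f i)) * to_complex (gs ! i))"

definition shifted :: "complex list \<Rightarrow> complex mpoly \<Rightarrow> complex mpoly" where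
  "shifted a p = p - Const (ceval p a)"

lemma linear_lincomb: "Vector_Spaces.linear fun_scale (scale e) (lincomb gs)"
  unfolding Vector_Spaces.linear_iff
  by (auto simp: fun_space.vector_space_axioms poly_space.vector_space_axioms lincomb_def
      fun_scale_def scale_def hom_add hom_mult Const_add Const_mult algebra_simps sum.distrib
      sum_distrib_left)

lemma linear_shifted: "Vector_Spaces.linear (scale e) (scale e) (shifted a)"
  unfolding Vector_Spaces.linear_iff
  by (auto simp: poly_space.vector_space_axioms shifted_def scale_def ceval.hom_add ceval.hom_mult
      Const_add Const_mult algebra_simps)

lemma linear_shifted_lincomb: "Vector_Spaces.linear fun_scale (scale e) (shifted a \<circ> lincomb gs)"
  using linear_lincomb linear_shifted by (rule Vector_Spaces.linear_compose)

text \<open>Each coefficient of a combination is a rational linear form in the coefficient vector;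
  this links the vanishing of polynomials to the linear system.\<close>

lemma lookup_lincomb:
  "Poly_Mapping.lookup (lincomb gs c) t = e (form (map (\<lambda>g. Poly_Mapping.lookup g t) gs) c)"
  by (simp add: lincomb_def lookup_sum lookup_Const_mult form_def hom_sum hom_mult mult.commute)

lemma ceval_lincomb: "ceval (lincomb gs c) x = (\<Sum>i<length gs. e (c i) * qeval (gs ! i) x)"
  by (simp add: lincomb_def ceval.hom_sum ceval.hom_mult)

lemma indets_lincomb:
  assumes "\<And>g. g \<in> set gs \<Longrightarrow> indets g \<subseteq> V"
  shows "indets (lincomb gs c) \<subseteq> V"
  unfolding lincomb_def
proof (rule indets_sum)
  fix i assume "i \<in> {..<length gs}"
  then show "indets (Const (e (c i)) * to_complex (gs ! i)) \<subseteq> V"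
    using indets_mult[of "Const (e (c i))" "to_complex (gs ! i)"] assms[of "gs ! i"] by auto
qed

lemma to_complex_combination:
  assumes "length c = length gs"
  shows "to_complex (combination c gs) = lincomb gs (vec c)"
proof -
  have "to_complex (Const q) = Const (of_rat q)" for q
    by (simp add: to_complex_def const_rat.meval_Const)
  then show ?thesis
    using assms by (simp add: combination_def lincomb_def sum_list_sum_nth atLeast0LessThan
        to_complex.hom_sum to_complex.hom_mult vec_def)
qed

lemma lincomb_unit_vector:
  assumes "i < length gs"
  shows "lincomb gs (vec (unit_vectors (length gs) ! i)) = to_complex (gs ! i)"
proof -
  have "lincomb gs (vec (unit_vectors (length gs) ! i)) =
      (\<Sum>j<length gs. if j = i then to_complex (gs ! j) else 0)"
    unfolding lincomb_def
    by (rule sum.cong) (use assms in \<open>auto simp: vec_def unit_vectors_def Const_1, auto simp: Const_def\<close>)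
  then show ?thesis
    using assms by simp
qed

lemma map_lincomb_unit_vectors:
  "map (lincomb gs) (map vec (unit_vectors (length gs))) = map to_complex gs"
proof (rule nth_equalityI)
  show "length (map (lincomb gs) (map vec (unit_vectors (length gs)))) = length (map to_complex gs)"
    by (simp add: unit_vectors_def)
  then show "map (lincomb gs) (map vec (unit_vectors (length gs))) ! i = map to_complex gs ! i"
    if "i < length (map (lincomb gs) (map vec (unit_vectors (length gs))))" for i
    using that by (simp add: lincomb_unit_vector)
qed

lemma spanned_eq: "spanned e (to_complex ` set gs) = lincomb gs ` supported (length gs)"
proof -
  interpret lin: Vector_Spaces.linear fun_scale "scale e" "lincomb gs"
    by (rule linear_lincomb)
  have "to_complex ` set gs = lincomb gs ` (vec ` set (unit_vectors (length gs)))"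
    using arg_cong[OF map_lincomb_unit_vectors[of gs], of set] by (simp add: image_image)
  then show ?thesis
    unfolding spanned_def by (simp only: lin.span_image unit_vectors_correct(2))
qed

lemma lin_independent_iff:
  "lin_independent e (map to_complex gs) \<longleftrightarrow>
    (\<forall>c\<in>supported (length gs). lincomb gs c = 0 \<longrightarrow> c = 0)"
proof -
  interpret lin: Vector_Spaces.linear fun_scale "scale e" "lincomb gs"
    by (rule linear_lincomb)
  have "lin_independent e (map to_complex gs) \<longleftrightarrow> inj_on (lincomb gs) (supported (length gs))"
    unfolding lin_independent_eq map_lincomb_unit_vectors[symmetric]
    by (subst independent_list_map_iff[OF linear_lincomb unit_vectors_correct(1)])
      (simp only: set_map unit_vectors_correct(2))
  also have "\<dots> \<longleftrightarrow> (\<forall>c\<in>supported (length gs). lincomb gs c = 0 \<longrightarrow> c = 0)"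
    unfolding unit_vectors_correct(2)[symmetric]
    by (rule lin.inj_on_iff_eq_0[OF fun_space.subspace_span])
  finally show ?thesis .
qed

context
  fixes n :: nat and gs :: "rat mpoly list" and Fs :: "rat mpoly list list"
  assumes valid: "valid_input n gs Fs"
begin

lemma valid_gs: "g \<in> set gs \<Longrightarrow> indets g \<subseteq> {..<n}"
  using valid by (simp add: valid_input_def)

lemma valid_Fs: "F \<in> set Fs \<Longrightarrow> length F = n" "F \<in> set Fs \<Longrightarrow> f \<in> set F \<Longrightarrow> indets f \<subseteq> {..<n}"
  using valid by (simp_all add: valid_input_def)

definition invariant_vectors :: "(nat \<Rightarrow> 'k) set" where
  "invariant_vectors = {c \<in> supported (length gs).
     \<forall>F\<in>set Fs. \<forall>x. length x = n \<longrightarrow> ceval (lincomb gs c) (apply_map F x) = ceval (lincomb gs c) x}"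

lemma indets_differences:
  assumes "F \<in> set Fs" "p \<in> set (differences gs F)"
  shows "indets p \<subseteq> {..<n}"
proof -
  obtain g where g: "g \<in> set gs" "p = g - subst_poly F g"
    using assms by (auto simp: differences_def)
  then have "indets (subst_poly F g) \<subseteq> {..<n}"
    by (intro indets_subst_poly) (use valid_gs valid_Fs assms in auto)
  then show ?thesis
    using indets_diff[of g "subst_poly F g"] valid_gs[OF g(1)] g by auto
qed

lemma ceval_differences:
  assumes "F \<in> set Fs"
  shows "ceval (lincomb (differences gs F) c) x =
    ceval (lincomb gs c) x - ceval (lincomb gs c) (apply_map F x)"
  using assms valid_gs valid_Fs(1)
  by (simp add: ceval_lincomb differences_def qeval.hom_diff qeval_subst_poly right_diff_distrib
      sum_subtractf)

text \<open>By \<open>vanishing_polynomial\<close> the pointwise condition is an identity of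
  polynomials, hence finitely many linear equations.\<close>

lemma lincomb_differences_eq_0_iff:
  assumes "F \<in> set Fs"
  shows "lincomb (differences gs F) c = 0 \<longleftrightarrow>
    (\<forall>x. length x = n \<longrightarrow> ceval (lincomb gs c) (apply_map F x) = ceval (lincomb gs c) x)"
proof
  assume "lincomb (differences gs F) c = 0"
  then show "\<forall>x. length x = n \<longrightarrow> ceval (lincomb gs c) (apply_map F x) = ceval (lincomb gs c) x"
    using ceval_differences[OF assms, of c] by (auto simp: ceval.hom_zero)
next
  assume "\<forall>x. length x = n \<longrightarrow> ceval (lincomb gs c) (apply_map F x) = ceval (lincomb gs c) x"
  then show "lincomb (differences gs F) c = 0"
    by (intro vanishing_polynomial[of _ n] indets_lincomb)
      (use indets_differences[OF assms] ceval_differences[OF assms] in auto)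
qed

text \<open>Monomials outside all supports give the zero form, so the listed coefficients
  suffice.\<close>

lemma lincomb_eq_0_iff:
  "lincomb ps c = 0 \<longleftrightarrow> (\<forall>L\<in>set (coefficient_forms ps). form L c = 0)"
proof -
  have "lincomb ps c = 0 \<longleftrightarrow> (\<forall>t. form (map (\<lambda>p. Poly_Mapping.lookup p t) ps) c = 0)"
    by (auto simp: poly_mapping_eq_iff fun_eq_iff lookup_lincomb)
  also have "\<dots> \<longleftrightarrow> (\<forall>t\<in>set (monomials ps). form (map (\<lambda>p. Poly_Mapping.lookup p t) ps) c = 0)"
  proof (intro iffI allI ballI)
    fix t
    assume *: "\<forall>t\<in>set (monomials ps). form (map (\<lambda>p. Poly_Mapping.lookup p t) ps) c = 0"
    show "form (map (\<lambda>p. Poly_Mapping.lookup p t) ps) c = 0"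
    proof (cases "t \<in> set (monomials ps)")
      case False
      then have "Poly_Mapping.lookup (ps ! i) t = 0" if "i < length ps" for i
        using that by (auto simp: in_keys_iff)
      then show ?thesis
        by (simp add: form_def)
    qed (use * in blast)
  qed simp
  finally show ?thesis
    by (simp add: coefficient_forms_def)
qed

lemma kernel_vectors_eq_invariant_vectors:
  shows "fun_space.independent_list (map vec (invariant_kernel gs Fs) :: (nat \<Rightarrow> 'k) list)"
    and "fun_space.span (vec ` set (invariant_kernel gs Fs)) = invariant_vectors"
proof -
  let ?Ls = "concat (map coefficient_forms (map (differences gs) Fs))"
  have len: "length L = length gs" if "L \<in> set ?Ls" for L
    using that by (auto simp: coefficient_forms_def differences_def)
  show "fun_space.independent_list (map vec (invariant_kernel gs Fs) :: (nat \<Rightarrow> 'k) list)"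
    unfolding invariant_kernel_def by (rule kernel_vectors_correct(1)[OF len])
  have "(\<forall>L\<in>set ?Ls. form L c = 0) \<longleftrightarrow> (\<forall>F\<in>set Fs. lincomb (differences gs F) c = 0)" for c
    by (auto simp: lincomb_eq_0_iff)
  also have "\<dots> c \<longleftrightarrow> (\<forall>F\<in>set Fs. \<forall>x. length x = n \<longrightarrow>
      ceval (lincomb gs c) (apply_map F x) = ceval (lincomb gs c) x)" for c
    by (simp add: lincomb_differences_eq_0_iff)
  finally have forms: "(\<forall>L\<in>set ?Ls. form L c = 0) \<longleftrightarrow> (\<forall>F\<in>set Fs. \<forall>x. length x = n \<longrightarrow>
      ceval (lincomb gs c) (apply_map F x) = ceval (lincomb gs c) x)" for c .
  have "fun_space.span (vec ` set (invariant_kernel gs Fs)) =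
      {f :: nat \<Rightarrow> 'k. f \<in> supported (length gs) \<and> (\<forall>L\<in>set ?Ls. form L f = 0)}"
    unfolding invariant_kernel_def by (rule kernel_vectors_correct(2)[OF len])
  then show "fun_space.span (vec ` set (invariant_kernel gs Fs)) = invariant_vectors"
    unfolding forms invariant_vectors_def .
qed

lemma polynomial_invariant_iff:
  assumes hs: "\<And>h. h \<in> set hs \<Longrightarrow> h \<noteq> 0 \<and> indets h \<subseteq> {..<n}"
  shows "(\<forall>b. length b = n \<longrightarrow> polynomial_invariant b hs Fs (shifted b (lincomb gs c))) \<longleftrightarrow>
    (\<forall>F\<in>set Fs. \<forall>x. length x = n \<longrightarrow> ceval (lincomb gs c) (apply_map F x) = ceval (lincomb gs c) x)"
    (is "?inv \<longleftrightarrow> ?fixed")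
proof
  have ceval_shifted: "ceval (shifted b f) x = ceval f x - ceval f b" for b f x
    by (simp add: shifted_def ceval.hom_diff)
  {
    assume inv: ?inv
    show ?fixed
    proof (rule ballI)
      fix F assume F: "F \<in> set Fs"
      then obtain i where i: "i < length Fs" "F = Fs ! i"
        by (auto simp: in_set_conv_nth)
      let ?q = "lincomb (differences gs F) c" and ?h = "to_complex (prod_list hs)"
      have "?q * ?h = 0"
      proof (rule vanishing_polynomial)
        show "indets (?q * ?h) \<subseteq> {..<n}"
          using indets_mult[of ?q ?h] indets_lincomb[OF indets_differences[OF F], where c = c]
            indets_prod_list[of hs "{..<n}"] hs by (auto simp: subset_iff)
        fix x :: "complex list" assume x: "length x = n"
        then have "polynomial_invariant x hs Fs (shifted x (lincomb gs c))"
          using inv by blast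
        \<comment> \<open>For a word of length 1 the only early exit is at l = 0, where the range of
          j is empty: either the first iterate is a zero or the guard vanishes at the starting point
          itself.\<close>
        then have "(\<forall>j\<in>{1..length [i]}. ceval (shifted x (lincomb gs c)) (run_word Fs (take j [i]) x) = 0) \<or>
            (\<exists>l<length [i]. (\<forall>j\<in>{1..l}. ceval (shifted x (lincomb gs c)) (run_word Fs (take j [i]) x) = 0) \<and>
              qeval (prod_list hs) (run_word Fs (take l [i]) x) = 0)"
          unfolding polynomial_invariant_def using i by (elim conjE allE[of _ "[i]"]) auto
        then have "ceval (lincomb gs c) (apply_map F x) = ceval (lincomb gs c) x \<or> qeval (prod_list hs) x = 0"
          using i by (auto simp: run_word_def ceval_shifted)
        then show "ceval (?q * ?h) x = 0"
          by (auto simp: ceval.hom_mult ceval_differences[OF F])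
      qed
      \<comment> \<open>The polynomials form an integral domain, so the guard can be cancelled from
        \<open>?q * ?h\<close>.\<close>
      moreover have "?h \<noteq> 0"
        using hs by (auto simp: prod_list_zero_iff)
      ultimately have "?q = 0"
        by simp
      then show "\<forall>x. length x = n \<longrightarrow> ceval (lincomb gs c) (apply_map F x) = ceval (lincomb gs c) x"
        by (simp add: lincomb_differences_eq_0_iff[OF F])
    qed
  next
    assume fixed: ?fixed
    \<comment> \<open>Being fixed by each map propagates along every word, so the first alternative
      in the definition of invariants always holds.\<close>
    have run: "ceval (lincomb gs c) (run_word Fs w b) = ceval (lincomb gs c) b"
      if "length b = n" "set w \<subseteq> {..<length Fs}" for w b
      using that
    proof (induction w arbitrary: b)
      case (Cons i w)
      have F: "Fs ! i \<in> set Fs"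
        using Cons.prems by simp
      have "ceval (lincomb gs c) (run_word Fs w (apply_map (Fs ! i) b)) =
          ceval (lincomb gs c) (apply_map (Fs ! i) b)"
        by (rule Cons.IH) (use Cons.prems valid_Fs(1)[OF F] in \<open>auto simp: apply_map_def\<close>)
      also have "\<dots> = ceval (lincomb gs c) b"
        using fixed F Cons.prems by blast
      finally show ?case
        by (simp add: run_word_def)
    qed (simp add: run_word_def)
    show ?inv
    proof (intro allI impI)
      fix b :: "complex list" assume b: "length b = n"
      have "ceval (shifted b (lincomb gs c)) (run_word Fs (take j w) b) = 0"
        if "set w \<subseteq> {..<length Fs}" for w j
        using run[OF b, of "take j w"] that set_take_subset[of j w] by (simp add: ceval_shifted)
      then show "polynomial_invariant b hs Fs (shifted b (lincomb gs c))"
        by (simp add: polynomial_invariant_def ceval_shifted)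
    qed
  }
qed

lemma invariants_of_form_eq:
  assumes "\<And>h. h \<in> set hs \<Longrightarrow> h \<noteq> 0 \<and> indets h \<subseteq> {..<n}"
  shows "invariants_of_form e n a hs gs Fs = (shifted a \<circ> lincomb gs) ` invariant_vectors"
proof -
  have "invariants_of_form e n a hs gs Fs = {shifted a f | f. f \<in> lincomb gs ` supported (length gs) \<and>
      (\<forall>b. length b = n \<longrightarrow> polynomial_invariant b hs Fs (shifted b f))}"
    by (simp add: invariants_of_form_def spanned_eq shifted_def)
  also have "\<dots> = {shifted a (lincomb gs c) | c. c \<in> supported (length gs) \<and>
      (\<forall>b. length b = n \<longrightarrow> polynomial_invariant b hs Fs (shifted b (lincomb gs c)))}"
    by blast
  also have "\<dots> = (shifted a \<circ> lincomb gs) ` invariant_vectors"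
  proof -
    have "(\<forall>b. length b = n \<longrightarrow> polynomial_invariant b hs Fs (shifted b (lincomb gs c))) \<longleftrightarrow>
      (\<forall>F\<in>set Fs. \<forall>x. length x = n \<longrightarrow> ceval (lincomb gs c) (apply_map F x) = ceval (lincomb gs c) x)" for c
      by (rule polynomial_invariant_iff[OF assms])
    then show ?thesis
      unfolding invariant_vectors_def by auto
  qed
  finally show ?thesis .
qed

lemma map_at_initial_specific_form_value:
  assumes "length a = n"
  shows "map (at_initial n a) (specific_form_value n gs Fs) =
    map (shifted a \<circ> lincomb gs) (map vec (invariant_kernel gs Fs))"
proof -
  have "at_initial n a (combination c gs - at_start n (combination c gs)) = shifted a (lincomb gs (vec c))"
    if "c \<in> set (invariant_kernel gs Fs)" for c
  proof -
    have "length c = length gs"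
      using that basis_shape_kernel by (auto simp: invariant_kernel_def basis_shape_def)
    then show ?thesis
      using indets_combination[OF valid_gs, of gs c] assms
      by (simp add: at_initial_minus_at_start shifted_def flip: to_complex_combination)
  qed
  then show ?thesis
    by (simp add: specific_form_value_def)
qed

lemma spanned_specific_form:
  assumes "length a = n" and hs: "\<And>h. h \<in> set hs \<Longrightarrow> h \<noteq> 0 \<and> indets h \<subseteq> {..<n}"
  shows "spanned e (set (map (at_initial n a) (specific_form_value n gs Fs))) =
    invariants_of_form e n a hs gs Fs"
proof -
  interpret lin: Vector_Spaces.linear fun_scale "scale e" "shifted a \<circ> lincomb gs"
    by (rule linear_shifted_lincomb)
  have "invariants_of_form e n a hs gs Fs = (shifted a \<circ> lincomb gs) ` invariant_vectors"
    by (rule invariants_of_form_eq[OF hs])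
  then show ?thesis
    unfolding map_at_initial_specific_form_value[OF assms(1)]
      spanned_def set_map lin.span_image kernel_vectors_eq_invariant_vectors(2) by simp
qed

text \<open>A nontrivial relation among 1 and \<open>gs\<close> amounts to a nonzero coefficient
  vector whose combination is constant, with minus that constant as entry at index 0. Repetitions
  and zeros in \<open>gs\<close> also show up as such vectors, for the constant 0.\<close>

lemma lin_independent_specific_form_iff:
  assumes "length a = n"
  shows "lin_independent e (map (at_initial n a) (specific_form_value n gs Fs)) \<longleftrightarrow>
    lin_independent e (1 # map to_complex gs)"
proof -
  interpret lin: Vector_Spaces.linear fun_scale "scale e" "shifted a \<circ> lincomb gs"
    by (rule linear_shifted_lincomb)
  have "lin_independent e (map (at_initial n a) (specific_form_value n gs Fs)) \<longleftrightarrow>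
      inj_on (shifted a \<circ> lincomb gs) invariant_vectors"
    unfolding map_at_initial_specific_form_value[OF assms(1)] lin_independent_eq
    by (subst independent_list_map_iff[OF linear_shifted_lincomb kernel_vectors_eq_invariant_vectors(1)])
      (simp only: set_map kernel_vectors_eq_invariant_vectors(2))
  also have "\<dots> \<longleftrightarrow> (\<forall>c\<in>invariant_vectors. (shifted a \<circ> lincomb gs) c = 0 \<longrightarrow> c = 0)"
    unfolding kernel_vectors_eq_invariant_vectors(2)[symmetric]
    by (rule lin.inj_on_iff_eq_0[OF fun_space.subspace_span])
  also have "\<dots> \<longleftrightarrow> (\<forall>c\<in>supported (length (1 # gs)). lincomb (1 # gs) c = 0 \<longrightarrow> c = 0)"
  proof -
    have split: "lincomb (1 # gs) c = Const (e (c 0)) + lincomb gs (\<lambda>i. c (Suc i))" for c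
      unfolding lincomb_def by (simp add: sum.lessThan_Suc_shift del: sum.lessThan_Suc)
    show ?thesis
    proof (intro iffI ballI impI)
      fix c assume *: "\<forall>c\<in>invariant_vectors. (shifted a \<circ> lincomb gs) c = 0 \<longrightarrow> c = 0"
        and c: "c \<in> supported (length (1 # gs))" "lincomb (1 # gs) c = 0"
      let ?c = "\<lambda>i. c (Suc i)"
      have const: "lincomb gs ?c = Const (- e (c 0))"
        using c(2) by (simp add: split Const_def single_uminus eq_neg_iff_add_eq_0 add.commute)
      then have "?c \<in> invariant_vectors"
        using c(1) by (simp add: invariant_vectors_def supported_def)
      moreover have "shifted a (lincomb gs ?c) = 0"
        by (simp add: const shifted_def)
      ultimately have c_Suc: "?c = 0"
        using * by simp
      then have "Const (- e (c 0)) = 0"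
        using const by (simp add: lincomb_def Const_def)
      then have "c 0 = 0"
        by (metis Const_def e_eq_0_iff lookup_single_eq lookup_zero neg_equal_0_iff_equal)
      with c_Suc show "c = 0"
        by (auto simp: fun_eq_iff) (metis not0_implies_Suc)
    next
      fix c assume *: "\<forall>c\<in>supported (length (1 # gs)). lincomb (1 # gs) c = 0 \<longrightarrow> c = 0"
        and c: "c \<in> invariant_vectors" "(shifted a \<circ> lincomb gs) c = 0"
      \<comment> \<open>The constant is read off at the monomial 0 and not as a value at
        \<open>a\<close>: as a form in \<open>c\<close> it lies in \<open>'k\<close>, so it is an
        admissible coefficient over the rationals too.\<close>
      define z where "z = form (map (\<lambda>g. Poly_Mapping.lookup g 0) gs) c"
      let ?c = "\<lambda>i. case i of 0 \<Rightarrow> - z | Suc j \<Rightarrow> c j"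
      have const: "lincomb gs c = Const (ceval (lincomb gs c) a)"
        using c(2) by (simp add: shifted_def)
      then have "ceval (lincomb gs c) a = Poly_Mapping.lookup (lincomb gs c) 0"
        by (metis Const_def lookup_single_eq)
      then have "lincomb gs c = Const (e z)"
        using const by (simp add: z_def lookup_lincomb)
      then have "lincomb (1 # gs) ?c = 0"
        by (simp add: split hom_uminus Const_def single_uminus)
      moreover have "?c \<in> supported (length (1 # gs))"
        using c(1) by (auto simp: supported_def invariant_vectors_def split: nat.split)
      ultimately have c_0: "?c = 0"
        using * by blast
      have "c j = 0" for j
        using fun_cong[OF c_0, of "Suc j"] by simp
      then show "c = 0"
        by (simp add: fun_eq_iff)
    qed
  qed
  also have "\<dots> \<longleftrightarrow> lin_independent e (1 # map to_complex gs)"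
    unfolding lin_independent_iff[symmetric] by simp
  finally show ?thesis .
qed

end

end

section \<open>The two scalar fields and the final bounds\<close>

lemma of_rat_rat [simp]: "(of_rat q :: rat) = q"
  by (metis id_apply of_rat_eq_id)

lemma scalar_embedding_complex: "scalar_embedding (\<lambda>c::complex. c)"
  by unfold_locales simp_all

lemma scalar_embedding_rat: "scalar_embedding (of_rat :: rat \<Rightarrow> complex)"
  by unfold_locales (simp only: of_rat_rat)

lemma valid_input_nth:
  assumes "valid_input n gs Fs" "i < length Fs"
  shows "length (Fs ! i) = n" "p \<in> set (Fs ! i) \<Longrightarrow> indets p \<subseteq> {..<n}"
  using assms nth_mem[OF assms(2)] unfolding valid_input_def by blast+

text \<open>Correctness concerns every valid input, so degree bounds are read off from the input,
  with a successor for the maps because \<open>computes_specific_form\<close> asks for positive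
  ones. Only the result is kept.\<close>

lemma specific_form_eq:
  assumes "valid_input n gs Fs"
  shows "specific_form n gs Fs = specific_form_value n gs Fs"
proof -
  define deg :: "rat mpoly list \<Rightarrow> nat" where "deg ps = Max (insert 0 (total_degree ` set ps))" for ps
  have deg: "total_degree p \<le> deg ps" if "p \<in> set ps" for p ps
    using that by (auto simp: deg_def)
  have "computes (specific_form_counted n gs Fs) (specific_form_value n gs Fs)
    ((\<Sum>i<length Fs. 2 * subst_cost n (deg gs) (Suc (deg (Fs ! i))) +
       2 * length gs * (num_mon n (deg gs) * num_mon n (deg gs * Suc (deg (Fs ! i)))) +
       length gs * num_mon n (deg gs * Suc (deg (Fs ! i))) +
       6 * length gs ^ 2 * num_mon n (deg gs * Suc (deg (Fs ! i)))) + 3 * length gs ^ 2 * num_mon n (deg gs))"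
    by (rule computes_specific_form)
      (use assms deg in \<open>simp_all add: valid_input_nth[OF assms] valid_input_def bounded_poly_iff le_SucI\<close>)
  from computes_run(1)[OF this] show ?thesis
    unfolding specific_form_def .
qed

lemma specific_form_ops_le:
  assumes "sized_input n gs Fs d f"
  shows "specific_form_ops n gs Fs \<le> (\<Sum>i<length Fs. map_cost n (length gs) d (f i))"
proof -
  let ?m = "length gs"
  have f: "f i \<ge> 1" if "i < length Fs" for i
    using assms that by (simp add: sized_input_def)
  have valid: "valid_input n gs Fs"
    using assms by (simp add: sized_input_def)
  have "computes (specific_form_counted n gs Fs) (specific_form_value n gs Fs)
    ((\<Sum>i<length Fs. 2 * subst_cost n d (f i) + 2 * ?m * (num_mon n d * num_mon n (d * f i)) +
       ?m * num_mon n (d * f i) + 6 * ?m ^ 2 * num_mon n (d * f i)) + 3 * ?m ^ 2 * num_mon n d)"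
    by (rule computes_specific_form)
      (use assms in \<open>simp_all add: valid_input_nth[OF valid] sized_input_def valid_input_def
        bounded_poly_iff\<close>)
  from computes_run(2)[OF this] have "specific_form_ops n gs Fs \<le>
    (\<Sum>i<length Fs. 2 * subst_cost n d (f i) + 2 * ?m * (num_mon n d * num_mon n (d * f i)) +
       ?m * num_mon n (d * f i) + 6 * ?m ^ 2 * num_mon n (d * f i)) + 3 * ?m ^ 2 * num_mon n d"
    unfolding specific_form_ops_def .
  \<comment> \<open>The share of map 0 alone covers the output; it exists because \<open>Fs\<close>
    is nonempty.\<close>
  also have "3 * ?m ^ 2 * num_mon n d \<le> (\<Sum>i<length Fs. 3 * ?m ^ 2 * num_mon n (d * f i))"
  proof -
    have "0 < length Fs"
      using assms by (simp add: sized_input_def)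
    have "3 * ?m ^ 2 * num_mon n d \<le> 3 * ?m ^ 2 * num_mon n (d * f 0)"
      by (intro mult_left_mono num_mon_mono) (use f[OF \<open>0 < length Fs\<close>] in auto)
    also have "\<dots> \<le> (\<Sum>i<length Fs. 3 * ?m ^ 2 * num_mon n (d * f i))"
      by (rule member_le_sum) (use \<open>0 < length Fs\<close> in auto)
    finally show ?thesis .
  qed
  also have "(\<Sum>i<length Fs. 2 * subst_cost n d (f i) + 2 * ?m * (num_mon n d * num_mon n (d * f i)) +
       ?m * num_mon n (d * f i) + 6 * ?m ^ 2 * num_mon n (d * f i)) +
      (\<Sum>i<length Fs. 3 * ?m ^ 2 * num_mon n (d * f i)) \<le> (\<Sum>i<length Fs. map_cost n ?m d (f i))"
    unfolding sum.distrib[symmetric]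
  proof (rule sum_mono)
    fix i
    have "?m * num_mon n (d * f i) \<le> ?m ^ 2 * num_mon n (d * f i)"
      by (simp only: power2_eq_square le_square mult_le_mono1)
    then show "2 * subst_cost n d (f i) + 2 * ?m * (num_mon n d * num_mon n (d * f i)) +
       ?m * num_mon n (d * f i) + 6 * ?m ^ 2 * num_mon n (d * f i) + 3 * ?m ^ 2 * num_mon n (d * f i)
        \<le> map_cost n ?m d (f i)"
      unfolding map_cost_def by linarith
  qed
  finally show ?thesis
    by simp
qed

lemma specific_form_ops_le_operation_bound:
  assumes sized: "sized_input n gs Fs d f"
    and bound: "\<And>i. i < length Fs \<Longrightarrow>
      real (map_cost n (length gs) d (f i)) \<le> C * map_bound n (length gs) d (f i)"
  shows "real (specific_form_ops n gs Fs) \<le> C * operation_bound n (length gs) (length Fs) d f"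
proof -
  have "real (specific_form_ops n gs Fs) \<le> real (\<Sum>i<length Fs. map_cost n (length gs) d (f i))"
    using specific_form_ops_le[OF sized] by (rule of_nat_mono)
  also have "\<dots> \<le> (\<Sum>i<length Fs. C * map_bound n (length gs) d (f i))"
    unfolding of_nat_sum by (rule sum_mono) (use bound in auto)
  also have "\<dots> = C * operation_bound n (length gs) (length Fs) d f"
    by (simp add: operation_bound_def map_bound_def ratio_def sum_distrib_left)
  finally show ?thesis .
qed

lemma specific_form_ops_le_power:
  assumes sized: "sized_input n gs Fs d f" and M: "d * Max (f ` {..<length Fs}) \<ge> 2"
  shows "specific_form_ops n gs Fs \<le>
    length Fs * length gs ^ 2 * (d * Max (f ` {..<length Fs})) ^ (12 * n)"
proof -
  have "specific_form_ops n gs Fs \<le> (\<Sum>i<length Fs. map_cost n (length gs) d (f i))"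
    by (rule specific_form_ops_le[OF sized])
  also have "\<dots> \<le> (\<Sum>i<length Fs. length gs ^ 2 * (d * Max (f ` {..<length Fs})) ^ (12 * n))"
  proof (rule sum_mono)
    fix i assume "i \<in> {..<length Fs}"
    then show "map_cost n (length gs) d (f i) \<le> length gs ^ 2 * (d * Max (f ` {..<length Fs})) ^ (12 * n)"
      using sized M by (intro map_cost_le_power mult_left_mono Max_ge)
        (auto simp: sized_input_def Suc_le_eq)
  qed
  finally show ?thesis
    by simp
qed

text \<open>Three bounds, because the hidden constants have different reach. One constant for all n
  goes with degree products of at least 2; a constant depending on n also covers the product 1,
  where n + 1 monomials face the base 1. In the last bound the constants sit in the exponent, which
  takes a base of at least 2.\<close>

theorem theorem5p5:
  shows
    "(\<forall>n gs Fs. valid_input n gs Fs \<longrightarrow>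
        (\<forall>P\<in>set (specific_form n gs Fs). indets P \<subseteq> {..<2 * n}) \<and>
        (\<forall>a hs. length a = n \<longrightarrow> (\<forall>h\<in>set hs. h \<noteq> 0 \<and> indets h \<subseteq> {..<n}) \<longrightarrow>
           (let Ps = map (at_initial n a) (specific_form n gs Fs);
                V = invariants_of_form (\<lambda>c::complex. c) n a hs gs Fs;
                V\<^sub>Q = invariants_of_form (of_rat :: rat \<Rightarrow> complex) n a hs gs Fs
            in spanned (\<lambda>c::complex. c) (set Ps) = V \<and>
               spanned (of_rat :: rat \<Rightarrow> complex) (set Ps) = V\<^sub>Q \<and>
               (is_basis (\<lambda>c::complex. c) Ps V \<longleftrightarrow>
                  lin_independent (\<lambda>c::complex. c) (1 # map to_complex gs)) \<and>
               (is_basis (of_rat :: rat \<Rightarrow> complex) Ps V\<^sub>Q \<longleftrightarrow>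
                  lin_independent (of_rat :: rat \<Rightarrow> complex) (1 # map to_complex gs))))) \<and>
     (\<exists>C. \<forall>n gs Fs dg dF. sized_input n gs Fs dg dF \<longrightarrow>
        (\<forall>i<length Fs. dg * dF i \<ge> 2) \<longrightarrow>
        real (specific_form_ops n gs Fs) \<le>
          C * operation_bound n (length gs) (length Fs) dg dF) \<and>
     (\<forall>n. \<exists>C. \<forall>gs Fs dg dF. sized_input n gs Fs dg dF \<longrightarrow>
        real (specific_form_ops n gs Fs) \<le>
          C * operation_bound n (length gs) (length Fs) dg dF) \<and>
     (\<exists>c. \<forall>n gs Fs dg dF. sized_input n gs Fs dg dF \<longrightarrow>
        dg * Max (dF ` {..<length Fs}) \<ge> 2 \<longrightarrow>
        specific_form_ops n gs Fs \<le>
          length Fs * length gs ^ 2 * (dg * Max (dF ` {..<length Fs})) ^ (c * n))"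
proof (intro conjI allI impI)
  fix n gs Fs assume valid: "valid_input n gs Fs"
  note eq = specific_form_eq[OF valid]
  show "\<forall>P\<in>set (specific_form n gs Fs). indets P \<subseteq> {..<2 * n}"
    using valid by (auto simp: eq specific_form_value_def valid_input_def
        intro!: subsetD[OF indets_minus_at_start[OF indets_combination], unfolded lessThan_iff])
next
  fix n gs Fs and a :: "complex list" and hs :: "rat mpoly list"
  assume valid: "valid_input n gs Fs" and a: "length a = n"
    and "\<forall>h\<in>set hs. h \<noteq> 0 \<and> indets h \<subseteq> {..<n}"
  then have hs: "\<And>h. h \<in> set hs \<Longrightarrow> h \<noteq> 0 \<and> indets h \<subseteq> {..<n}"
    by blast
  note eq = specific_form_eq[OF valid]
  interpret C: scalar_embedding "\<lambda>c::complex. c"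
    by (rule scalar_embedding_complex)
  interpret Q: scalar_embedding "of_rat :: rat \<Rightarrow> complex"
    by (rule scalar_embedding_rat)
  show "let Ps = map (at_initial n a) (specific_form n gs Fs);
            V = invariants_of_form (\<lambda>c::complex. c) n a hs gs Fs;
            V\<^sub>Q = invariants_of_form (of_rat :: rat \<Rightarrow> complex) n a hs gs Fs
        in spanned (\<lambda>c::complex. c) (set Ps) = V \<and>
           spanned (of_rat :: rat \<Rightarrow> complex) (set Ps) = V\<^sub>Q \<and>
           (is_basis (\<lambda>c::complex. c) Ps V \<longleftrightarrow>
              lin_independent (\<lambda>c::complex. c) (1 # map to_complex gs)) \<and>
           (is_basis (of_rat :: rat \<Rightarrow> complex) Ps V\<^sub>Q \<longleftrightarrow>
              lin_independent (of_rat :: rat \<Rightarrow> complex) (1 # map to_complex gs))"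
    unfolding Let_def eq is_basis_def
    using C.spanned_specific_form[OF valid a hs] Q.spanned_specific_form[OF valid a hs]
      C.lin_independent_specific_form_iff[OF valid a] Q.lin_independent_specific_form_iff[OF valid a]
    by blast
next
  obtain C where C: "\<And>n m d f. n \<ge> 1 \<Longrightarrow> m \<ge> 1 \<Longrightarrow> d * f \<ge> 2 \<Longrightarrow>
      real (map_cost n m d f) \<le> C * map_bound n m d f"
    using map_cost_bound by blast
  have "real (specific_form_ops n gs Fs) \<le> C * operation_bound n (length gs) (length Fs) d f"
    if "sized_input n gs Fs d f" "\<forall>i<length Fs. d * f i \<ge> 2" for n gs Fs d f
    by (rule specific_form_ops_le_operation_bound[OF that(1)], rule C)
      (use that in \<open>auto simp: sized_input_def Suc_le_eq\<close>)
  then show "\<exists>C. \<forall>n gs Fs dg dF. sized_input n gs Fs dg dF \<longrightarrow>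
      (\<forall>i<length Fs. dg * dF i \<ge> 2) \<longrightarrow>
      real (specific_form_ops n gs Fs) \<le> C * operation_bound n (length gs) (length Fs) dg dF"
    by blast
next
  fix n
  obtain C where C: "\<And>m d f. m \<ge> 1 \<Longrightarrow> d \<ge> 1 \<Longrightarrow> f \<ge> 1 \<Longrightarrow> n \<ge> 1 \<Longrightarrow>
      real (map_cost n m d f) \<le> C * map_bound n m d f"
    using map_cost_bound_fixed by blast
  have "real (specific_form_ops n gs Fs) \<le> C * operation_bound n (length gs) (length Fs) d f"
    if "sized_input n gs Fs d f" for gs Fs d f
    by (rule specific_form_ops_le_operation_bound[OF that], rule C)
      (use that in \<open>auto simp: sized_input_def Suc_le_eq\<close>)
  then show "\<exists>C. \<forall>gs Fs dg dF. sized_input n gs Fs dg dF \<longrightarrow>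
      real (specific_form_ops n gs Fs) \<le> C * operation_bound n (length gs) (length Fs) dg dF"
    by blast
next
  show "\<exists>c. \<forall>n gs Fs dg dF. sized_input n gs Fs dg dF \<longrightarrow>
      dg * Max (dF ` {..<length Fs}) \<ge> 2 \<longrightarrow>
      specific_form_ops n gs Fs \<le>
        length Fs * length gs ^ 2 * (dg * Max (dF ` {..<length Fs})) ^ (c * n)"
    using specific_form_ops_le_power by blast
qed

end
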